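(* Let $Q>1$ and let $(X,d,\mu)$ and $(Y,\sigma,\nu)$ be locally compact Ahlfors $Q$-regular metric measure spaces. If $f:X\to Y$ is a quasimöbius homeomorphism and $(X,d,\mu)$ is $Q$-Loewner, then $(Y,\sigma,\nu)$ is also $Q$-Loewner.
   Context: A metric measure space $(X,d,\mu)$ ($\mu$ a positive Borel measure) is Ahlfors $Q$-regular if there is $C\ge1$ with $C^{-1}R^Q\le\mu(B(x,R))\le CR^Q$ for all $x\in X$ and $0<R<\operatorname{diam}(X)$ (possibly $\operatorname{diam}(X)=\infty$). Cross ratio: for points $a,b,c,e$ of a metric space with $a\ne b$, $c\ne e$, $r(a,b,c,e)=\dfrac{d(a,c)d(b,e)}{d(a,b)d(c,e)}$. A homeomorphism $f:X\to Y$ is quasimöbius if there is a homeomorphism $\theta:[0,\infty)\to[0,\infty)$ such that $r(a,b,c,e)\le t$ implies $r(f(a),f(b),f(c),f(e))\le\theta(t)$ for all $a,b,c,e\in X$ (with $a\ne b$, $c\neq e$) and $t\geq 0$ (the cross ratio in $Y$ being computed with $\sigma$). Modulus: for a family $\Gamma$ of nonconstant curves in $X$, a Borel function $g:X\to[0,\infty]$ is admissible if $\int_\gamma g\,ds\ge1$ for all locally rectifiable $\gamma\in\Gamma$, and $\mathrm{mod}_Q\Gamma=\inf\int_X g^Q\,d\mu$ over all admissible $g$. For $E,F\subset X$, $\Gamma(E,F)$ denotes the collection of rectifiable curves connecting $E$ and $F$ in $X$. For disjoint nondegenerate closed continua $E,F\subset X$ put $\Delta(E,F)=\dfrac{d(E,F)}{\min\{\operatorname{diam}E,\operatorname{diam}F\}}$,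 where $d(E,F)=\inf\{d(x,y):x\in E,y\in F\}$. The space $(X,d,\mu)$ is $Q$-Loewner if there is a decreasing (i.e. non-increasing) function $\eta:(0,\infty)\to(0,\infty)$ such that $\mathrm{mod}_Q(\Gamma(E,F))\ge\eta(\Delta(E,F))$ for every pair of disjoint nondegenerate continua $E,F$ in $X$. *)

theory Defs
  imports "HOL-Analysis.Analysis"
begin

text \<open>A metric measure space is a type of class \<open>metric_space\<close> together with a measure on its
  Borel sets. The library's \<open>diameter\<close> is meaningful for bounded sets only, so the possibly
  infinite diameter of the whole space is taken in \<open>ennreal\<close>.\<close>

definition ediameter :: "'a::metric_space set \<Rightarrow> ennreal" where
  "ediameter S = (SUP x\<in>S. SUP y\<in>S. ennreal (dist x y))"

definition Ahlfors_regular :: "real \<Rightarrow> 'a::metric_space measure \<Rightarrow> bool" where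
  "Ahlfors_regular Q \<mu> \<longleftrightarrow>
     (\<exists>C\<ge>1. \<forall>x. \<forall>R>0. ennreal R < ediameter (UNIV :: 'a set) \<longrightarrow>
        ennreal (inverse C * R powr Q) \<le> emeasure \<mu> (ball x R) \<and>
        emeasure \<mu> (ball x R) \<le> ennreal (C * R powr Q))"


subsection \<open>Quasimoebius maps\<close>

definition cross_ratio :: "'a::metric_space \<Rightarrow> 'a \<Rightarrow> 'a \<Rightarrow> 'a \<Rightarrow> real" where
  "cross_ratio a b c e = (dist a c * dist b e) / (dist a b * dist c e)"

definition quasimoebius :: "('a::metric_space \<Rightarrow> 'b::metric_space) \<Rightarrow> bool" where
  "quasimoebius f \<longleftrightarrow>
     (\<exists>g. homeomorphism UNIV UNIV f g) \<and>
     (\<exists>\<theta> \<theta>' :: real \<Rightarrow> real. homeomorphism {0..} {0..} \<theta> \<theta>' \<and>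
        (\<forall>a b c e. \<forall>t\<ge>0. a \<noteq> b \<longrightarrow> c \<noteq> e \<longrightarrow> cross_ratio a b c e \<le> t \<longrightarrow>
           cross_ratio (f a) (f b) (f c) (f e) \<le> \<theta> t))"


subsection \<open>Curves and line integrals\<close>

text \<open>A curve is a parameter interval together with a map; the values of the map outside the
  interval are irrelevant.\<close>

type_synonym 'a curve = "real set \<times> (real \<Rightarrow> 'a)"

definition is_curve :: "'a::metric_space curve \<Rightarrow> bool" where
  "is_curve = (\<lambda>(I, \<gamma>). is_interval I \<and> I \<noteq> {} \<and> continuous_on I \<gamma>)"

definition curve_length :: "real set \<Rightarrow> (real \<Rightarrow> 'a::metric_space) \<Rightarrow> ennreal" where
  "curve_length I \<gamma> =
     (SUP (n, t) \<in> {(n :: nat, t :: nat \<Rightarrow> real). t ` {..n} \<subseteq> I \<and> mono_on {..n} t}.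
        \<Sum>i<n. ennreal (dist (\<gamma> (t i)) (\<gamma> (t (Suc i)))))"

definition rectifiable :: "'a::metric_space curve \<Rightarrow> bool" where
  "rectifiable = (\<lambda>(I, \<gamma>). curve_length I \<gamma> < \<infinity>)"

definition locally_rectifiable :: "'a::metric_space curve \<Rightarrow> bool" where
  "locally_rectifiable = (\<lambda>(I, \<gamma>). \<forall>a b. {a..b} \<subseteq> I \<longrightarrow> curve_length {a..b} \<gamma> < \<infinity>)"

text \<open>The arc length parametrization of a rectifiable curve on \<open>{a..b}\<close>, defined for arc length
  \<open>u\<close> between 0 and the total length. The choice of \<open>t\<close> does not matter: between two parameters
  with the same arc length the curve is constant.\<close>

definition arclength_param :: "real \<Rightarrow> real \<Rightarrow> (real \<Rightarrow> 'a::metric_space) \<Rightarrow> real \<Rightarrow> 'a" where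
  "arclength_param a b \<gamma> u =
     \<gamma> (SOME t. t \<in> {a..b} \<and> curve_length {a..t} \<gamma> = ennreal u)"

text \<open>Over a locally rectifiable curve one takes the supremum over all compact subcurves. On a
  rectifiable curve with compact parameter interval it is attained at the whole curve.\<close>

definition line_integral :: "'a::metric_space curve \<Rightarrow> ('a \<Rightarrow> ennreal) \<Rightarrow> ennreal" where
  "line_integral = (\<lambda>(I, \<gamma>) g.
     (SUP (a, b) \<in> {(a, b). a \<le> b \<and> {a..b} \<subseteq> I}.
        \<integral>\<^sup>+u\<in>{0..enn2real (curve_length {a..b} \<gamma>)}. g (arclength_param a b \<gamma> u) \<partial>lborel))"


subsection \<open>Modulus and the Loewner condition\<close>

text \<open>Real powers with positive exponent on \<open>[0, \<infinity>]\<close>.\<close>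

definition ennpowr :: "ennreal \<Rightarrow> real \<Rightarrow> ennreal" where
  "ennpowr x p = (if x = \<infinity> then \<infinity> else ennreal (enn2real x powr p))"

definition admissible :: "'a::metric_space curve set \<Rightarrow> ('a \<Rightarrow> ennreal) \<Rightarrow> bool" where
  "admissible \<Gamma> g \<longleftrightarrow>
     g \<in> borel_measurable borel \<and> (\<forall>c\<in>\<Gamma>. locally_rectifiable c \<longrightarrow> 1 \<le> line_integral c g)"

definition modulus :: "real \<Rightarrow> 'a::metric_space measure \<Rightarrow> 'a curve set \<Rightarrow> ennreal" where
  "modulus Q \<mu> \<Gamma> = (INF g \<in> {g. admissible \<Gamma> g}. \<integral>\<^sup>+x. ennpowr (g x) Q \<partial>\<mu>)"

definition connecting_curves :: "'a::metric_space set \<Rightarrow> 'a set \<Rightarrow> 'a curve set" where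
  "connecting_curves E F =
     {({a..b}, \<gamma>) | a b \<gamma>. is_curve ({a..b}, \<gamma>) \<and> rectifiable ({a..b}, \<gamma>) \<and>
        (\<gamma> a \<in> E \<and> \<gamma> b \<in> F \<or> \<gamma> a \<in> F \<and> \<gamma> b \<in> E)}"

definition nondegenerate_continuum :: "'a::metric_space set \<Rightarrow> bool" where
  "nondegenerate_continuum E \<longleftrightarrow> compact E \<and> connected E \<and> (\<exists>x\<in>E. \<exists>y\<in>E. x \<noteq> y)"

definition relative_distance :: "'a::metric_space set \<Rightarrow> 'a set \<Rightarrow> real" where
  "relative_distance E F = setdist E F / min (diameter E) (diameter F)"

definition Loewner :: "real \<Rightarrow> 'a::metric_space measure \<Rightarrow> bool" where
  "Loewner Q \<mu> \<longleftrightarrow>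
     (\<exists>\<eta> :: real \<Rightarrow> real. (\<forall>t>0. \<eta> t > 0) \<and> antimono_on {0<..} \<eta> \<and>
        (\<forall>E F. nondegenerate_continuum E \<longrightarrow> nondegenerate_continuum F \<longrightarrow> E \<inter> F = {} \<longrightarrow>
           ennreal (\<eta> (relative_distance E F)) \<le> modulus Q \<mu> (connecting_curves E F)))"

end

theory Submission
  imports Defs
begin

text \<open>For a rectifiable curve in \<open>X\<close>, the function \<open>x \<mapsto> osc e x / e\<close>, where \<open>osc e x\<close> is the
  oscillation of \<open>f\<close> on the ball of radius \<open>e\<close>, acts as an upper gradient of \<open>f\<close> at scale \<open>e\<close>.
  Given an admissible function on \<open>Y\<close>, take a lower semicontinuous majorant \<open>h\<close> of almost the
  same energy, and multiply this upper gradient by the infimum of \<open>h \<circ> f\<close> over the ball. The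
  Moebius condition places a ball of radius comparable to \<open>osc e x\<close> in the image of the ball
  around \<open>x\<close>, so Ahlfors regularity of both spaces and Fubini bound the \<open>Q\<close>-energy of the product
  by a fixed multiple of that of \<open>h\<close>. As \<open>e\<close> tends to 0, each fixed curve eventually has integral
  at least 1/8, also if its image is not rectifiable, because \<open>h\<close> is positive. Uniform convexity of
  \<open>L\<^sup>Q\<close> converts this sequence, admissible only in the limit, into one admissible function.
  Hence modulus decreases by at most a constant factor, and the distortion of relative distances
  under quasimoebius maps gives the new Loewner function.\<close>

section \<open>Almost admissible sequences\<close>

text \<open>Working at a positive scale \<open>e\<close> avoids differentiability, absolute
  continuity along curves and change of variables for \<open>f\<close>: the measure of an image ball
  plays the role of the Jacobian, and the factor \<open>e powr Q\<close> from regularity of X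
  cancels \<open>(1 / e) powr Q\<close>. Lower semicontinuity makes the infimum of
  \<open>h \<circ> f\<close> over shrinking balls increase to \<open>h \<circ> f\<close> at every
  point, so no exceptional curve family arises. Curves enter the limit as Borel measures
  (\<open>path_measure\<close>), so that step concerns integrals against an arbitrary family of
  measures. Fubini needs sigma-finiteness and product measurability, which may fail in a
  nonseparable space; since continua and curves are connected, one clopen separable piece
  \<open>U\<close> meeting \<open>E\<close> is enough. The value 1/8 is 1/2, kept from the bound 1
  after approximation, times 1/4: pieces have arc length at least \<open>e / 2\<close>, and on them
  \<open>osc\<close> is at least half the increment of \<open>f\<close>.\<close>

lemma ennpowr_ennreal: "0 \<le> x \<Longrightarrow> ennpowr (ennreal x) p = ennreal (x powr p)"
  by (simp add: ennpowr_def)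

text \<open>\<open>D\<close> is the convexity deficit of the pair (1, t). Its derivative is Q/2
  times \<open>x powr (Q - 1) - ((1 + x) / 2) powr (Q - 1)\<close>, which is negative because x < (1
  + x) / 2.\<close>

lemma midpoint_powr_gap:
  fixes Q t :: real
  assumes Q: "Q > 1" and t: "0 \<le> s" "s < t" "t \<le> 1"
  defines "D \<equiv> \<lambda>t. (1 + t powr Q) / 2 - ((1 + t) / 2) powr Q"
  shows "D t < D s"
proof (rule DERIV_neg_imp_decreasing_open[OF t(2)])
  fix x assume x: "s < x" "x < t"
  then have x01: "0 < x" "x < 1" using t by auto
  have "(D has_real_derivative (Q * x powr (Q - 1)) / 2 - Q * ((1 + x) / 2) powr (Q - 1) * (1 / 2)) (at x)"
    unfolding D_def using x01 by (auto intro!: derivative_eq_intros)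
  moreover have "x powr (Q - 1) < ((1 + x) / 2) powr (Q - 1)"
    using x01 Q by (intro powr_less_mono2) auto
  then have "(Q * x powr (Q - 1)) / 2 - Q * ((1 + x) / 2) powr (Q - 1) * (1 / 2) < 0"
    using Q by (simp add: field_simps)
  ultimately show "\<exists>y. (D has_real_derivative y) (at x) \<and> y < 0" by blast
next
  show "continuous_on {s..t} D"
    unfolding D_def using Q t by (intro continuous_intros continuous_on_powr') auto
qed

text \<open>A pointwise substitute for Clarkson's inequalities, uniform in all Q > 1. Homogeneity
  reduces it to the pair (1, t): near t = 1 the term with \<open>e\<close> suffices, elsewhere the
  deficit is bounded away from 0 and \<open>C\<close> absorbs the left side.\<close>

lemma uniform_convexity_powr:
  fixes Q e :: real
  assumes Q: "Q > 1" and e: "e > 0"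
  obtains C where "C \<ge> 0" and "\<And>a b :: real. \<lbrakk>0 \<le> a; 0 \<le> b\<rbrakk> \<Longrightarrow>
     \<bar>a - b\<bar> powr Q \<le> e * (a powr Q + b powr Q) + C * ((a powr Q + b powr Q) / 2 - ((a + b) / 2) powr Q)"
proof -
  define D where "D \<equiv> \<lambda>t::real. (1 + t powr Q) / 2 - ((1 + t) / 2) powr Q"
  have D1: "D 1 = 0" by (simp add: D_def)
  have Dmono: "D t \<le> D s" if "0 \<le> s" "s \<le> t" "t \<le> 1" for s t
    using midpoint_powr_gap[OF Q, of s t] that by (cases "s = t") (auto simp: D_def)
  \<comment> \<open>Beyond this threshold \<open>(1 - t) powr Q\<close> is at most \<open>e\<close>;
    the maximum with 0 covers large \<open>e\<close>.\<close>
  define t0 where "t0 = max 0 (1 - e powr (1 / Q))"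
  have t0: "0 \<le> t0" "t0 < 1" using e by (auto simp: t0_def)
  have Dt0: "D t0 > 0" using midpoint_powr_gap[OF Q, of t0 1] t0 D1 by (simp add: D_def)
  define C where "C = 1 / D t0"
  have C: "C \<ge> 0" using Dt0 by (simp add: C_def)
  have key: "(1 - t) powr Q \<le> e * (1 + t powr Q) + C * D t" if t: "0 \<le> t" "t \<le> 1" for t
  proof (cases "t \<le> t0")
    case True
    have "(1 - t) powr Q \<le> 1" using t Q by (intro powr_le1) auto
    also have "\<dots> = C * D t0" using Dt0 by (simp add: C_def)
    also have "\<dots> \<le> C * D t" using C Dmono[of t t0] True t t0 by (intro mult_left_mono) auto
    finally show ?thesis using e by (smt (verit) mult_nonneg_nonneg powr_ge_zero)
  next
    case False
    then have "1 - t \<le> e powr (1 / Q)" by (auto simp: t0_def)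
    then have "(1 - t) powr Q \<le> (e powr (1 / Q)) powr Q" using t Q by (intro powr_mono2) auto
    also have "\<dots> = e" using e Q by (simp add: powr_powr)
    also have "\<dots> \<le> e * (1 + t powr Q)" using e by simp
    also have "\<dots> \<le> e * (1 + t powr Q) + C * D t" using C Dmono[of t 1] t D1 by simp
    finally show ?thesis .
  qed
  have key2: "\<bar>a - b\<bar> powr Q \<le> e * (a powr Q + b powr Q) + C * ((a powr Q + b powr Q) / 2 - ((a + b) / 2) powr Q)"
    if ab: "0 \<le> b" "b \<le> a" for a b :: real
  proof (cases "a = 0")
    case True then show ?thesis using ab by simp
  next
    case False
    then have a: "a > 0" using ab by simp
    define t where "t = b / a"
    have t: "0 \<le> t" "t \<le> 1" "b = a * t" using ab a by (auto simp: t_def)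
    have "\<bar>a - b\<bar> = a * (1 - t)" using t a ab by (simp add: algebra_simps)
    then have 1: "\<bar>a - b\<bar> powr Q = a powr Q * (1 - t) powr Q"
      using a t by (simp add: powr_mult)
    have 2: "b powr Q = a powr Q * t powr Q" using a t by (simp add: powr_mult)
    have "(a + b) / 2 = a * ((1 + t) / 2)" using t by (simp add: algebra_simps)
    then have 3: "((a + b) / 2) powr Q = a powr Q * ((1 + t) / 2) powr Q"
      using a t by (metis powr_mult)
    have "a powr Q * (1 - t) powr Q \<le> a powr Q * (e * (1 + t powr Q) + C * D t)"
      using key[OF t(1,2)] by (intro mult_left_mono) auto
    also have "\<dots> = e * (a powr Q + b powr Q) + C * ((a powr Q + b powr Q) / 2 - ((a + b) / 2) powr Q)"
      unfolding 2 3 D_def by (simp add: algebra_simps add_divide_distrib diff_divide_distrib)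
    finally show ?thesis unfolding 1 .
  qed
  show ?thesis
  proof (rule that[OF C])
    fix a b :: real assume "0 \<le> a" "0 \<le> b"
    then show "\<bar>a - b\<bar> powr Q \<le> e * (a powr Q + b powr Q) + C * ((a powr Q + b powr Q) / 2 - ((a + b) / 2) powr Q)"
      using key2[of b a] key2[of a b] by (cases "b \<le> a") (auto simp: abs_minus_commute add.commute)
  qed
qed

lemma midpoint_powr_le:
  fixes Q a b :: real
  assumes Q: "Q > 1" and "0 \<le> a" "0 \<le> b"
  shows "((a + b) / 2) powr Q \<le> (a powr Q + b powr Q) / 2"
proof -
  have *: "((x + y) / 2) powr Q \<le> (x powr Q + y powr Q) / 2" if xy: "0 \<le> y" "y \<le> x" "0 < x" for x y :: real
  proof -
    have "0 \<le> (1 + (y/x) powr Q) / 2 - ((1 + y/x) / 2) powr Q"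
      using midpoint_powr_gap[OF Q, of "y/x" 1] xy by (cases "y = x") auto
    then have "x powr Q * (((1 + y/x) / 2) powr Q) \<le> x powr Q * ((1 + (y/x) powr Q) / 2)"
      by (intro mult_left_mono) auto
    moreover have "(x + y) / 2 = x * ((1 + y/x) / 2)" using xy by (simp add: field_simps)
    then have "x powr Q * (((1 + y/x) / 2) powr Q) = ((x + y) / 2) powr Q"
      by (metis powr_mult)
    moreover have "x powr Q * ((1 + (y/x) powr Q) / 2) = (x powr Q + y powr Q) / 2"
      using xy by (simp add: powr_divide field_simps)
    ultimately show ?thesis by simp
  qed
  consider "b \<le> a" "a > 0" | "a \<le> b" "b > 0" | "a = 0" "b = 0"
    using assms by linarith
  then show ?thesis
    using *[of b a] *[of a b] assms by cases (simp_all add: add.commute)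
qed

lemma powr_add_le:
  fixes a b p :: real
  assumes "0 \<le> a" "0 \<le> b" "0 \<le> p"
  shows "(a + b) powr p \<le> 2 powr p * (a powr p + b powr p)"
proof -
  have "(a + b) powr p \<le> (2 * max a b) powr p" using assms by (intro powr_mono2) auto
  also have "\<dots> = 2 powr p * max a b powr p" using assms by (simp add: powr_mult)
  also have "\<dots> \<le> 2 powr p * (a powr p + b powr p)" by (intro mult_left_mono) (auto simp: max_def)
  finally show ?thesis .
qed

lemma ennpowr_mono:
  assumes "x \<le> y" "0 \<le> p"
  shows "ennpowr x p \<le> ennpowr y p"
proof (cases "y = \<infinity>")
  case False
  then have "x \<noteq> \<infinity>" "enn2real x \<le> enn2real y"
    using assms by (auto simp: top_unique less_top intro!: enn2real_mono)
  then show ?thesis using False assms by (auto simp: ennpowr_def intro!: ennreal_leI powr_mono2)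
qed (simp add: ennpowr_def)

text \<open>A sequence of almost-minimizers of the \<open>Q\<close>-energy in the convex sets of functions that
  inherit admissibility from a tail of \<open>r\<close> is Cauchy by uniform convexity. The supremum of a
  rapidly converging subsequence is then admissible for every measure, with no exceptional set.\<close>

lemma admissible_limit:
  fixes M :: "'a::topological_space measure" and r :: "nat \<Rightarrow> 'a \<Rightarrow> real"
    and MM :: "'a measure set" and Q B :: real
  assumes Q: "Q > 1" and M: "sets M = sets borel" and B: "B > 0"
    and r_meas: "\<And>n. r n \<in> borel_measurable borel" and r_nn: "\<And>n x. 0 \<le> r n x"
    and r_int: "\<And>n. (\<integral>\<^sup>+x. ennreal (r n x powr Q) \<partial>M) \<le> ennreal B"
    and MM: "\<And>m. m \<in> MM \<Longrightarrow> sets m = sets borel"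
    and adm: "\<And>m. m \<in> MM \<Longrightarrow> \<forall>\<^sub>F n in sequentially. 1 \<le> (\<integral>\<^sup>+x. ennreal (r n x) \<partial>m)"
  obtains \<rho> where "\<rho> \<in> borel_measurable borel"
    "(\<integral>\<^sup>+x. ennpowr (\<rho> x) Q \<partial>M) \<le> ennreal (2 powr Q * (2 * B))"
    "\<And>m. m \<in> MM \<Longrightarrow> 1 \<le> (\<integral>\<^sup>+x. \<rho> x \<partial>m)"
proof -
  have Mb: "borel_measurable M = (borel_measurable borel :: ('a \<Rightarrow> 'c::topological_space) set)"
    using M by (rule measurable_cong_sets) simp
  define E where "E \<equiv> \<lambda>h::'a\<Rightarrow>real. integral\<^sup>L M (\<lambda>x. h x powr Q)"
  \<comment> \<open>These sets are convex and shrink as \<open>n\<close> grows: a measure imposes a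
    condition only if all \<open>r k\<close> with \<open>k \<ge> n\<close> are already admissible
    for it. They are nonempty because \<open>r n\<close> belongs to \<open>K n\<close>.\<close>
  define K where "K \<equiv> \<lambda>n. {h :: 'a \<Rightarrow> real. h \<in> borel_measurable borel \<and> (\<forall>x. 0 \<le> h x) \<and>
     integrable M (\<lambda>x. h x powr Q) \<and> E h \<le> B \<and>
     (\<forall>m\<in>MM. (\<forall>k\<ge>n. 1 \<le> (\<integral>\<^sup>+x. ennreal (r k x) \<partial>m)) \<longrightarrow> 1 \<le> (\<integral>\<^sup>+x. ennreal (h x) \<partial>m))}"
  have rK: "r n \<in> K n" for n
  proof -
    have meas: "(\<lambda>x. r n x powr Q) \<in> borel_measurable M" using r_meas[of n] unfolding Mb by measurable
    have fin: "(\<integral>\<^sup>+x. ennreal (r n x powr Q) \<partial>M) < \<infinity>" using r_int[of n] by (simp add: le_less_trans)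
    have int: "integrable M (\<lambda>x. r n x powr Q)"
      using meas fin by (intro integrableI_nonneg) auto
    then have "ennreal (E (r n)) = (\<integral>\<^sup>+x. ennreal (r n x powr Q) \<partial>M)"
      unfolding E_def by (intro nn_integral_eq_integral[symmetric]) auto
    then have "ennreal (E (r n)) \<le> ennreal B" using r_int[of n] by simp
    then have "E (r n) \<le> B" using B ennreal_le_iff[of B "E (r n)"] by linarith
    then show ?thesis using r_meas r_nn int by (auto simp: K_def)
  qed
  have K_anti: "K n \<subseteq> K k" if "k \<le> n" for k n
    using that unfolding K_def by fastforce
  have diff_int: "integrable M (\<lambda>x. \<bar>h x - h' x\<bar> powr Q)" and mid_K: "(\<lambda>x. (h x + h' x) / 2) \<in> K n"
    if h: "h \<in> K n" "h' \<in> K n" for h h' n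
  proof -
    have meas[measurable]: "h \<in> borel_measurable M" "h' \<in> borel_measurable M"
      and nn: "\<And>x. 0 \<le> h x" "\<And>x. 0 \<le> h' x"
      and int: "integrable M (\<lambda>x. h x powr Q)" "integrable M (\<lambda>x. h' x powr Q)"
      and EB: "E h \<le> B" "E h' \<le> B"
      using h unfolding K_def Mb by auto
    have int2: "integrable M (\<lambda>x. 2 powr Q * (h x powr Q + h' x powr Q))" using int by auto
    have "\<bar>h x - h' x\<bar> powr Q \<le> 2 powr Q * (h x powr Q + h' x powr Q)" for x
    proof -
      have "\<bar>h x - h' x\<bar> powr Q \<le> (h x + h' x) powr Q" using nn[of x] Q by (intro powr_mono2) auto
      also have "\<dots> \<le> 2 powr Q * (h x powr Q + h' x powr Q)" using nn[of x] Q by (intro powr_add_le) auto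
      finally show ?thesis .
    qed
    moreover have "(\<lambda>x. \<bar>h x - h' x\<bar> powr Q) \<in> borel_measurable M" by measurable
    ultimately show "integrable M (\<lambda>x. \<bar>h x - h' x\<bar> powr Q)"
      by (intro Bochner_Integration.integrable_bound[OF int2]) auto
    have int3: "integrable M (\<lambda>x. (h x powr Q + h' x powr Q) / 2)" using int by auto
    have mle: "((h x + h' x) / 2) powr Q \<le> (h x powr Q + h' x powr Q) / 2" for x
      using midpoint_powr_le[OF Q] nn by auto
    have "(\<lambda>x. ((h x + h' x) / 2) powr Q) \<in> borel_measurable M" by measurable
    then have int4: "integrable M (\<lambda>x. ((h x + h' x) / 2) powr Q)"
      using mle by (intro Bochner_Integration.integrable_bound[OF int3]) auto
    have "E (\<lambda>x. (h x + h' x) / 2) \<le> integral\<^sup>L M (\<lambda>x. (h x powr Q + h' x powr Q) / 2)"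
      unfolding E_def by (intro integral_mono int3 int4 mle)
    also have "\<dots> = (E h + E h') / 2" unfolding E_def using int by simp
    also have "\<dots> \<le> B" using EB by simp
    finally have EmB: "E (\<lambda>x. (h x + h' x) / 2) \<le> B" .
    have "1 \<le> (\<integral>\<^sup>+x. ennreal ((h x + h' x) / 2) \<partial>m)"
      if m: "m \<in> MM" "\<forall>k\<ge>n. 1 \<le> (\<integral>\<^sup>+x. ennreal (r k x) \<partial>m)" for m
    proof -
      have mb: "h \<in> borel_measurable m" "h' \<in> borel_measurable m"
        using h MM[OF m(1)] unfolding K_def by (auto cong: measurable_cong_sets)
      have "(\<integral>\<^sup>+x. ennreal ((h x + h' x) / 2) \<partial>m) =
          (\<integral>\<^sup>+x. ennreal (1/2) * ennreal (h x) + ennreal (1/2) * ennreal (h' x) \<partial>m)"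
      proof (intro nn_integral_cong)
        fix x
        have "ennreal ((h x + h' x) / 2) = ennreal (1/2 * h x + 1/2 * h' x)" by (simp add: field_simps)
        also have "\<dots> = ennreal (1/2 * h x) + ennreal (1/2 * h' x)"
          using nn[of x] by (intro ennreal_plus) auto
        finally show "ennreal ((h x + h' x) / 2) = ennreal (1/2) * ennreal (h x) + ennreal (1/2) * ennreal (h' x)"
          using nn[of x] by (simp only: ennreal_mult)
      qed
      also have "\<dots> = ennreal (1/2) * (\<integral>\<^sup>+x. ennreal (h x) \<partial>m) + ennreal (1/2) * (\<integral>\<^sup>+x. ennreal (h' x) \<partial>m)"
        using mb by (simp add: nn_integral_add nn_integral_cmult)
      also have "\<dots> \<ge> ennreal (1/2) * 1 + ennreal (1/2) * 1"
        using h m unfolding K_def by (intro add_mono mult_left_mono) auto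
      also have "ennreal (1/2) * 1 + ennreal (1/2) * 1 = 1"
        using ennreal_plus[of "1/2" "1/2"] by (simp only: mult_1_right) simp
      finally show ?thesis .
    qed
    then show "(\<lambda>x. (h x + h' x) / 2) \<in> K n"
      using h nn EmB int4 unfolding K_def by auto
  qed
  have E_nn: "0 \<le> E h" for h unfolding E_def by simp
  \<comment> \<open>The infimal energies increase with \<open>n\<close> and stay below
    \<open>B\<close>, hence converge.\<close>
  define d where "d \<equiv> \<lambda>n. Inf (E ` K n)"
  have bdd: "bdd_below (E ` K n)" for n using E_nn by (meson bdd_belowI2)
  have d_le: "d n \<le> E h" if "h \<in> K n" for n h
    unfolding d_def using that bdd by (intro cInf_lower) auto
  have d_mono: "d n \<le> d k" if "n \<le> k" for n k
    unfolding d_def using K_anti[OF that] rK[of k] bdd by (intro cInf_superset_mono) auto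
  have d_B: "d n \<le> B" for n using d_le[OF rK] rK[of n] unfolding K_def by (smt (verit) mem_Collect_eq)
  have "\<exists>h. h \<in> K n \<and> E h < d n + 1 / real (Suc n)" for n
  proof -
    have "Inf (E ` K n) < d n + 1 / real (Suc n)" unfolding d_def by simp
    then show ?thesis using cInf_lessD[of "E ` K n"] rK[of n] by blast
  qed
  then obtain h where hK: "\<And>n. h n \<in> K n" and hE: "\<And>n. E (h n) < d n + 1 / real (Suc n)"
    by metis
  obtain dd where dd: "d \<longlonglongrightarrow> dd" and d_dd: "d n \<le> dd" for n
    using incseq_convergent[of d B] d_mono d_B by (metis incseq_def)
  \<comment> \<open>The midpoint of two almost-minimizers in \<open>K N\<close> is again in
    \<open>K N\<close>, so its energy is at least \<open>d N\<close> and the convexity deficit is at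
    most \<open>dd + 1 / real (Suc N) - d N\<close>, which tends to 0. The weight
    \<open>\<eta> / (4 * B)\<close> turns two energies bounded by \<open>B\<close> into
    \<open>\<eta> / 2\<close>.\<close>
  have cauchy: "\<exists>N. \<forall>n\<ge>N. \<forall>k\<ge>N. E (\<lambda>x. \<bar>h n x - h k x\<bar>) \<le> \<eta>" if \<eta>: "\<eta> > 0" for \<eta>
  proof -
    obtain C where C: "C \<ge> 0" and conv: "\<And>a b :: real. \<lbrakk>0 \<le> a; 0 \<le> b\<rbrakk> \<Longrightarrow>
     \<bar>a - b\<bar> powr Q \<le> (\<eta> / (4 * B)) * (a powr Q + b powr Q) + C * ((a powr Q + b powr Q) / 2 - ((a + b) / 2) powr Q)"
      using uniform_convexity_powr[OF Q, of "\<eta> / (4 * B)"] \<eta> B by auto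
    have "(\<lambda>N. C * (dd + 1 / real (Suc N) - d N)) \<longlonglongrightarrow> C * (dd + 0 - dd)"
      by (intro tendsto_intros dd) (use LIMSEQ_inverse_real_of_nat in \<open>simp add: inverse_eq_divide\<close>)
    then have "\<forall>\<^sub>F N in sequentially. C * (dd + 1 / real (Suc N) - d N) < \<eta> / 2"
      using \<eta> by (intro order_tendstoD(2)) auto
    then obtain N where N: "C * (dd + 1 / real (Suc N) - d N) < \<eta> / 2"
      by (auto simp: eventually_sequentially)
    have "E (\<lambda>x. \<bar>h n x - h k x\<bar>) \<le> \<eta>" if nk: "n \<ge> N" "k \<ge> N" for n k
    proof -
      have hn: "h n \<in> K N" "h k \<in> K N" using hK K_anti nk by blast+
      have int: "integrable M (\<lambda>x. h n x powr Q)" "integrable M (\<lambda>x. h k x powr Q)"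
        and EB: "E (h n) \<le> B" "E (h k) \<le> B" and nn: "\<And>x. 0 \<le> h n x" "\<And>x. 0 \<le> h k x"
        using hn unfolding K_def by auto
      have midK: "(\<lambda>x. (h n x + h k x) / 2) \<in> K N" by (rule mid_K[OF hn])
      have intm: "integrable M (\<lambda>x. ((h n x + h k x) / 2) powr Q)" using midK unfolding K_def by auto
      have "E (\<lambda>x. \<bar>h n x - h k x\<bar>) \<le> integral\<^sup>L M (\<lambda>x. (\<eta> / (4 * B)) * (h n x powr Q + h k x powr Q) + C * ((h n x powr Q + h k x powr Q) / 2 - ((h n x + h k x) / 2) powr Q))"
        unfolding E_def using diff_int[OF hn] int intm conv nn by (intro integral_mono) auto
      also have "\<dots> = (\<eta> / (4 * B)) * (E (h n) + E (h k)) + C * ((E (h n) + E (h k)) / 2 - E (\<lambda>x. (h n x + h k x) / 2))"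
        unfolding E_def using int intm by simp
      also have "\<dots> \<le> (\<eta> / (4 * B)) * (B + B) + C * (dd + 1 / real (Suc N) - d N)"
      proof (intro add_mono mult_left_mono EB C)
        have inv: "1 / real (Suc n) \<le> 1 / real (Suc N)" "1 / real (Suc k) \<le> 1 / real (Suc N)"
          using nk by (auto intro!: divide_left_mono)
        have "E (h n) \<le> dd + 1 / real (Suc N)"
          by (rule order_trans[OF less_imp_le[OF hE] add_mono[OF d_dd inv(1)]])
        moreover have "E (h k) \<le> dd + 1 / real (Suc N)"
          by (rule order_trans[OF less_imp_le[OF hE] add_mono[OF d_dd inv(2)]])
        ultimately have "E (h n) + E (h k) \<le> (dd + 1 / real (Suc N)) + (dd + 1 / real (Suc N))"
          by (rule add_mono)
        then have "(E (h n) + E (h k)) / 2 \<le> dd + 1 / real (Suc N)" by simp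
        then show "(E (h n) + E (h k)) / 2 - E (\<lambda>x. (h n x + h k x) / 2) \<le> dd + 1 / real (Suc N) - d N"
          using d_le[OF midK] by (rule diff_mono)
      qed (use \<eta> B in auto)
      also have "\<dots> \<le> \<eta> / 2 + \<eta> / 2" using N B by (intro add_mono) auto
      finally show ?thesis by simp
    qed
    then show ?thesis by blast
  qed
  \<comment> \<open>So small that the differences, scaled by \<open>2 ^ Suc j\<close>, still have
    energies with sum at most \<open>B\<close>.\<close>
  define \<eta> where "\<eta> \<equiv> \<lambda>j::nat. B * (1/2) ^ Suc j / (2 ^ Suc j) powr Q"
  have \<eta>_pos: "\<eta> j > 0" for j using B by (simp add: \<eta>_def)
  obtain \<phi> where \<phi>: "\<And>j n k. n \<ge> \<phi> j \<Longrightarrow> k \<ge> \<phi> j \<Longrightarrow> E (\<lambda>x. \<bar>h n x - h k x\<bar>) \<le> \<eta> j"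
    using cauchy[OF \<eta>_pos] by metis
  \<comment> \<open>The sum puts both \<open>\<psi> j\<close> and \<open>\<psi> (Suc j)\<close>
    beyond \<open>\<phi> j\<close>; the extra summand \<open>j\<close> gives
    \<open>H j \<in> K j\<close>.\<close>
  define \<psi> where "\<psi> \<equiv> \<lambda>j. (\<Sum>i\<le>j. \<phi> i) + j"
  have \<psi>1: "\<psi> j \<ge> \<phi> j" "\<psi> (Suc j) \<ge> \<phi> j" "\<psi> j \<ge> j" for j
    using member_le_sum[of j "{..j}" \<phi>] by (auto simp: \<psi>_def)
  define H where "H \<equiv> \<lambda>j. h (\<psi> j)"
  define w where "w \<equiv> \<lambda>j x. \<bar>H (Suc j) x - H j x\<bar>"
  have HK: "H j \<in> K 0" for j using hK K_anti unfolding H_def by blast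
  have H_meas[measurable]: "H j \<in> borel_measurable borel" and H_nn: "0 \<le> H j x" for j x
    using HK[of j] unfolding K_def by auto
  have H_measM[measurable]: "H j \<in> borel_measurable M" for j unfolding Mb by simp
  have Ew: "E (w j) \<le> \<eta> j" for j unfolding w_def H_def using \<psi>1 by (intro \<phi>) auto
  have w_int: "integrable M (\<lambda>x. w j x powr Q)" for j
    unfolding w_def using diff_int[OF HK HK] .
  have w_nn: "0 \<le> w j x" for j x by (simp add: w_def)
  have w_meas[measurable]: "w j \<in> borel_measurable M" for j unfolding w_def by measurable
  \<comment> \<open>Where \<open>S x\<close> is a real \<open>s\<close>, every \<open>w j x\<close>
    is at most \<open>s powr (1/Q) * (1/2) ^ Suc j\<close>, so by telescoping all
    \<open>H j x\<close> stay below \<open>H 0 x + s powr (1/Q)\<close>. This dominates the supremum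
    by an integrable function.\<close>
  define S where "S \<equiv> \<lambda>x. (\<Sum>j. ennreal ((2 ^ Suc j * w j x) powr Q))"
  define \<rho> where "\<rho> \<equiv> \<lambda>x. (SUP j. ennreal (H j x))"
  have \<rho>S: "ennpowr (\<rho> x) Q \<le> ennreal (2 powr Q) * (ennreal (H 0 x powr Q) + S x)" for x
  proof (cases "S x = \<infinity>")
    case False
    then obtain s where s: "s \<ge> 0" "S x = ennreal s" by (cases "S x") auto
    have "2 ^ Suc j * w j x \<le> s powr (1 / Q)" for j
    proof -
      define c where "c = 2 ^ Suc j * w j x"
      have c: "c \<ge> 0" using w_nn by (simp add: c_def)
      have "sum (\<lambda>j. ennreal ((2 ^ Suc j * w j x) powr Q)) {j} \<le> S x"
        unfolding S_def by (rule sum_le_suminf) auto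
      then have "ennreal (c powr Q) \<le> ennreal s"
        unfolding s(2) c_def by (simp only: sum.insert_if sum.empty finite.emptyI empty_iff if_False add_0_right)
      then have "c powr Q \<le> s" using s(1) by (simp only: ennreal_le_iff)
      then have "(c powr Q) powr (1 / Q) \<le> s powr (1 / Q)" using Q by (intro powr_mono2) auto
      then show ?thesis unfolding c_def[symmetric] using Q c by (simp add: powr_powr)
    qed
    then have wle: "w j x \<le> s powr (1 / Q) * (1/2) ^ Suc j" for j
      by (simp add: field_simps power_divide)
    have Hle: "H j x \<le> H 0 x + s powr (1/Q) * (1 - (1/2) ^ j)" for j
    proof (induction j)
      case (Suc j)
      have "H (Suc j) x \<le> H j x + w j x" by (simp add: w_def)
      then show ?case using Suc wle[of j] by (simp add: algebra_simps)
    qed simp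
    have "\<rho> x \<le> ennreal (H 0 x + s powr (1/Q))" unfolding \<rho>_def
    proof (intro SUP_least ennreal_leI)
      fix j show "H j x \<le> H 0 x + s powr (1/Q)"
        using Hle[of j] mult_left_mono[of "1 - (1/2::real) ^ j" 1 "s powr (1/Q)"] by simp
    qed
    then have "ennpowr (\<rho> x) Q \<le> ennpowr (ennreal (H 0 x + s powr (1/Q))) Q"
      using Q by (intro ennpowr_mono) auto
    also have "\<dots> = ennreal ((H 0 x + s powr (1/Q)) powr Q)" using H_nn by (intro ennpowr_ennreal add_nonneg_nonneg) auto
    also have "\<dots> \<le> ennreal (2 powr Q * (H 0 x powr Q + (s powr (1/Q)) powr Q))"
      using H_nn Q by (intro ennreal_leI powr_add_le) auto
    also have "(s powr (1/Q)) powr Q = s" using s Q by (simp add: powr_powr)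
    finally show ?thesis using s by (simp add: ennreal_mult ennreal_plus)
  qed (simp add: ennreal_mult_top ennreal_top_mult)
  show ?thesis
  proof (rule that[of \<rho>])
    show "\<rho> \<in> borel_measurable borel" unfolding \<rho>_def by measurable
    have E_nn_int: "(\<integral>\<^sup>+x. ennreal (H 0 x powr Q) \<partial>M) \<le> ennreal B"
    proof -
      have "(\<integral>\<^sup>+x. ennreal (H 0 x powr Q) \<partial>M) = ennreal (E (H 0))"
        unfolding E_def using HK[of 0] by (intro nn_integral_eq_integral) (auto simp: K_def)
      then show ?thesis using HK[of 0] by (auto simp: K_def intro: ennreal_leI)
    qed
    have wj: "(\<integral>\<^sup>+x. ennreal ((2 ^ Suc j * w j x) powr Q) \<partial>M) \<le> ennreal (B * (1/2) ^ Suc j)" for j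
    proof -
      have "(\<integral>\<^sup>+x. ennreal ((2 ^ Suc j * w j x) powr Q) \<partial>M) = (\<integral>\<^sup>+x. ennreal ((2 ^ Suc j) powr Q * w j x powr Q) \<partial>M)"
        using w_nn by (simp add: powr_mult)
      also have "\<dots> = ennreal ((2 ^ Suc j) powr Q * E (w j))"
        unfolding E_def using w_int[of j]
        by (subst nn_integral_eq_integral) auto
      also have "\<dots> \<le> ennreal ((2 ^ Suc j) powr Q * \<eta> j)"
        using Ew by (intro ennreal_leI mult_left_mono) auto
      also have "(2 ^ Suc j) powr Q * \<eta> j = B * (1/2) ^ Suc j" by (simp add: \<eta>_def)
      finally show ?thesis .
    qed
    have S_int: "(\<integral>\<^sup>+x. S x \<partial>M) \<le> ennreal B"
    proof -
      have "(\<integral>\<^sup>+x. S x \<partial>M) = (\<Sum>j. \<integral>\<^sup>+x. ennreal ((2 ^ Suc j * w j x) powr Q) \<partial>M)"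
        unfolding S_def by (intro nn_integral_suminf) measurable
      also have "\<dots> \<le> (\<Sum>j. ennreal (B * (1/2) ^ Suc j))" by (intro suminf_le wj) auto
      also have "\<dots> = ennreal (B * 1)"
        using B sums_mult[OF power_half_series, of B] by (intro suminf_ennreal_eq) auto
      finally show ?thesis by simp
    qed
    have "(\<integral>\<^sup>+x. ennpowr (\<rho> x) Q \<partial>M) \<le> (\<integral>\<^sup>+x. ennreal (2 powr Q) * (ennreal (H 0 x powr Q) + S x) \<partial>M)"
      by (intro nn_integral_mono \<rho>S)
    also have "\<dots> = ennreal (2 powr Q) * ((\<integral>\<^sup>+x. ennreal (H 0 x powr Q) \<partial>M) + (\<integral>\<^sup>+x. S x \<partial>M))"
      unfolding S_def by (subst nn_integral_cmult, measurable, subst nn_integral_add, measurable)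
    also have "\<dots> \<le> ennreal (2 powr Q) * (ennreal B + ennreal B)"
      by (intro mult_left_mono add_mono E_nn_int S_int) auto
    also have "\<dots> = ennreal (2 powr Q * (2 * B))" using B by (simp add: ennreal_mult ennreal_plus[symmetric] del: ennreal_plus)
    finally show "(\<integral>\<^sup>+x. ennpowr (\<rho> x) Q \<partial>M) \<le> ennreal (2 powr Q * (2 * B))" .
    fix m assume m: "m \<in> MM"
    obtain N where N: "\<And>n. n \<ge> N \<Longrightarrow> 1 \<le> (\<integral>\<^sup>+x. ennreal (r n x) \<partial>m)"
      using adm[OF m] by (auto simp: eventually_sequentially)
    \<comment> \<open>One member of the sequence suffices: past the threshold \<open>N\<close> of
      \<open>m\<close>, membership in \<open>K N\<close> is admissibility for
      \<open>m\<close>.\<close>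
    have "h (\<psi> N) \<in> K N" using hK K_anti \<psi>1(3) by blast
    then have "1 \<le> (\<integral>\<^sup>+x. ennreal (H N x) \<partial>m)" using m N unfolding K_def H_def by auto
    also have "\<dots> \<le> (\<integral>\<^sup>+x. \<rho> x \<partial>m)" unfolding \<rho>_def by (intro nn_integral_mono SUP_upper) auto
    finally show "1 \<le> (\<integral>\<^sup>+x. \<rho> x \<partial>m)" .
  qed
qed

section \<open>Arc length of curves in metric spaces\<close>

definition partition_sum :: "(real \<Rightarrow> 'a::metric_space) \<Rightarrow> nat \<Rightarrow> (nat \<Rightarrow> real) \<Rightarrow> real" where
  "partition_sum \<gamma> n t = (\<Sum>i<n. dist (\<gamma> (t i)) (\<gamma> (t (Suc i))))"

lemma partition_sum_nonneg: "0 \<le> partition_sum \<gamma> n t"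
  by (simp add: partition_sum_def sum_nonneg)

lemma curve_length_eq:
  "curve_length I \<gamma> = (SUP (n, t) \<in> {(n, t). t ` {..n} \<subseteq> I \<and> mono_on {..n} t}. ennreal (partition_sum \<gamma> n t))"
  unfolding curve_length_def partition_sum_def by (simp add: sum_ennreal)

lemma partition_sum_le_curve_length:
  "t ` {..n} \<subseteq> I \<Longrightarrow> mono_on {..n} t \<Longrightarrow> ennreal (partition_sum \<gamma> n t) \<le> curve_length I \<gamma>"
  unfolding curve_length_eq by (rule SUP_upper2[of "(n, t)"]) auto

lemma curve_length_leI:
  assumes "\<And>n t. t ` {..n} \<subseteq> I \<Longrightarrow> mono_on {..n} t \<Longrightarrow> ennreal (partition_sum \<gamma> n t) \<le> l"
  shows "curve_length I \<gamma> \<le> l"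
  unfolding curve_length_eq by (rule SUP_least) (auto intro: assms)

lemma less_curve_lengthE:
  assumes "v < curve_length I \<gamma>"
  obtains n t where "t ` {..n} \<subseteq> I" "mono_on {..n} t" "v < ennreal (partition_sum \<gamma> n t)"
  using assms unfolding curve_length_eq less_SUP_iff by auto

lemma dist_le_curve_length:
  assumes "p \<le> q"
  shows "ennreal (dist (\<gamma> p) (\<gamma> q)) \<le> curve_length {p..q} \<gamma>"
proof -
  define t where "t = (\<lambda>i::nat. if i = 0 then p else q)"
  have "ennreal (partition_sum \<gamma> 1 t) \<le> curve_length {p..q} \<gamma>"
    using assms by (intro partition_sum_le_curve_length) (auto simp: t_def mono_on_def)
  then show ?thesis by (simp add: partition_sum_def t_def)
qed

lemma curve_length_mono: "I \<subseteq> J \<Longrightarrow> curve_length I \<gamma> \<le> curve_length J \<gamma>"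
  by (intro curve_length_leI partition_sum_le_curve_length) auto

text \<open>A partition with no point strictly between \<open>p\<close> and \<open>q\<close> jumps at most once across \<open>[p, q]\<close>;
  the jump is counted by the telescoping sum of \<open>g\<close>.\<close>

lemma partition_sum_gap:
  assumes pq: "a \<le> p" "p \<le> q" "q \<le> b"
    and t: "t ` {..n} \<subseteq> {a..b}" "mono_on {..n} t"
    and gap: "\<And>i. i \<le> n \<Longrightarrow> t i \<le> p \<or> q \<le> t i"
  shows "ennreal (partition_sum \<gamma> n t) \<le>
    curve_length {a..p} \<gamma> + ennreal (dist (\<gamma> p) (\<gamma> q)) + curve_length {q..b} \<gamma>"
proof -
  define g :: "nat \<Rightarrow> real" where "g = (\<lambda>i. if t i \<le> p then 0 else 1)"
  \<comment> \<open>Clamping to the two sides of the gap turns \<open>t\<close> into a partition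
    \<open>l\<close> of \<open>{a..p}\<close> and a partition \<open>u\<close> of
    \<open>{q..b}\<close>.\<close>
  define l where "l = (\<lambda>i. min (t i) p)"
  define u where "u = (\<lambda>i. max (t i) q)"
  have step: "dist (\<gamma> (t i)) (\<gamma> (t (Suc i))) \<le> dist (\<gamma> (l i)) (\<gamma> (l (Suc i))) +
     dist (\<gamma> p) (\<gamma> q) * (g (Suc i) - g i) + dist (\<gamma> (u i)) (\<gamma> (u (Suc i)))" if i: "i < n" for i
  proof -
    have le: "t i \<le> t (Suc i)" using t(2) i by (auto simp: mono_on_def)
    consider "t (Suc i) \<le> p" | "t i \<le> p" "\<not> t (Suc i) \<le> p" | "\<not> t i \<le> p" by blast
    then show ?thesis
    proof cases
      case 1 then show ?thesis using le by (simp add: g_def l_def u_def)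
    next
      case 2
      then have "q \<le> t (Suc i)" using gap[of "Suc i"] i by auto
      then have "l i = t i" "l (Suc i) = p" "u i = q" "u (Suc i) = t (Suc i)"
        using 2 pq by (auto simp: l_def u_def)
      moreover have "dist (\<gamma> (t i)) (\<gamma> (t (Suc i))) \<le> dist (\<gamma> (t i)) (\<gamma> p) + dist (\<gamma> p) (\<gamma> q) + dist (\<gamma> q) (\<gamma> (t (Suc i)))"
        by (smt (verit) dist_triangle)
      ultimately show ?thesis using 2 by (simp add: g_def)
    next
      case 3
      then have "q \<le> t i" "q \<le> t (Suc i)" using gap[of i] i le by auto
      then have "l i = p" "l (Suc i) = p" "u i = t i" "u (Suc i) = t (Suc i)" "g i = 1" "g (Suc i) = 1"
        using 3 le pq by (auto simp: g_def l_def u_def)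
      then show ?thesis by simp
    qed
  qed
  have "partition_sum \<gamma> n t \<le> partition_sum \<gamma> n l + dist (\<gamma> p) (\<gamma> q) * (\<Sum>i<n. g (Suc i) - g i) + partition_sum \<gamma> n u"
    unfolding partition_sum_def sum_distrib_left sum.distrib[symmetric]
    by (intro sum_mono step) auto
  also have "(\<Sum>i<n. g (Suc i) - g i) = g n - g 0" by (rule sum_lessThan_telescope)
  also have "dist (\<gamma> p) (\<gamma> q) * (g n - g 0) \<le> dist (\<gamma> p) (\<gamma> q) * 1"
    by (intro mult_left_mono) (auto simp: g_def)
  finally have "partition_sum \<gamma> n t \<le> partition_sum \<gamma> n l + dist (\<gamma> p) (\<gamma> q) + partition_sum \<gamma> n u" by simp
  then have "ennreal (partition_sum \<gamma> n t) \<le> ennreal (partition_sum \<gamma> n l) + ennreal (dist (\<gamma> p) (\<gamma> q)) + ennreal (partition_sum \<gamma> n u)"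
    by (simp add: ennreal_plus[symmetric] partition_sum_nonneg ennreal_leI del: ennreal_plus)
  also have "\<dots> \<le> curve_length {a..p} \<gamma> + ennreal (dist (\<gamma> p) (\<gamma> q)) + curve_length {q..b} \<gamma>"
  proof (intro add_mono partition_sum_le_curve_length order_refl)
    show "l ` {..n} \<subseteq> {a..p}" "u ` {..n} \<subseteq> {q..b}" using t(1) pq by (auto simp: l_def u_def)
    show "mono_on {..n} l" "mono_on {..n} u" using t(2) unfolding mono_on_def l_def u_def
      by (blast intro: min.mono max.mono order_refl)+
  qed
  finally show ?thesis .
qed

text \<open>One inequality is \<open>partition_sum_gap\<close> with both gap ends equal to
  \<open>c\<close>; the other concatenates partitions of the two parts.\<close>

lemma curve_length_split:
  assumes "a \<le> c" "c \<le> b"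
  shows "curve_length {a..b} \<gamma> = curve_length {a..c} \<gamma> + curve_length {c..b} \<gamma>"
proof (rule antisym)
  show "curve_length {a..b} \<gamma> \<le> curve_length {a..c} \<gamma> + curve_length {c..b} \<gamma>"
    using assms by (intro curve_length_leI) (auto dest!: partition_sum_gap[where p = c and q = c and \<gamma> = \<gamma>, rotated 3])
next
  have "ennreal (partition_sum \<gamma> n t) + ennreal (partition_sum \<gamma> k s) \<le> curve_length {a..b} \<gamma>"
    if t: "t ` {..n} \<subseteq> {a..c}" "mono_on {..n} t" and s: "s ` {..k} \<subseteq> {c..b}" "mono_on {..k} s" for n t k s
  proof -
    \<comment> \<open>Index \<open>Suc n\<close> carries \<open>s 0\<close>; the joining step from
      \<open>t n\<close> to \<open>s 0\<close> can only increase the sum.\<close>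
    define w where "w = (\<lambda>i. if i \<le> n then t i else s (i - Suc n))"
    have "partition_sum \<gamma> (Suc n + k) w = partition_sum \<gamma> (Suc n) w + (\<Sum>i<k. dist (\<gamma> (w (Suc n + i))) (\<gamma> (w (Suc (Suc n + i)))))"
      unfolding partition_sum_def by (induction k) auto
    moreover have "(\<Sum>i<k. dist (\<gamma> (w (Suc n + i))) (\<gamma> (w (Suc (Suc n + i))))) = partition_sum \<gamma> k s"
      unfolding partition_sum_def w_def by (intro sum.cong) (auto simp: Suc_diff_le)
    moreover have "partition_sum \<gamma> n t = partition_sum \<gamma> n w"
      unfolding partition_sum_def w_def by (intro sum.cong) auto
    moreover have "partition_sum \<gamma> n w \<le> partition_sum \<gamma> (Suc n) w" unfolding partition_sum_def by simp
    ultimately have "ennreal (partition_sum \<gamma> n t) + ennreal (partition_sum \<gamma> k s) \<le> ennreal (partition_sum \<gamma> (Suc n + k) w)"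
      by (simp add: ennreal_plus[symmetric] partition_sum_nonneg ennreal_leI del: ennreal_plus)
    also have "\<dots> \<le> curve_length {a..b} \<gamma>"
    proof (rule partition_sum_le_curve_length)
      have tin: "t i \<in> {a..c}" if "i \<le> n" for i using t(1) that by blast
      have sin: "s i \<in> {c..b}" if "i \<le> k" for i using s(1) that by blast
      show "w ` {..Suc n + k} \<subseteq> {a..b}"
      proof safe
        fix i assume "i \<le> Suc n + k"
        then have "i \<le> n \<or> i - Suc n \<le> k" by linarith
        then show "w i \<in> {a..b}" using tin[of i] sin[of "i - Suc n"] assms \<open>i \<le> Suc n + k\<close> unfolding w_def by fastforce
      qed
      show "mono_on {..Suc n + k} w"
      proof (rule mono_onI)
        fix i j assume ij: "i \<in> {..Suc n + k}" "j \<in> {..Suc n + k}" "i \<le> j"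
        consider "j \<le> n" | "i \<le> n" "n < j" | "n < i" using ij by linarith
        then show "w i \<le> w j"
        proof cases
          case 1 then show ?thesis using ij t(2) by (auto simp: w_def mono_on_def)
        next
          case 2
          moreover have "j - Suc n \<le> k" using ij by auto
          ultimately show ?thesis using tin[of i] sin[of "j - Suc n"] by (auto simp: w_def)
        next
          case 3
          then have "i - Suc n \<le> k" "j - Suc n \<le> k" "i - Suc n \<le> j - Suc n" using ij by auto
          then have "s (i - Suc n) \<le> s (j - Suc n)" using s(2) by (auto simp: mono_on_def)
          then show ?thesis using 3 ij by (auto simp: w_def)
        qed
      qed
    qed
    finally show ?thesis .
  qed
  note key = this
  have ne: "{(n, t). t ` {..n} \<subseteq> {p..q} \<and> mono_on {..n} t} \<noteq> {}" if "p \<le> q" for p q :: real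
    using that by (auto intro!: exI[of _ 0] exI[of _ "\<lambda>_. p"] simp: mono_on_def)
  have "ennreal (partition_sum \<gamma> n t) + curve_length {c..b} \<gamma> \<le> curve_length {a..b} \<gamma>"
    if "t ` {..n} \<subseteq> {a..c}" "mono_on {..n} t" for n t
    unfolding curve_length_eq[of "{c..b}"] ennreal_SUP_add_right[OF ne[OF assms(2)]]
    using key[OF that] by (auto intro!: SUP_least)
  then show "curve_length {a..c} \<gamma> + curve_length {c..b} \<gamma> \<le> curve_length {a..b} \<gamma>"
    unfolding curve_length_eq[of "{a..c}"] ennreal_SUP_add_left[symmetric, OF ne[OF assms(1)]]
    by (auto intro!: SUP_least)
qed

lemma curve_length_singleton: "curve_length {a..a} \<gamma> = 0"
proof -
  have "curve_length {a..a} \<gamma> \<le> 0"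
  proof (rule curve_length_leI)
    fix n :: nat and t :: "nat \<Rightarrow> real" assume "t ` {..n} \<subseteq> {a..a}"
    then have "t i = a" if "i \<le> n" for i using that by auto
    then have "partition_sum \<gamma> n t = 0" unfolding partition_sum_def by (intro sum.neutral) auto
    then show "ennreal (partition_sum \<gamma> n t) \<le> 0" by simp
  qed
  then show ?thesis by simp
qed

section \<open>Continuity of arc length and the parametrization by it\<close>

locale rectifiable_path =
  fixes a b :: real and \<gamma> :: "real \<Rightarrow> 'a::metric_space"
  assumes ab: "a \<le> b" and cont: "continuous_on {a..b} \<gamma>" and rect: "curve_length {a..b} \<gamma> < \<infinity>"
begin

definition arclength :: "real \<Rightarrow> real" where
  "arclength t = enn2real (curve_length {a..t} \<gamma>)"

definition total_length :: real where "total_length = arclength b"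

lemma length_finite: "a \<le> p \<Longrightarrow> q \<le> b \<Longrightarrow> curve_length {p..q} \<gamma> < \<infinity>"
  using curve_length_mono[of "{p..q}" "{a..b}" \<gamma>] rect by (auto intro: le_less_trans)

lemma ennreal_arclength: "t \<le> b \<Longrightarrow> ennreal (arclength t) = curve_length {a..t} \<gamma>"
  using length_finite[of a t] by (simp add: arclength_def)

lemma arclength_nonneg: "0 \<le> arclength t"
  by (simp add: arclength_def)

lemma arclength_start [simp]: "arclength a = 0"
  using curve_length_singleton[of a \<gamma>] by (simp add: arclength_def)

lemma curve_length_arclength:
  assumes "a \<le> p" "p \<le> q" "q \<le> b"
  shows "curve_length {p..q} \<gamma> = ennreal (arclength q - arclength p)" "arclength p \<le> arclength q"
proof -
  obtain r where r: "r \<ge> 0" "curve_length {p..q} \<gamma> = ennreal r"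
    using length_finite[of p q] assms by (metis ennreal_cases infinity_ennreal_def less_irrefl)
  have "ennreal (arclength q) = ennreal (arclength p + r)"
    using curve_length_split[of a p q \<gamma>] assms ennreal_arclength r arclength_nonneg by simp
  then have "arclength q = arclength p + r"
    using r arclength_nonneg[of p] arclength_nonneg[of q] by (subst (asm) ennreal_inj) auto
  then show "curve_length {p..q} \<gamma> = ennreal (arclength q - arclength p)" "arclength p \<le> arclength q"
    using r by auto
qed

lemma dist_le_arclength:
  assumes "p \<in> {a..b}" "q \<in> {a..b}"
  shows "dist (\<gamma> p) (\<gamma> q) \<le> \<bar>arclength q - arclength p\<bar>"
proof -
  have *: "dist (\<gamma> p) (\<gamma> q) \<le> arclength q - arclength p" if "a \<le> p" "p \<le> q" "q \<le> b" for p q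
    using dist_le_curve_length[OF that(2), of \<gamma>] curve_length_arclength[OF that] by simp
  show ?thesis
    using *[of p q] *[of q p] assms by (cases "p \<le> q") (auto simp: dist_commute)
qed

text \<open>Fix a partition whose sum misses the total length by less than \<open>e / 2\<close>. On
  an interval without interior partition points the arc length then exceeds the distance of the end
  points by less than \<open>e / 2\<close>, and that distance is small by continuity of
  \<open>\<gamma>\<close>.\<close>

lemma continuous_on_arclength: "continuous_on {a..b} arclength"
  unfolding continuous_on_iff
proof (intro ballI allI impI)
  fix p e :: real assume p: "p \<in> {a..b}" and e: "e > 0"
  have "\<exists>n t. t ` {..n} \<subseteq> {a..b} \<and> mono_on {..n} t \<and> total_length < partition_sum \<gamma> n t + e / 2"
  proof (cases "total_length < e / 2")
    case True
    then show ?thesis using ab by (auto intro!: exI[of _ 0] exI[of _ "\<lambda>_. a"] simp: mono_on_def partition_sum_def)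
  next
    case False
    then have "ennreal (total_length - e / 2) < curve_length {a..b} \<gamma>"
      using e unfolding total_length_def by (subst ennreal_arclength[symmetric]) (auto intro!: ennreal_lessI)
    then obtain n t where "t ` {..n} \<subseteq> {a..b}" "mono_on {..n} t" "ennreal (total_length - e / 2) < ennreal (partition_sum \<gamma> n t)"
      by (rule less_curve_lengthE)
    then show ?thesis using False by (auto simp: ennreal_less_iff intro!: exI[of _ n] exI[of _ t])
  qed
  then obtain n t where t: "t ` {..n} \<subseteq> {a..b}" "mono_on {..n} t" "total_length < partition_sum \<gamma> n t + e / 2"
    by blast
  have small: "arclength q2 - arclength q1 < e"
    if q: "a \<le> q1" "q1 \<le> q2" "q2 \<le> b" and gap: "\<And>i. i \<le> n \<Longrightarrow> t i \<le> q1 \<or> q2 \<le> t i"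
      and d: "dist (\<gamma> q1) (\<gamma> q2) < e / 2" for q1 q2
  proof -
    have "ennreal (partition_sum \<gamma> n t) \<le> curve_length {a..q1} \<gamma> + ennreal (dist (\<gamma> q1) (\<gamma> q2)) + curve_length {q2..b} \<gamma>"
      using partition_sum_gap[OF q t(1,2) gap] .
    also have "\<dots> = ennreal (arclength q1 + dist (\<gamma> q1) (\<gamma> q2) + (total_length - arclength q2))"
      using q curve_length_arclength[of q2 b] arclength_nonneg
      by (simp add: ennreal_arclength[symmetric] total_length_def ennreal_plus[symmetric] del: ennreal_plus)
    finally have "partition_sum \<gamma> n t \<le> arclength q1 + dist (\<gamma> q1) (\<gamma> q2) + (total_length - arclength q2)"
      using q curve_length_arclength(2)[of q2 b] arclength_nonneg[of q1]
      by (subst (asm) ennreal_le_iff) (auto simp: total_length_def)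
    then show ?thesis using t(3) d by simp
  qed
  \<comment> \<open>Partition points other than \<open>p\<close> keep away from \<open>p\<close>;
    \<open>p\<close> itself may be one, since the gap condition only concerns interior
    points.\<close>
  have "\<exists>d>0. \<forall>i\<in>{..n}. t i \<noteq> p \<longrightarrow> d \<le> dist p (t i)"
    using finite_set_avoid[of "t ` {..n}" p] by auto
  then obtain d1 where d1: "d1 > 0" "\<And>i. i \<le> n \<Longrightarrow> t i \<noteq> p \<Longrightarrow> d1 \<le> dist p (t i)" by auto
  obtain d2 where d2: "d2 > 0" "\<And>q. q \<in> {a..b} \<Longrightarrow> dist q p < d2 \<Longrightarrow> dist (\<gamma> q) (\<gamma> p) < e / 2"
    using cont p e unfolding continuous_on_iff by (meson half_gt_zero)
  show "\<exists>d>0. \<forall>q\<in>{a..b}. dist q p < d \<longrightarrow> dist (arclength q) (arclength p) < e"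
  proof (intro exI[of _ "min d1 d2"] conjI ballI impI)
    show "min d1 d2 > 0" using d1 d2 by simp
    fix q assume q: "q \<in> {a..b}" "dist q p < min d1 d2"
    then have dq: "dist (\<gamma> q) (\<gamma> p) < e / 2" using d2 by auto
    show "dist (arclength q) (arclength p) < e"
    proof (cases "p \<le> q")
      case True
      have "t i \<le> p \<or> q \<le> t i" if "i \<le> n" for i using d1(2)[OF that] q True by (force simp: dist_real_def)
      then show ?thesis using small[of p q] p q True dq curve_length_arclength(2)[of p q] by (simp add: dist_real_def dist_commute)
    next
      case False
      have "t i \<le> q \<or> p \<le> t i" if "i \<le> n" for i using d1(2)[OF that] q False by (force simp: dist_real_def)
      then show ?thesis using small[of q p] p q False dq curve_length_arclength(2)[of q p] by (simp add: dist_real_def)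
    qed
  qed
qed

lemma arclength_ivt:
  assumes "a \<le> p" "p \<le> q" "q \<le> b" "arclength p \<le> u" "u \<le> arclength q"
  obtains t where "p \<le> t" "t \<le> q" "arclength t = u"
  using IVT'[of arclength p u q] assms continuous_on_subset[OF continuous_on_arclength, of "{p..q}"] by auto

definition param :: "real \<Rightarrow> 'a" where "param = arclength_param a b \<gamma>"

lemma param_arclength:
  assumes "t \<in> {a..b}"
  shows "param (arclength t) = \<gamma> t"
proof -
  define P where "P = (\<lambda>t'. t' \<in> {a..b} \<and> curve_length {a..t'} \<gamma> = ennreal (arclength t))"
  have "P t" using assms ennreal_arclength[of t] by (simp add: P_def)
  then have "P (SOME t. P t)" by (rule someI)
  then have "(SOME t. P t) \<in> {a..b}" "arclength (SOME t. P t) = arclength t"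
    using ennreal_arclength arclength_nonneg by (auto simp: P_def arclength_def)
  then have "dist (\<gamma> (SOME t. P t)) (\<gamma> t) \<le> 0"
    using dist_le_arclength[of "SOME t. P t" t] assms by simp
  then show ?thesis unfolding param_def arclength_param_def P_def[symmetric] by simp
qed

lemma param_in:
  assumes "a \<le> p" "p \<le> q" "q \<le> b" "arclength p \<le> u" "u \<le> arclength q"
  shows "param u \<in> \<gamma> ` {p..q}"
proof -
  obtain t where "p \<le> t" "t \<le> q" "arclength t = u" using arclength_ivt[OF assms] .
  then show ?thesis using param_arclength[of t] assms by force
qed

lemma dist_param_le:
  assumes "u \<in> {0..total_length}" "v \<in> {0..total_length}"
  shows "dist (param u) (param v) \<le> \<bar>u - v\<bar>"
proof -
  obtain s where "a \<le> s" "s \<le> b" "arclength s = u"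
    using arclength_ivt[of a b u] assms ab by (auto simp: total_length_def)
  moreover obtain t where "a \<le> t" "t \<le> b" "arclength t = v"
    using arclength_ivt[of a b v] assms ab by (auto simp: total_length_def)
  ultimately show ?thesis
    using param_arclength[of s] param_arclength[of t] dist_le_arclength[of s t] by (simp add: abs_minus_commute)
qed

lemma continuous_on_param: "continuous_on {0..total_length} param"
  unfolding continuous_on_iff
proof (intro ballI allI impI)
  fix u e :: real assume u: "u \<in> {0..total_length}" "e > 0"
  have "dist (param v) (param u) < e" if "v \<in> {0..total_length}" "dist v u < e" for v
    using dist_param_le[of v u] u that by (simp add: dist_real_def)
  then show "\<exists>d>0. \<forall>v\<in>{0..total_length}. dist v u < d \<longrightarrow> dist (param v) (param u) < e"
    using u by blast
qed

text \<open>Integration against this measure is integration over the curve by arc length. In this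
  form curves supply the family of measures for \<open>admissible_limit\<close>.\<close>

definition path_measure :: "'a measure" where
  "path_measure = distr (restrict_space lborel {0..total_length}) borel param"

end

section \<open>Lower semicontinuous majorants\<close>

text \<open>Take the points at distance at least \<open>1 / real (Suc n)\<close> from the
  complement. The whole space is separate because \<open>infdist\<close> to the empty set is 0 by
  convention.\<close>

lemma closed_ball_exhaustion:
  fixes S :: "'a::metric_space set"
  assumes "open S"
  obtains F :: "nat \<Rightarrow> 'a set" where "\<And>n. closed (F n)" "incseq F" "(\<Union>n. F n) = S"
proof (cases "S = UNIV")
  case True then show ?thesis by (intro that[of "\<lambda>_. UNIV"]) (auto simp: incseq_def)
next
  case False
  define F where "F = (\<lambda>n. {x. 1 / real (Suc n) \<le> infdist x (- S)})"
  show ?thesis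
  proof (rule that[of F])
    fix n show "closed (F n)" unfolding F_def by (intro closed_Collect_le continuous_intros)
  next
    have "1 / real (Suc n) \<le> 1 / real (Suc m)" if "m \<le> n" for m n
      using that by (intro divide_left_mono) auto
    then show "incseq F" unfolding F_def incseq_def by (blast intro: order_trans)
    show "(\<Union>n. F n) = S"
    proof (intro equalityI subsetI)
      fix x assume "x \<in> (\<Union>n. F n)"
      then obtain n where "1 / real (Suc n) \<le> infdist x (- S)" by (auto simp: F_def)
      then have "infdist x (- S) \<noteq> 0" by (smt (verit) divide_pos_pos of_nat_0_less_iff zero_less_Suc)
      then show "x \<in> S" by (metis ComplI infdist_zero)
    next
      fix x assume "x \<in> S"
      then have "infdist x (- S) \<noteq> 0"
        using in_closed_iff_infdist_zero[of "- S" x] assms False by auto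
      then have "infdist x (- S) > 0" using infdist_nonneg[of x "- S"] by linarith
      then obtain n where "inverse (real (Suc n)) < infdist x (- S)" using reals_Archimedean by blast
      then show "x \<in> (\<Union>n. F n)" by (auto simp: F_def inverse_eq_divide intro!: exI[of _ n])
    qed
  qed
qed

text \<open>The sets with this approximation property form a sigma-algebra, which contains the open
  sets by \<open>closed_ball_exhaustion\<close>. Finiteness of \<open>M\<close> is what gives
  continuity from above.\<close>

lemma finite_borel_measure_regular:
  fixes M :: "'a::metric_space measure"
  assumes M: "sets M = sets borel" and fin: "emeasure M (space M) < \<infinity>"
    and A: "A \<in> sets borel" and e: "(e::ennreal) > 0"
  shows "\<exists>F W. closed F \<and> open W \<and> F \<subseteq> A \<and> A \<subseteq> W \<and> emeasure M (W - F) < e"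
proof -
  have fin': "emeasure M B \<noteq> \<infinity>" for B
    using emeasure_space[of M B] fin by (metis infinity_ennreal_def leD)
  have op: "open B \<Longrightarrow> B \<in> sets M" for B using M by auto
  have cl: "closed B \<Longrightarrow> B \<in> sets M" for B using M by auto
  define P where "P = (\<lambda>A. \<forall>e::ennreal>0. \<exists>F W. closed F \<and> open W \<and> F \<subseteq> A \<and> A \<subseteq> W \<and> emeasure M (W - F) < e)"
  have "A \<in> sigma_sets UNIV {S. open S}" using A by (simp add: borel_def)
  then have "P A"
  proof (induction rule: sigma_sets.induct)
    case (Basic S)
    then have S: "open S" by simp
    obtain F where F: "\<And>n. closed (F n)" "incseq F" "(\<Union>n. F n) = S" using closed_ball_exhaustion[OF S] by blast
    have "(\<lambda>n. emeasure M (S - F n)) \<longlonglongrightarrow> emeasure M (\<Inter>n. S - F n)"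
      using F(2) fin' by (intro Lim_emeasure_decseq) (auto simp: decseq_def incseq_def op[OF S] cl[OF F(1)])
    also have "(\<Inter>n. S - F n) = {}" using F(3) by auto
    finally have lim: "(\<lambda>n. emeasure M (S - F n)) \<longlonglongrightarrow> 0" by simp
    show ?case unfolding P_def
    proof (intro allI impI)
      fix e :: ennreal assume "e > 0"
      then have "\<forall>\<^sub>F n in sequentially. emeasure M (S - F n) < e" using lim by (rule order_tendstoD(2)[rotated])
      then obtain n where "emeasure M (S - F n) < e" by (auto simp: eventually_sequentially)
      moreover have "F n \<subseteq> S" using F(3) by blast
      ultimately show "\<exists>F W. closed F \<and> open W \<and> F \<subseteq> S \<and> S \<subseteq> W \<and> emeasure M (W - F) < e"
        using S F(1) by blast
    qed
  next
    case Empty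
    show ?case unfolding P_def
    proof (intro allI impI)
      fix e :: ennreal assume "e > 0"
      then show "\<exists>F W. closed F \<and> open W \<and> F \<subseteq> {} \<and> {} \<subseteq> W \<and> emeasure M (W - F) < e"
        by (intro exI[of _ "{}"] conjI) simp_all
    qed
  next
    case (Compl S)
    show ?case unfolding P_def
    proof (intro allI impI)
      fix e :: ennreal assume e: "e > 0"
      obtain F W where FW: "closed F" "open W" "F \<subseteq> S" "S \<subseteq> W" "emeasure M (W - F) < e"
        using Compl.IH[unfolded P_def, rule_format, OF e] by metis
      have "- F - - W = W - F" by auto
      then have "emeasure M (- F - - W) < e" using FW by simp
      moreover have "closed (- W)" "open (- F)" "- W \<subseteq> UNIV - S" "UNIV - S \<subseteq> - F" using FW by auto
      ultimately show "\<exists>F W. closed F \<and> open W \<and> F \<subseteq> UNIV - S \<and> UNIV - S \<subseteq> W \<and> emeasure M (W - F) < e"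
        by blast
    qed
  next
    case (Union A)
    show ?case unfolding P_def
    proof (intro allI impI)
      fix e :: ennreal assume e: "e > 0"
      \<comment> \<open>Since \<open>e\<close> may be infinite, a positive real below it is used to
        distribute the errors.\<close>
      obtain z where z: "0 < z" "z < e" using dense[OF e] by blast
      then obtain e' where e': "0 < e'" "ennreal e' < e" by (cases z) auto
      have "\<exists>F W. closed F \<and> open W \<and> F \<subseteq> A i \<and> A i \<subseteq> W \<and> emeasure M (W - F) < ennreal (e' / 2 * (1/2) ^ Suc i)" for i
        using e'(1) by (intro Union.IH[unfolded P_def, rule_format]) (simp del: power_Suc)
      then obtain F W where FW: "\<And>i. closed (F i)" "\<And>i. open (W i)" "\<And>i. F i \<subseteq> A i" "\<And>i. A i \<subseteq> W i"
        "\<And>i. emeasure M (W i - F i) < ennreal (e' / 2 * (1/2) ^ Suc i)" by metis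
      have big: "emeasure M ((\<Union>i. W i) - (\<Union>i. F i)) \<le> ennreal (e' / 2)"
      proof -
        have "emeasure M ((\<Union>i. W i) - (\<Union>i. F i)) \<le> emeasure M (\<Union>i. W i - F i)"
          by (intro emeasure_mono sets.countable_UN sets.Diff image_subsetI op cl FW) auto
        also have "\<dots> \<le> (\<Sum>i. emeasure M (W i - F i))"
          by (intro emeasure_subadditive_countably image_subsetI sets.Diff op cl FW)
        also have "\<dots> \<le> (\<Sum>i. ennreal (e' / 2 * (1/2) ^ Suc i))"
          using FW(5) by (intro suminf_le) (auto intro: less_imp_le simp del: power_Suc)
        also have "\<dots> = ennreal (e' / 2 * 1)"
          using e'(1) sums_mult[OF power_half_series, of "e'/2"] by (intro suminf_ennreal_eq) (auto simp del: power_Suc)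
        finally show ?thesis by simp
      qed
      \<comment> \<open>The full union of the closed sets need not be closed; continuity from above
        allows replacing it by a finite union.\<close>
      have "(\<lambda>n. emeasure M ((\<Union>i. W i) - (\<Union>i\<le>n. F i))) \<longlonglongrightarrow> emeasure M (\<Inter>n. (\<Union>i. W i) - (\<Union>i\<le>n. F i))"
      proof (rule Lim_emeasure_decseq)
        show "range (\<lambda>n. (\<Union>i. W i) - (\<Union>i\<le>n. F i)) \<subseteq> sets M"
          by (intro image_subsetI sets.Diff op cl open_UN closed_UN ballI FW finite_atMost)
        show "decseq (\<lambda>n. (\<Union>i. W i) - (\<Union>i\<le>n. F i))" by (intro decseq_SucI) auto
      qed (use fin' in simp)
      also have "(\<Inter>n. (\<Union>i. W i) - (\<Union>i\<le>n. F i)) = (\<Union>i. W i) - (\<Union>i. F i)" by auto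
      finally have lim: "(\<lambda>n. emeasure M ((\<Union>i. W i) - (\<Union>i\<le>n. F i))) \<longlonglongrightarrow> emeasure M ((\<Union>i. W i) - (\<Union>i. F i))" .
      have "ennreal (e' / 2) \<le> ennreal e'" using e' by (intro ennreal_leI) simp
      then have "ennreal (e' / 2) < e" using e'(2) by (rule le_less_trans)
      then have "emeasure M ((\<Union>i. W i) - (\<Union>i. F i)) < e" using big by (rule le_less_trans[rotated])
      then have "\<forall>\<^sub>F n in sequentially. emeasure M ((\<Union>i. W i) - (\<Union>i\<le>n. F i)) < e"
        by (rule order_tendstoD(2)[OF lim])
      then obtain n where n: "emeasure M ((\<Union>i. W i) - (\<Union>i\<le>n. F i)) < e" by (auto simp: eventually_sequentially)
      show "\<exists>F W. closed F \<and> open W \<and> F \<subseteq> \<Union> (range A) \<and> \<Union> (range A) \<subseteq> W \<and> emeasure M (W - F) < e"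
      proof (rule exI[of _ "\<Union>i\<le>n. F i"], rule exI[of _ "\<Union>i. W i"], intro conjI n)
        show "closed (\<Union>i\<le>n. F i)" by (intro closed_UN ballI FW finite_atMost)
        show "open (\<Union>i. W i)" by (intro open_UN ballI FW)
        show "(\<Union>i\<le>n. F i) \<subseteq> \<Union> (range A)" "\<Union> (range A) \<subseteq> (\<Union>i. W i)" using FW(3,4) by blast+
      qed
    qed
  qed
  then show ?thesis using e unfolding P_def by blast
qed

text \<open>Apply finite regularity to the restriction of \<open>M\<close> to each
  \<open>W i\<close>, with errors \<open>e * (1/2) ^ Suc i\<close>. Intersecting the open sets with
  \<open>W i\<close> before taking the union keeps each excess where it is controlled.\<close>

lemma outer_regular_sigma_finite:
  fixes M :: "'a::metric_space measure" and W :: "nat \<Rightarrow> 'a set"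
  assumes M: "sets M = sets borel" and W: "\<And>i. open (W i)" "\<And>i. emeasure M (W i) < \<infinity>"
    and A: "A \<in> sets borel" "A \<subseteq> (\<Union>i. W i)" and e: "e > 0"
  obtains U where "open U" "A \<subseteq> U" "emeasure M (U - A) \<le> ennreal e"
proof -
  have op: "open B \<Longrightarrow> B \<in> sets M" and cl: "closed B \<Longrightarrow> B \<in> sets M" for B using M by auto
  have "\<exists>U. open U \<and> A \<subseteq> U \<and> emeasure M (W i \<inter> (U - A)) < ennreal (e * (1/2) ^ Suc i)" for i
  proof -
    define N where "N = density M (indicator (W i))"
    have N: "emeasure N B = emeasure M (W i \<inter> B)" if "B \<in> sets borel" for B
      unfolding N_def using that op[OF W(1)] M
      by (subst emeasure_density) (auto simp: nn_integral_indicator[symmetric] indicator_inter_arith intro!: nn_integral_cong)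
    have "\<exists>F U. closed F \<and> open U \<and> F \<subseteq> A \<and> A \<subseteq> U \<and> emeasure N (U - F) < ennreal (e * (1/2) ^ Suc i)"
    proof (rule finite_borel_measure_regular)
      show "sets N = sets borel" by (simp add: N_def M)
      have "space N = UNIV" using sets_eq_imp_space_eq[of N borel] by (simp add: N_def M)
      then show "emeasure N (space N) < \<infinity>" using N[of UNIV] W(2)[of i] by simp
    qed (use A e in auto)
    then obtain F U where FU: "closed F" "open U" "F \<subseteq> A" "A \<subseteq> U" "emeasure N (U - F) < ennreal (e * (1/2) ^ Suc i)" by blast
    have "emeasure M (W i \<inter> (U - A)) \<le> emeasure M (W i \<inter> (U - F))"
      using FU(3) M op[OF FU(2)] cl[OF FU(1)] op[OF W(1)] by (intro emeasure_mono sets.Int sets.Diff) auto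
    also have "\<dots> < ennreal (e * (1/2) ^ Suc i)" using FU N[of "U - F"] by auto
    finally show ?thesis using FU by blast
  qed
  then obtain U where U: "\<And>i. open (U i)" "\<And>i. A \<subseteq> U i" "\<And>i. emeasure M (W i \<inter> (U i - A)) < ennreal (e * (1/2) ^ Suc i)"
    by metis
  show ?thesis
  proof (rule that[of "\<Union>i. W i \<inter> U i"])
    show "open (\<Union>i. W i \<inter> U i)" by (intro open_UN ballI open_Int W U)
    show "A \<subseteq> (\<Union>i. W i \<inter> U i)" using A U(2) by blast
    have "(\<Union>i. W i \<inter> U i) - A = (\<Union>i. W i \<inter> (U i - A))" by auto
    then have "emeasure M ((\<Union>i. W i \<inter> U i) - A) = emeasure M (\<Union>i. W i \<inter> (U i - A))" by simp
    also have "\<dots> \<le> (\<Sum>i. emeasure M (W i \<inter> (U i - A)))"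
      using W U A by (intro emeasure_subadditive_countably) (auto simp: M)
    also have "\<dots> \<le> (\<Sum>i. ennreal (e * (1/2) ^ Suc i))"
      using U(3) by (intro suminf_le) (auto intro: less_imp_le simp del: power_Suc)
    also have "\<dots> = ennreal (e * 1)"
      using e sums_mult[OF power_half_series, of e] by (intro suminf_ennreal_eq) (auto simp del: power_Suc)
    finally show "emeasure M ((\<Union>i. W i \<inter> U i) - A) \<le> ennreal e" by simp
  qed
qed

text \<open>The Vitali--Caratheodory theorem. As \<open>G\<close> is the supremum of \<open>q \<cdot> indicator {G > q}\<close> over the
  rationals \<open>q \<ge> 0\<close>, it suffices to enlarge these superlevel sets to open ones; the second
  supremum makes \<open>H\<close> positive.\<close>

lemma lower_semicontinuous_majorant:
  fixes M :: "'a::metric_space measure" and W :: "nat \<Rightarrow> 'a set" and G :: "'a \<Rightarrow> ennreal"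
  assumes M: "sets M = sets borel" and W: "\<And>i. open (W i)" "\<And>i. emeasure M (W i) < \<infinity>"
    and G: "G \<in> borel_measurable borel" and V: "V \<in> sets borel" "V \<subseteq> (\<Union>i. W i)" and e: "e > 0"
  obtains H where "\<And>a. open {x. a < H x}" "\<And>x. x \<in> V \<Longrightarrow> G x \<le> H x" "\<And>x. x \<in> V \<Longrightarrow> 0 < H x"
    "(\<integral>\<^sup>+x. H x \<partial>M) \<le> (\<integral>\<^sup>+x. G x \<partial>M) + ennreal e"
proof -
  define q where "q = (\<lambda>n. \<bar>real_of_rat (nat_to_rat_surj n)\<bar>)"
  have q_nn: "q n \<ge> 0" for n by (simp add: q_def)
  have q_dense: "\<exists>n. x < q n \<and> q n < y" if "0 \<le> x" "x < y" for x y
  proof -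
    obtain r where r: "x < real_of_rat r" "real_of_rat r < y" using of_rat_dense \<open>x < y\<close> by blast
    obtain n where n: "r = nat_to_rat_surj n" using surj_nat_to_rat_surj by (rule surjE)
    have "q n = real_of_rat r"
      unfolding q_def n[symmetric] using r \<open>0 \<le> x\<close> by (intro abs_of_nonneg) linarith
    then show ?thesis using r by (intro exI[of _ n]) simp
  qed
  define A where "A = (\<lambda>n. {x\<in>V. ennreal (q n) < G x})"
  have A_meas: "A n \<in> sets borel" for n
  proof -
    have "{x \<in> space borel. ennreal (q n) < G x} \<in> sets borel" using G by measurable
    then have "V \<inter> {x. ennreal (q n) < G x} \<in> sets borel" using V by auto
    then show ?thesis by (simp add: A_def Collect_conj_eq)
  qed
  define d where "d = (\<lambda>n. e / 2 * (1/2) ^ Suc n)"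
  have d: "d n > 0" for n using e by (simp add: d_def)
  have d_sum: "(\<Sum>n. ennreal (d n)) = ennreal (e / 2)"
    using e sums_mult[OF power_half_series, of "e/2"] unfolding d_def
    by (subst suminf_ennreal_eq[where x = "e / 2 * 1"]) (auto simp del: power_Suc)
  \<comment> \<open>With this error the excess weighted by the level \<open>q n\<close> is at most
    \<open>d n\<close>; the added 1 matters for level 0.\<close>
  have "\<exists>U. open U \<and> A n \<subseteq> U \<and> emeasure M (U - A n) \<le> ennreal (d n / (q n + 1))" for n
  proof (rule outer_regular_sigma_finite[OF M W A_meas])
    show "A n \<subseteq> (\<Union>i. W i)" using V by (auto simp: A_def)
    show "d n / (q n + 1) > 0" using d[of n] q_nn[of n] by auto
  qed auto
  then obtain U where U: "\<And>n. open (U n)" "\<And>n. A n \<subseteq> U n" "\<And>n. emeasure M (U n - A n) \<le> ennreal (d n / (q n + 1))"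
    by metis
  \<comment> \<open>Tiny multiples of the indicators of \<open>W i\<close>, of total integral at
    most \<open>e / 2\<close>, will make \<open>H\<close> positive.\<close>
  have "\<exists>c>0. ennreal c * emeasure M (W i) \<le> ennreal (d i)" for i
  proof -
    obtain m where m: "m \<ge> 0" "emeasure M (W i) = ennreal m"
      using W(2)[of i] by (cases "emeasure M (W i)") auto
    then have "ennreal (d i / (m + 1)) * emeasure M (W i) = ennreal (d i / (m + 1) * m)"
      unfolding m(2) using m d[of i] by (intro ennreal_mult[symmetric]) auto
    also have "d i / (m + 1) * m \<le> d i" using m d[of i] by (simp add: field_simps)
    finally have "ennreal (d i / (m + 1)) * emeasure M (W i) \<le> ennreal (d i)" by (simp add: ennreal_leI)
    then show ?thesis using d[of i] m by (intro exI[of _ "d i / (m + 1)"]) auto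
  qed
  then obtain c where c: "\<And>i. c i > 0" "\<And>i. ennreal (c i) * emeasure M (W i) \<le> ennreal (d i)" by metis
  define H where "H = (\<lambda>x. max (SUP n. ennreal (q n) * indicator (U n) x) (SUP i. ennreal (c i) * indicator (W i) x))"
  have op: "open B \<Longrightarrow> B \<in> sets M" for B using M by auto
  note [measurable] = op[OF U(1)] op[OF W(1)]
  have AM[measurable]: "A n \<in> sets M" for n using A_meas M by simp
  show ?thesis
  proof (rule that[of H])
    fix a
    have "{x. a < ennreal r * indicator S x} = (if a < ennreal r then S else {})" for r and S :: "'a set"
      by (auto simp: indicator_def)
    then have op: "open {x. a < ennreal r * indicator S x}" if "open S" for r and S :: "'a set" using that by simp
    have "{x. a < H x} = (\<Union>n. {x. a < ennreal (q n) * indicator (U n) x}) \<union> (\<Union>i. {x. a < ennreal (c i) * indicator (W i) x})"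
      unfolding H_def by (auto simp: less_max_iff_disj less_SUP_iff)
    then show "open {x. a < H x}" using op[OF U(1)] op[OF W(1)] by (simp only:) (intro open_Un open_UN ballI)
  next
    fix x assume x: "x \<in> V"
    show "G x \<le> H x"
    proof (rule dense_le)
      fix y assume y: "y < G x"
      then obtain z where z: "y < z" "z < G x" using dense by blast
      obtain y' where y': "y' \<ge> 0" "y = ennreal y'" using y by (cases y) auto
      obtain z' where z': "z' \<ge> 0" "z = ennreal z'" using z by (cases z) auto
      have "y' < z'" using z y' z' by (simp add: ennreal_less_iff)
      then obtain n where n: "y' < q n" "q n < z'" using q_dense y' by blast
      have "ennreal (q n) < z" using n z' q_nn by (simp add: ennreal_less_iff)
      then have "x \<in> A n" using x z by (auto simp: A_def)
      then have "x \<in> U n" using U by blast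
      have "y \<le> ennreal (q n)" using n y' by (simp add: ennreal_leI)
      also have "\<dots> = ennreal (q n) * indicator (U n) x" using \<open>x \<in> U n\<close> by simp
      also have "\<dots> \<le> H x" unfolding H_def by (rule max.coboundedI1, rule SUP_upper) simp
      finally show "y \<le> H x" .
    qed
    obtain i where i: "x \<in> W i" using x V by blast
    have "0 < ennreal (c i) * indicator (W i) x" using i c by simp
    also have "\<dots> \<le> H x" unfolding H_def by (rule max.coboundedI2, rule SUP_upper) simp
    finally show "0 < H x" .
  next
    have Gm[measurable]: "G \<in> borel_measurable M" using G M by (simp cong: measurable_cong_sets)
    \<comment> \<open>\<open>T\<close> pays for enlarging the superlevel sets of \<open>G\<close>
      and \<open>Z\<close> for the positive part; each costs at most \<open>e / 2\<close>.\<close>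
    define T where "T = (\<lambda>x. \<Sum>n. ennreal (q n) * indicator (U n - A n) x)"
    define Z where "Z = (\<lambda>x. \<Sum>n. ennreal (c n) * indicator (W n) x)"
    have term_le: "f n \<le> suminf f" for f :: "nat \<Rightarrow> ennreal" and n
      using sum_le_suminf[of f "{n}"] by simp
    have HTZ: "H x \<le> G x + T x + Z x" for x unfolding H_def
    proof (intro max.boundedI SUP_least)
      fix n
      show "ennreal (q n) * indicator (U n) x \<le> G x + T x + Z x"
      proof (cases "x \<in> A n")
        case True
        then have "ennreal (q n) \<le> G x" by (auto simp: A_def)
        moreover have "ennreal (q n) * indicator (U n) x \<le> ennreal (q n)" by (simp add: indicator_def)
        ultimately show ?thesis by (metis add.assoc add_increasing2 order_trans zero_le)
      next
        case False
        then have "ennreal (q n) * indicator (U n) x = ennreal (q n) * indicator (U n - A n) x" by (simp add: indicator_def)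
        also have "\<dots> \<le> T x" unfolding T_def by (rule term_le)
        finally show ?thesis by (metis add.commute add_increasing2 order_trans zero_le)
      qed
      have "ennreal (c n) * indicator (W n) x \<le> Z x" unfolding Z_def by (rule term_le)
      then show "ennreal (c n) * indicator (W n) x \<le> G x + T x + Z x" by (metis add.commute add_increasing2 zero_le)
    qed
    have T_int: "(\<integral>\<^sup>+x. T x \<partial>M) \<le> ennreal (e / 2)"
    proof -
      have "(\<integral>\<^sup>+x. T x \<partial>M) = (\<Sum>n. \<integral>\<^sup>+x. ennreal (q n) * indicator (U n - A n) x \<partial>M)"
        unfolding T_def by (intro nn_integral_suminf) measurable
      also have "\<dots> = (\<Sum>n. ennreal (q n) * emeasure M (U n - A n))"
        by (intro suminf_cong nn_integral_cmult_indicator) measurable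
      also have "\<dots> \<le> (\<Sum>n. ennreal (d n))"
      proof (intro suminf_le allI)
        fix n
        have "ennreal (q n) * emeasure M (U n - A n) \<le> ennreal (q n) * ennreal (d n / (q n + 1))"
          by (intro mult_left_mono U) auto
        also have "\<dots> = ennreal (q n * (d n / (q n + 1)))"
          using q_nn[of n] d[of n] by (intro ennreal_mult[symmetric]) auto
        also have "\<dots> \<le> ennreal (d n)"
        proof (rule ennreal_leI)
          show "q n * (d n / (q n + 1)) \<le> d n" using q_nn[of n] d[of n] by (simp add: field_simps)
        qed
        finally show "ennreal (q n) * emeasure M (U n - A n) \<le> ennreal (d n)" .
      qed auto
      finally show ?thesis by (simp add: d_sum)
    qed
    have Z_int: "(\<integral>\<^sup>+x. Z x \<partial>M) \<le> ennreal (e / 2)"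
    proof -
      have "(\<integral>\<^sup>+x. Z x \<partial>M) = (\<Sum>n. \<integral>\<^sup>+x. ennreal (c n) * indicator (W n) x \<partial>M)"
        unfolding Z_def by (intro nn_integral_suminf) measurable
      also have "\<dots> = (\<Sum>n. ennreal (c n) * emeasure M (W n))"
        by (intro suminf_cong nn_integral_cmult_indicator) measurable
      also have "\<dots> \<le> (\<Sum>n. ennreal (d n))" using c by (intro suminf_le) auto
      finally show ?thesis by (simp add: d_sum)
    qed
    have "(\<integral>\<^sup>+x. H x \<partial>M) \<le> (\<integral>\<^sup>+x. G x + T x + Z x \<partial>M)" by (intro nn_integral_mono HTZ)
    also have "\<dots> = (\<integral>\<^sup>+x. G x \<partial>M) + (\<integral>\<^sup>+x. T x \<partial>M) + (\<integral>\<^sup>+x. Z x \<partial>M)"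
      unfolding T_def Z_def by (subst nn_integral_add, measurable, subst nn_integral_add, measurable)
    also have "\<dots> \<le> (\<integral>\<^sup>+x. G x \<partial>M) + ennreal (e / 2) + ennreal (e / 2)"
      by (intro add_mono T_int Z_int order_refl)
    also have "\<dots> = (\<integral>\<^sup>+x. G x \<partial>M) + ennreal e"
      using e by (simp add: add.assoc ennreal_plus[symmetric] del: ennreal_plus)
    finally show "(\<integral>\<^sup>+x. H x \<partial>M) \<le> (\<integral>\<^sup>+x. G x \<partial>M) + ennreal e" .
  qed
qed

section \<open>Separable pieces of Ahlfors regular spaces\<close>

lemma dist_le_ediameter:
  fixes x y :: "'a::metric_space"
  shows "ennreal (dist x y) \<le> ediameter (UNIV :: 'a set)"
  unfolding ediameter_def by (meson SUP_upper2 UNIV_I order_refl)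

lemma less_ediameter:
  fixes x y :: "'a::metric_space"
  assumes "r < dist x y" "x \<noteq> y"
  shows "ennreal r < ediameter (UNIV :: 'a set)"
proof -
  have "ennreal r < ennreal (dist x y)" using assms by (intro ennreal_lessI) auto
  then show ?thesis using dist_le_ediameter by (rule less_le_trans)
qed

text \<open>Packing argument: around the points of an \<open>e\<close>-separated set in
  \<open>ball q (2 * s)\<close>, the balls of radius \<open>e / 2\<close> are disjoint, have measure
  at least \<open>\<alpha>\<close>, and lie in \<open>ball q (3 * s)\<close>, whose measure is
  finite. Cardinalities are therefore bounded, and a separated set of maximal cardinality is a
  net.\<close>

lemma Ahlfors_finite_net:
  fixes \<mu> :: "'a::metric_space measure" and q :: 'a
  assumes ar: "Ahlfors_regular Q \<mu>" and M: "sets \<mu> = sets borel"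
    and s: "ennreal (3 * s) < ediameter (UNIV :: 'a set)" and e: "0 < e" "e \<le> s"
  obtains P where "finite P" "\<And>z. dist q z < 2 * s \<Longrightarrow> \<exists>p\<in>P. dist p z < e"
proof -
  obtain C where C: "C \<ge> 1" and lower: "\<And>x R. R > 0 \<Longrightarrow> ennreal R < ediameter (UNIV :: 'a set) \<Longrightarrow> ennreal (inverse C * R powr Q) \<le> emeasure \<mu> (ball x R)"
    and upper: "\<And>x R. R > 0 \<Longrightarrow> ennreal R < ediameter (UNIV :: 'a set) \<Longrightarrow> emeasure \<mu> (ball x R) \<le> ennreal (C * R powr Q)"
    using ar unfolding Ahlfors_regular_def by blast
  define \<alpha> where "\<alpha> = inverse C * (e / 2) powr Q"
  have \<alpha>: "\<alpha> > 0" using C e by (simp add: \<alpha>_def)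
  define N where "N = nat \<lceil>C * (3 * s) powr Q / \<alpha>\<rceil>"
  define S where "S = (\<lambda>P. finite P \<and> P \<subseteq> ball q (2 * s) \<and> (\<forall>x\<in>P. \<forall>y\<in>P. x \<noteq> y \<longrightarrow> e \<le> dist x y))"
  have card_le: "card P \<le> N" if P: "S P" for P
  proof -
    have fin: "finite P" using P by (simp add: S_def)
    have disj: "disjoint_family_on (\<lambda>p. ball p (e / 2)) P"
      unfolding disjoint_family_on_def
    proof (intro ballI impI)
      fix x y assume xy: "x \<in> P" "y \<in> P" "x \<noteq> y"
      then have "e \<le> dist x y" using P by (auto simp: S_def)
      then show "ball x (e / 2) \<inter> ball y (e / 2) = {}"
        by (auto simp: disjoint_iff) (smt (verit) dist_commute dist_triangle field_sum_of_halves)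
    qed
    have "ennreal (real (card P) * \<alpha>) = (\<Sum>p\<in>P. ennreal \<alpha>)"
      using \<alpha> by (simp add: ennreal_of_nat_eq_real_of_nat ennreal_mult)
    also have "\<dots> \<le> (\<Sum>p\<in>P. emeasure \<mu> (ball p (e / 2)))"
    proof (intro sum_mono)
      fix p
      have "ennreal (e / 2) \<le> ennreal (3 * s)" using e by (intro ennreal_leI) simp
      then show "ennreal \<alpha> \<le> emeasure \<mu> (ball p (e / 2))"
        unfolding \<alpha>_def using e s by (intro lower le_less_trans[OF _ s]) auto
    qed
    also have "\<dots> = emeasure \<mu> (\<Union>p\<in>P. ball p (e / 2))"
      using fin disj by (intro sum_emeasure) (auto simp: M)
    also have "\<dots> \<le> emeasure \<mu> (ball q (3 * s))"
    proof (intro emeasure_mono subsetI)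
      fix z assume "z \<in> (\<Union>p\<in>P. ball p (e / 2))"
      then obtain p where "p \<in> P" "dist p z < e / 2" by auto
      moreover then have "dist q p < 2 * s" using P by (auto simp: S_def)
      ultimately show "z \<in> ball q (3 * s)" using e dist_triangle[of q z p] by auto
    qed (simp add: M)
    also have "\<dots> \<le> ennreal (C * (3 * s) powr Q)" using e s by (intro upper) auto
    finally have "real (card P) * \<alpha> \<le> C * (3 * s) powr Q" using C by simp
    then have "real (card P) \<le> C * (3 * s) powr Q / \<alpha>" using \<alpha> by (simp add: field_simps)
    then show ?thesis unfolding N_def by linarith
  qed
  have "S {}" by (simp add: S_def)
  then have "\<exists>P. S P \<and> (\<forall>P'. S P' \<longrightarrow> card P' \<le> card P)"
    using card_le by (intro ex_has_greatest_nat[of S "{}" card "Suc N"]) (auto simp: less_Suc_eq_le)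
  then obtain P where P: "S P" and max: "\<And>P'. S P' \<Longrightarrow> card P' \<le> card P" by metis
  show ?thesis
  proof (rule that)
    show "finite P" using P by (simp add: S_def)
    fix z assume z: "dist q z < 2 * s"
    show "\<exists>p\<in>P. dist p z < e"
    proof (rule ccontr)
      assume far: "\<not> ?thesis"
      then have "z \<notin> P" using e by force
      have "S (insert z P)" using P z far unfolding S_def by (auto simp: dist_commute not_less)
      then have "card (insert z P) \<le> card P" by (rule max)
      then show False using P \<open>z \<notin> P\<close> by (simp add: S_def)
    qed
  qed
qed

text \<open>A regular space need not be separable: it may be a union of uncountably many pieces at
  mutual distance equal to the diameter. Each piece is separable.\<close>

lemma Ahlfors_separable_piece:
  fixes \<mu> :: "'a::metric_space measure" and x0 :: 'a
  assumes ar: "Ahlfors_regular Q \<mu>" and M: "sets \<mu> = sets borel"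
    and s: "s > 0" "ennreal (3 * s) < ediameter (UNIV :: 'a set)"
  obtains C U where "countable C" "C \<subseteq> U" "x0 \<in> U" "open U" "\<And>x. x \<in> U \<Longrightarrow> ball x s \<subseteq> U"
    "\<And>x e. x \<in> U \<Longrightarrow> e > 0 \<Longrightarrow> \<exists>c\<in>C. dist c x < e"
proof -
  have "\<forall>q::'a. \<exists>D. countable D \<and> (\<forall>z e. dist q z < 2 * s \<longrightarrow> e > 0 \<longrightarrow> (\<exists>d\<in>D. dist d z < e))"
  proof
    fix q :: 'a
    have "\<exists>P. finite P \<and> (\<forall>z. dist q z < 2 * s \<longrightarrow> (\<exists>p\<in>P. dist p z < min s (inverse (real (Suc n)))))" for n
      by (rule Ahlfors_finite_net[OF ar M s(2), of "min s (inverse (real (Suc n)))" q]) (use s in auto)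
    then obtain P where P: "\<And>n. finite (P n)" "\<And>n z. dist q z < 2 * s \<Longrightarrow> \<exists>p\<in>P n. dist p z < min s (inverse (real (Suc n)))"
      by metis
    show "\<exists>D. countable D \<and> (\<forall>z e. dist q z < 2 * s \<longrightarrow> e > 0 \<longrightarrow> (\<exists>d\<in>D. dist d z < e))"
    proof (intro exI[of _ "\<Union>n. P n"] conjI allI impI)
      show "countable (\<Union>n. P n)" using P(1) by (intro countable_UN) (auto intro: countable_finite)
      fix z and e :: real assume z: "dist q z < 2 * s" and e: "e > 0"
      obtain n where n: "inverse (real (Suc n)) < e" using reals_Archimedean e by blast
      obtain p where "p \<in> P n" "dist p z < min s (inverse (real (Suc n)))" using P(2)[OF z] by blast
      then show "\<exists>d\<in>\<Union>n. P n. dist d z < e" using n by (intro bexI[of _ p]) auto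
    qed
  qed
  from choice[OF this] obtain D
    where D0: "\<forall>q::'a. countable (D q) \<and> (\<forall>z e. dist q z < 2 * s \<longrightarrow> e > 0 \<longrightarrow> (\<exists>d\<in>D q. dist d z < e))" ..
  have D: "countable (D q)" "dist q z < 2 * s \<Longrightarrow> e > 0 \<Longrightarrow> \<exists>d\<in>D q. dist d z < e" for q z e
    using D0 by simp_all
  define T where "T = (\<lambda>S. \<Union>q\<in>S. D q)"
  \<comment> \<open>The closure of \<open>{x0}\<close> under \<open>D\<close>, where the countable
    set \<open>D q\<close> approximates every point of \<open>ball q (2 * s)\<close>.\<close>
  define C where "C = (\<Union>n. (T ^^ n) {x0})"
  have cnt: "countable ((T ^^ n) {x0})" for n
    by (induction n) (auto simp: T_def D(1))
  have C_step: "D q \<subseteq> C" if q: "q \<in> C" for q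
  proof -
    obtain n where "q \<in> (T ^^ n) {x0}" using q by (auto simp: C_def)
    then have "D q \<subseteq> (T ^^ Suc n) {x0}" by (auto simp: T_def)
    then show ?thesis unfolding C_def by blast
  qed
  have x0: "x0 \<in> C" unfolding C_def by (rule UN_I[of 0]) auto
  define U where "U = (\<Union>c\<in>C. ball c s)"
  show ?thesis
  proof (rule that[of C U])
    show "countable C" using cnt by (simp add: C_def)
    show "C \<subseteq> U" "open U" using s by (auto simp: U_def)
    then show "x0 \<in> U" using x0 by blast
    \<comment> \<open>Here the radius \<open>2 * s\<close> is needed: \<open>x\<close> is within
      \<open>s\<close> of some \<open>c \<in> C\<close>, so \<open>y\<close> is within
      \<open>2 * s\<close> of \<open>c\<close> and \<open>D c\<close> has a point within
      \<open>s\<close> of \<open>y\<close>.\<close>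
    show "ball x s \<subseteq> U" if x: "x \<in> U" for x
    proof
      fix y assume y: "y \<in> ball x s"
      obtain c where c: "c \<in> C" "dist c x < s" using x by (auto simp: U_def)
      have "dist c y < 2 * s" using c y dist_triangle[of c y x] by auto
      then obtain d where "d \<in> D c" "dist d y < s" using D(2) s by blast
      then show "y \<in> U" using C_step c by (auto simp: U_def)
    qed
    show "\<exists>c\<in>C. dist c x < e" if x: "x \<in> U" and e: "e > 0" for x e
    proof -
      obtain c where c: "c \<in> C" "dist c x < s" using x by (auto simp: U_def)
      then obtain d where "d \<in> D c" "dist d x < e" using D(2)[of c x e] e s by auto
      then show ?thesis using C_step c by blast
    qed
  qed
qed

text \<open>The uniform radius makes the complement of \<open>U\<close> open as well, by symmetry of
  the distance. A clopen set contains every connected set that it meets.\<close>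

lemma connected_subset_ball_closed:
  fixes U :: "'a::metric_space set"
  assumes S: "connected S" "S \<inter> U \<noteq> {}" and U: "open U" "s > 0" "\<And>x. x \<in> U \<Longrightarrow> ball x s \<subseteq> U"
  shows "S \<subseteq> U"
proof -
  have "open (- U)"
    unfolding open_contains_ball
  proof
    fix y assume "y \<in> - U"
    then have "ball y s \<subseteq> - U" using U(3) by (auto simp: subset_iff dist_commute)
    then show "\<exists>e>0. ball y e \<subseteq> - U" using U(2) by blast
  qed
  then have "U \<inter> S = {} \<or> - U \<inter> S = {}" by (intro connectedD[OF S(1) U(1)]) auto
  then show ?thesis using S(2) by blast
qed

text \<open>The measure on the whole space need not be sigma-finite. Its restriction to a separable
  piece is: countably many balls cover \<open>U\<close>, and \<open>- U\<close> is a null set of the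
  restriction.\<close>

lemma sigma_finite_density_indicator:
  fixes M :: "'a::metric_space measure"
  assumes M: "sets M = sets borel" and U: "U \<in> sets borel" and C: "countable C" "U \<subseteq> (\<Union>c\<in>C. ball c r)"
    and fin: "\<And>c. c \<in> C \<Longrightarrow> emeasure M (ball c r) < \<infinity>"
  shows "sigma_finite_measure (density M (indicator U))"
proof
  let ?A = "insert (- U) ((\<lambda>c. ball c r) ` C)"
  have sp: "space M = UNIV" using sets_eq_imp_space_eq[OF M] by simp
  have em: "emeasure (density M (indicator U)) B = emeasure M (U \<inter> B)" if "B \<in> sets borel" for B
    using that U M by (subst emeasure_density)
      (auto simp: nn_integral_indicator[symmetric] indicator_inter_arith intro!: nn_integral_cong)
  show "\<exists>A. countable A \<and> A \<subseteq> sets (density M (indicator U)) \<and> \<Union> A = space (density M (indicator U)) \<and>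
     (\<forall>a\<in>A. emeasure (density M (indicator U)) a \<noteq> \<infinity>)"
  proof (intro exI[of _ ?A] conjI ballI)
    show "countable ?A" using C by simp
    have "- U \<in> sets M" using borel_comp[OF U] by (simp add: M)
    then show "?A \<subseteq> sets (density M (indicator U))" by (auto simp: M)
    show "\<Union> ?A = space (density M (indicator U))" using C(2) sp by auto
    fix B assume "B \<in> ?A"
    then consider "B = - U" | c where "c \<in> C" "B = ball c r" by blast
    then show "emeasure (density M (indicator U)) B \<noteq> \<infinity>"
    proof cases
      case 1 then show ?thesis using em[of B] U by auto
    next
      case (2 c)
      have "emeasure M (U \<inter> B) \<le> emeasure M B" using 2 U M by (intro emeasure_mono) auto
      then show ?thesis using em[of B] fin[OF 2(1)] 2 by (auto simp: top_unique less_top)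
    qed
  qed
qed

text \<open>The set is open, but without separability the product of the Borel sigma-algebras may
  miss open sets. Centres in \<open>C\<close> and rational radii exhibit it as a countable union of
  measurable rectangles.\<close>

lemma dist_less_product_measurable:
  fixes U :: "'a::metric_space set" and V :: "'b::metric_space set" and g :: "'b \<Rightarrow> 'a"
  assumes U: "open U" and V: "open V" and g: "continuous_on UNIV g"
    and C: "countable C" "\<And>x e. x \<in> U \<Longrightarrow> e > 0 \<Longrightarrow> \<exists>c\<in>C. dist c x < e"
  shows "{(x, w). x \<in> U \<and> w \<in> V \<and> dist x (g w) < e} \<in> sets (borel \<Otimes>\<^sub>M borel)"
proof -
  define R where "R = (\<lambda>(c, r). (ball c r \<inter> U) \<times> {w\<in>V. dist c (g w) < e - r})"
  have eq: "{(x, w). x \<in> U \<and> w \<in> V \<and> dist x (g w) < e} = (\<Union>p\<in>C \<times> \<rat>. R p)"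
  proof (intro equalityI subsetI)
    fix p assume "p \<in> {(x, w). x \<in> U \<and> w \<in> V \<and> dist x (g w) < e}"
    then obtain x w where p: "p = (x, w)" "x \<in> U" "w \<in> V" "dist x (g w) < e" by auto
    define \<eta> where "\<eta> = (e - dist x (g w)) / 2"
    have \<eta>: "\<eta> > 0" using p by (simp add: \<eta>_def)
    obtain c where c: "c \<in> C" "dist c x < \<eta>" using C(2)[OF p(2) \<eta>] by blast
    obtain r where r: "r \<in> \<rat>" "dist c x < r" "r < \<eta>" using Rats_dense_in_real[OF c(2)] by blast
    have "dist c (g w) \<le> dist c x + dist x (g w)" by (rule dist_triangle)
    also have "\<dots> < e - r" using c r unfolding \<eta>_def by argo
    finally have "p \<in> R (c, r)" using p r by (auto simp: R_def)
    then show "p \<in> (\<Union>p\<in>C \<times> \<rat>. R p)" using c r by blast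
  next
    fix p assume "p \<in> (\<Union>p\<in>C \<times> \<rat>. R p)"
    then obtain c r x w where "p = (x, w)" "dist c x < r" "x \<in> U" "w \<in> V" "dist c (g w) < e - r"
      by (auto simp: R_def)
    then show "p \<in> {(x, w). x \<in> U \<and> w \<in> V \<and> dist x (g w) < e}"
      using dist_triangle[of x "g w" c] by (auto simp: dist_commute)
  qed
  have Rm: "R (c, r) \<in> sets (borel \<Otimes>\<^sub>M borel)" for c r
  proof -
    have "open {w. dist c (g w) < e - r}" using g by (intro open_Collect_less continuous_intros)
    then have "open {w\<in>V. dist c (g w) < e - r}" using V by (simp add: Collect_conj_eq open_Int)
    then show ?thesis unfolding R_def using U by auto
  qed
  have "countable (C \<times> (\<rat> :: real set))" by (intro countable_SIGMA C(1) countable_rat)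
  then have "(\<Union>p\<in>C \<times> \<rat>. R p) \<in> sets (borel \<Otimes>\<^sub>M borel)"
  proof (rule sets.countable_UN'')
    fix p assume "p \<in> C \<times> (\<rat> :: real set)"
    then show "R p \<in> sets (borel \<Otimes>\<^sub>M borel)" using Rm[of "fst p" "snd p"] by simp
  qed
  then show ?thesis unfolding eq .
qed

section \<open>Energy of the transferred density\<close>

lemma ennpowr_measurable [measurable]: "(\<lambda>x. ennpowr x p) \<in> borel_measurable borel"
  unfolding ennpowr_def infinity_ennreal_def by measurable

text \<open>The anchors \<open>p1\<close> and \<open>p2\<close> supply the far point of the
  three-point comparison: no \<open>x\<close> equals both. The constant \<open>K\<close> is the
  distortion of cross ratios up to 3, the value arising in that comparison.\<close>

locale moebius_transfer =
  fixes Q :: real and \<mu> :: "'a::metric_space measure" and \<nu> :: "'b::metric_space measure"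
    and f :: "'a \<Rightarrow> 'b" and g :: "'b \<Rightarrow> 'a" and K C1 C2 e0 :: real and U C :: "'a set"
    and p1 p2 :: 'a and h :: "'b \<Rightarrow> ennreal"
  assumes Q: "Q > 1"
    and sets_mu: "sets \<mu> = sets borel" and sets_nu: "sets \<nu> = sets borel"
    and cont_f: "continuous_on UNIV f" and cont_g: "continuous_on UNIV g"
    and gf [simp]: "\<And>x. g (f x) = x" and fg [simp]: "\<And>y. f (g y) = y"
    and moebius: "\<And>a b c e. \<lbrakk>a \<noteq> b; c \<noteq> e; cross_ratio a b c e \<le> 3\<rbrakk> \<Longrightarrow> cross_ratio (f a) (f b) (f c) (f e) \<le> K"
    and K: "K \<ge> 1"
    and upper: "\<And>x R. \<lbrakk>0 < R; ennreal R < ediameter (UNIV :: 'a set)\<rbrakk> \<Longrightarrow> emeasure \<mu> (ball x R) \<le> ennreal (C1 * R powr Q)"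
    and C1: "C1 \<ge> 1"
    and lower: "\<And>y R. \<lbrakk>0 < R; ennreal R < ediameter (UNIV :: 'b set)\<rbrakk> \<Longrightarrow> ennreal (inverse C2 * R powr Q) \<le> emeasure \<nu> (ball y R)"
    and C2: "C2 \<ge> 1"
    and open_U: "open U" and e0: "e0 > 0" "ennreal e0 < ediameter (UNIV :: 'a set)"
    and ball_U: "\<And>x. x \<in> U \<Longrightarrow> ball x e0 \<subseteq> U"
    and dense_C: "countable C" "\<And>x e. x \<in> U \<Longrightarrow> e > 0 \<Longrightarrow> \<exists>c\<in>C. dist c x < e"
    and sf_mu: "sigma_finite_measure (density \<mu> (indicator U))"
    and sf_nu: "sigma_finite_measure (density \<nu> (indicator (f ` U)))"
    and p12: "p1 \<noteq> p2"
    and lsc_h: "\<And>a. open {y. a < h y}"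
begin

lemma inj_f: "f x = f y \<longleftrightarrow> x = y"
  by (metis gf)

lemma image_eq_vimage: "f ` U = g -` U"
  by force

lemma open_image: "open (f ` U)"
  unfolding image_eq_vimage using cont_g open_U by (simp add: open_vimage)

definition osc :: "real \<Rightarrow> 'a \<Rightarrow> ennreal" where
  "osc e x = (SUP y\<in>ball x e. ennreal (dist (f x) (f y)))"

text \<open>The truncation at \<open>1 / e\<close> keeps \<open>rho\<close> finite, as
  \<open>admissible_limit\<close> works with real-valued functions; it disappears as
  \<open>e\<close> tends to 0.\<close>

definition low :: "real \<Rightarrow> 'a \<Rightarrow> ennreal" where
  "low e x = min (ennreal (1 / e)) (INF y\<in>ball x e. h (f y))"

text \<open>Points for which some anchor is far at scale \<open>e\<close>, both in X and in Y.
  Cutting \<open>rho\<close> off outside costs nothing for a curve in \<open>U\<close>, since every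
  compact subset of \<open>U\<close> is eventually contained in \<open>good e\<close>.\<close>

definition good :: "real \<Rightarrow> 'a set" where
  "good e = {x \<in> U. \<exists>p\<in>{p1, p2}. 2 * e < dist x p \<and> osc e x < ennreal (dist (f x) (f p))}"

definition rho :: "real \<Rightarrow> 'a \<Rightarrow> ennreal" where
  "rho e x = indicator (good e) x * (ennreal (1 / e) * osc e x * low e x)"

lemma dist_le_osc: "dist x y < e \<Longrightarrow> ennreal (dist (f x) (f y)) \<le> osc e x"
  unfolding osc_def by (intro SUP_upper) simp

lemma low_le: "dist x y < e \<Longrightarrow> low e x \<le> h (f y)"
  unfolding low_def by (intro min.coboundedI2 INF_lower) simp

lemma h_measurable [measurable]: "h \<in> borel_measurable borel"
  by (rule borel_measurableI_greater) (simp add: lsc_h borel_open)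

section \<open>Measurability and finiteness of the transferred density\<close>

lemma osc_measurable [measurable]: "osc e \<in> borel_measurable borel"
proof (rule borel_measurableI_greater)
  fix a
  have "{x \<in> space borel. a < osc e x} = (\<Union>y. ball y e \<inter> {x. a < ennreal (dist (f x) (f y))})"
    by (auto simp: osc_def less_SUP_iff dist_commute)
  moreover have "open {x. a < ennreal (dist (f x) (f y))}" for y
    by (intro open_Collect_less continuous_intros continuous_on_ennreal cont_f)
  ultimately have "open {x \<in> space borel. a < osc e x}" by (simp add: open_Int open_UN)
  then show "{x \<in> space borel. a < osc e x} \<in> sets borel" by (rule borel_open)
qed

lemma low_measurable [measurable]: "low e \<in> borel_measurable borel"
proof -
  have "(\<lambda>x. INF y\<in>ball x e. h (f y)) \<in> borel_measurable borel"
  proof (rule borel_measurableI_less)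
    fix a
    have "{x \<in> space borel. (INF y\<in>ball x e. h (f y)) < a} = (\<Union>y\<in>{y. h (f y) < a}. ball y e)"
      by (auto simp: INF_less_iff dist_commute)
    then have "open {x \<in> space borel. (INF y\<in>ball x e. h (f y)) < a}"
      by (simp only:) (intro open_UN ballI open_ball)
    then show "{x \<in> space borel. (INF y\<in>ball x e. h (f y)) < a} \<in> sets borel" by (rule borel_open)
  qed
  then show ?thesis unfolding low_def by measurable
qed

lemma good_measurable [measurable]: "good e \<in> sets borel"
proof -
  have [measurable]: "f \<in> borel_measurable borel" using cont_f by (rule borel_measurable_continuous_onI)
  have [measurable]: "U \<in> sets borel" using open_U by (rule borel_open)
  have [measurable]: "(\<lambda>x. ennreal (dist (f x) (f p))) \<in> borel_measurable borel" for p
    by (intro borel_measurable_continuous_onI continuous_intros continuous_on_ennreal cont_f)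
  have [measurable]: "(\<lambda>x. dist x p) \<in> borel_measurable borel" for p :: 'a
    by (intro borel_measurable_continuous_onI continuous_intros)
  have "good e = U \<inter> ({x\<in>space borel. 2 * e < dist x p1 \<and> osc e x < ennreal (dist (f x) (f p1))} \<union>
     {x\<in>space borel. 2 * e < dist x p2 \<and> osc e x < ennreal (dist (f x) (f p2))})"
    by (auto simp: good_def)
  also have "\<dots> \<in> sets borel" by measurable
  finally show ?thesis .
qed

lemma rho_measurable [measurable]: "rho e \<in> borel_measurable borel"
  unfolding rho_def by measurable

lemma rho_finite:
  assumes "e > 0"
  shows "rho e x < \<infinity>"
proof (cases "x \<in> good e")
  case True
  then have "osc e x < \<infinity>" by (auto simp: good_def intro: less_trans)
  moreover have "low e x < \<infinity>" unfolding low_def by (simp add: min_less_iff_disj)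
  ultimately show ?thesis using True by (simp add: rho_def ennreal_mult_less_top)
qed (simp add: rho_def)

text \<open>Three-point comparison: the cross ratio with the far point \<open>p\<close> turns the Moebius condition
  into a lower bound for the distance from \<open>f x\<close> to the image of the complement of the ball.\<close>

lemma ball_subset_image:
  assumes e: "e > 0" and far: "2 * e < dist x p" and small: "osc e x < ennreal (dist (f x) (f p))"
    and l: "l = enn2real (osc e x)" "l > 0"
  shows "ball (f x) (l / (4 * K)) \<subseteq> f ` ball x e"
proof
  fix w assume w: "w \<in> ball (f x) (l / (4 * K))"
  define z where "z = g w"
  have wz: "w = f z" by (simp add: z_def)
  have osc_l: "osc e x = ennreal l" using small l by (cases "osc e x") auto
  have dl: "dist (f x) (f y) \<le> l" if "dist x y < e" for y
    using dist_le_osc[OF that] l unfolding osc_l by simp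
  have lp: "l < dist (f x) (f p)" using small l unfolding osc_l by (simp add: ennreal_less_iff)
  have "dist x z < e"
  proof (rule ccontr)
    assume "\<not> dist x z < e"
    then have xz: "e \<le> dist x z" by simp
    have "dist (f x) (f y) \<le> 4 * K * dist (f x) (f z)" if y: "dist x y < e" for y
    \<comment> \<open>If \<open>f z\<close> is more than half as far from \<open>f x\<close> as
      \<open>f p\<close> is, the claim follows from \<open>l < dist (f x) (f p)\<close> alone. Only
      otherwise is the cross ratio used.\<close>
    proof (cases "dist (f x) (f z) \<le> dist (f x) (f p) / 2")
      case False
      then have "dist (f x) (f y) \<le> 4 * dist (f x) (f z)" using dl[OF y] lp zero_le_dist[of "f x" "f z"] by linarith
      also have "\<dots> \<le> 4 * K * dist (f x) (f z)" using K by (intro mult_right_mono) auto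
      finally show ?thesis .
    next
      case True
      have yp: "dist x p - e < dist y p" using y dist_triangle[of x p y] by simp
      have neq: "x \<noteq> z" "y \<noteq> p" "z \<noteq> p" using xz yp far e True lp l by auto
      have "dist x y * dist z p \<le> dist x y * (dist x z + dist x p)"
        using dist_triangle[of z p x] by (intro mult_left_mono) (auto simp: dist_commute)
      also have "\<dots> = dist x z * dist x y + dist x y * dist x p" by (simp add: algebra_simps)
      also have "\<dots> \<le> dist x z * e + dist x z * dist x p"
        using y xz by (intro add_mono mult_left_mono mult_right_mono) auto
      also have "\<dots> = dist x z * (e + dist x p)" by (simp add: algebra_simps)
      \<comment> \<open>The 3 comes from \<open>2 * e < dist x p\<close>, which gives
        \<open>e + dist x p \<le> 3 * (dist x p - e)\<close>.\<close>
      also have "\<dots> \<le> dist x z * (3 * dist y p)" using yp far by (intro mult_left_mono) auto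
      finally have "cross_ratio x z y p \<le> 3"
        unfolding cross_ratio_def using neq by (simp add: divide_le_eq algebra_simps)
      then have "cross_ratio (f x) (f z) (f y) (f p) \<le> K" using neq by (intro moebius)
      then have le: "dist (f x) (f y) * dist (f z) (f p) \<le> K * (dist (f x) (f z) * dist (f y) (f p))"
        unfolding cross_ratio_def using neq inj_f by (simp add: divide_le_eq)
      \<comment> \<open>Up to a factor 2 each, \<open>dist (f z) (f p)\<close> and
        \<open>dist (f y) (f p)\<close> can be replaced by \<open>dist (f x) (f p)\<close>; this
        turns \<open>K\<close> into \<open>4 * K\<close>.\<close>
      have "dist (f x) (f p) / 2 \<le> dist (f z) (f p)" using True dist_triangle[of "f x" "f p" "f z"] by simp
      then have "dist (f x) (f y) * (dist (f x) (f p) / 2) \<le> dist (f x) (f y) * dist (f z) (f p)"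
        by (intro mult_left_mono) auto
      also have "\<dots> \<le> K * (dist (f x) (f z) * dist (f y) (f p))" by (rule le)
      also have "\<dots> \<le> K * (dist (f x) (f z) * (2 * dist (f x) (f p)))"
        using K dl[OF y] lp dist_triangle[of "f y" "f p" "f x"]
        by (intro mult_left_mono) (auto simp: dist_commute)
      finally have "dist (f x) (f y) * dist (f x) (f p) \<le> (4 * K * dist (f x) (f z)) * dist (f x) (f p)"
        by (simp add: algebra_simps)
      moreover have "dist (f x) (f p) > 0" using lp l by linarith
      ultimately show ?thesis by (simp only: mult_le_cancel_right_pos)
    qed
    then have "osc e x \<le> ennreal (4 * K * dist (f x) (f z))"
      unfolding osc_def by (intro SUP_least ennreal_leI) auto
    then have "l \<le> 4 * K * dist (f x) (f z)" unfolding osc_l using K by (subst (asm) ennreal_le_iff) auto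
    moreover have "4 * K * dist (f x) (f z) < l" using w K unfolding wz by (simp add: field_simps)
    ultimately show False by simp
  qed
  then show "w \<in> f ` ball x e" unfolding wz by auto
qed

definition density_int :: "real \<Rightarrow> 'a \<Rightarrow> ennreal" where
  "density_int e x = (\<integral>\<^sup>+w. indicator {(x, w). x \<in> U \<and> w \<in> f ` U \<and> dist x (g w) < e} (x, w) * ennpowr (h w) Q \<partial>\<nu>)"

text \<open>Lower regularity of Y bounds the Q-th power of the oscillation by the measure of the
  ball of radius \<open>R\<close> about \<open>f x\<close>. That ball lies in the image of
  \<open>ball x e\<close>, where \<open>h\<close> is at least \<open>low e x\<close>.\<close>

lemma rho_powr_le:
  assumes e: "0 < e" "e \<le> e0"
  shows "ennreal (enn2real (rho e x) powr Q) \<le> ennreal ((1 / e) powr Q * C2 * (4 * K) powr Q) * density_int e x"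
proof (cases "x \<in> good e \<and> enn2real (osc e x) > 0")
  case False
  then have "x \<notin> good e \<or> enn2real (osc e x) = 0" using enn2real_nonneg[of "osc e x"] by linarith
  then have "enn2real (rho e x) = 0" by (auto simp: rho_def enn2real_mult)
  then show ?thesis by simp
next
  case True
  define l where "l = enn2real (osc e x)"
  define m where "m = enn2real (low e x)"
  define R where "R = l / (4 * K)"
  have x: "x \<in> good e" and l: "l > 0" using True by (auto simp: l_def)
  obtain p where p: "2 * e < dist x p" "osc e x < ennreal (dist (f x) (f p))" and xU: "x \<in> U"
    using x by (auto simp: good_def)
  have m: "m \<ge> 0" "low e x = ennreal m"
  proof -
    have "low e x < \<infinity>" unfolding low_def by (simp add: min_less_iff_disj)
    then show "m \<ge> 0" "low e x = ennreal m" by (auto simp: m_def)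
  qed
  have sub: "ball (f x) R \<subseteq> f ` ball x e"
    unfolding R_def using ball_subset_image[OF e(1) p l_def l] .
  have R: "R > 0" using l K by (simp add: R_def)
  have osc_l: "osc e x = ennreal l" using p(2) by (cases "osc e x") (auto simp: l_def)
  \<comment> \<open>The anchor also guarantees that the radius is below the diameter of Y, as
    regularity demands.\<close>
  have "R \<le> l" using l K by (simp add: R_def field_simps)
  also have "l < dist (f x) (f p)" using p(2) l unfolding osc_l by (simp add: ennreal_less_iff)
  finally have "ennreal R < ediameter (UNIV :: 'b set)" using p(1) e inj_f by (intro less_ediameter) auto
  then have "ennreal (inverse C2 * R powr Q) \<le> emeasure \<nu> (ball (f x) R)" using R by (intro lower)
  then have "ennreal (m powr Q) * ennreal (inverse C2 * R powr Q) \<le> ennreal (m powr Q) * emeasure \<nu> (ball (f x) R)"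
    by (intro mult_left_mono) auto
  also have "\<dots> = (\<integral>\<^sup>+w. ennreal (m powr Q) * indicator (ball (f x) R) w \<partial>\<nu>)"
    by (intro nn_integral_cmult_indicator[symmetric]) (simp add: sets_nu)
  also have "\<dots> \<le> density_int e x"
    unfolding density_int_def
  proof (intro nn_integral_mono)
    fix w
    show "ennreal (m powr Q) * indicator (ball (f x) R) w \<le>
        indicator {(x, w). x \<in> U \<and> w \<in> f ` U \<and> dist x (g w) < e} (x, w) * ennpowr (h w) Q"
    proof (cases "w \<in> ball (f x) R")
      case True
      then obtain z where z: "w = f z" "dist x z < e" using sub by auto
      then have "z \<in> U" using ball_U[OF xU] e by auto
      have "ennreal (m powr Q) = ennpowr (low e x) Q" using m by (simp add: ennpowr_ennreal)
      also have "\<dots> \<le> ennpowr (h w) Q" using low_le[OF z(2)] z Q by (intro ennpowr_mono) auto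
      finally show ?thesis using True z xU \<open>z \<in> U\<close> by (simp add: indicator_def)
    qed simp
  qed
  finally have main: "ennreal (m powr Q) * ennreal (inverse C2 * R powr Q) \<le> density_int e x" .
  have "enn2real (rho e x) = 1 / e * l * m"
    using x e by (simp add: rho_def enn2real_mult l_def m_def)
  then have "enn2real (rho e x) powr Q = (1 / e) powr Q * l powr Q * m powr Q"
    using e l m by (simp add: powr_mult powr_divide)
  also have "l powr Q = (4 * K) powr Q * R powr Q"
    using l K by (subst powr_mult[symmetric]) (auto simp: R_def)
  also have "(1 / e) powr Q * ((4 * K) powr Q * R powr Q) * m powr Q =
     ((1 / e) powr Q * C2 * (4 * K) powr Q) * (m powr Q * (inverse C2 * R powr Q))"
    using C2 by (simp add: field_simps)
  finally have "ennreal (enn2real (rho e x) powr Q) =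
     ennreal ((1 / e) powr Q * C2 * (4 * K) powr Q) * (ennreal (m powr Q) * ennreal (inverse C2 * R powr Q))"
    using C2 e K by (simp add: ennreal_mult[symmetric])
  also have "\<dots> \<le> ennreal ((1 / e) powr Q * C2 * (4 * K) powr Q) * density_int e x"
    by (intro mult_left_mono main) auto
  finally show ?thesis .
qed

text \<open>Integrate \<open>rho_powr_le\<close> and exchange the integrals: for fixed
  \<open>w\<close>, the relevant \<open>x\<close> lie in \<open>ball (g w) e\<close>, of measure at
  most \<open>C1 * e powr Q\<close>, which cancels the factor \<open>(1 / e) powr Q\<close>.\<close>

lemma rho_energy:
  assumes e: "0 < e" "e \<le> e0"
  shows "(\<integral>\<^sup>+x. ennreal (enn2real (rho e x) powr Q) \<partial>\<mu>) \<le>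
     ennreal (C1 * C2 * (4 * K) powr Q) * (\<integral>\<^sup>+w. indicator (f ` U) w * ennpowr (h w) Q \<partial>\<nu>)"
proof -
  define M where "M = density \<mu> (indicator U)"
  define N where "N = density \<nu> (indicator (f ` U))"
  interpret M: sigma_finite_measure M unfolding M_def by (rule sf_mu)
  interpret N: sigma_finite_measure N unfolding N_def by (rule sf_nu)
  interpret MN: pair_sigma_finite M N ..
  define S where "S = {(x, w). x \<in> U \<and> w \<in> f ` U \<and> dist x (g w) < e}"
  have [measurable_cong]: "sets M = sets borel" "sets N = sets borel"
    by (simp_all add: M_def N_def sets_mu sets_nu)
  have [measurable_cong]: "sets \<mu> = sets borel" "sets \<nu> = sets borel" by (fact sets_mu sets_nu)+
  have [measurable]: "U \<in> sets borel" "f ` U \<in> sets borel" using open_U open_image by auto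
  have [measurable]: "ball y e \<in> sets borel" for y :: 'a by simp
  have S[measurable]: "S \<in> sets (borel \<Otimes>\<^sub>M borel)"
    unfolding S_def by (rule dist_less_product_measurable[OF open_U open_image cont_g dense_C])
  define A where "A = ennreal ((1 / e) powr Q * C2 * (4 * K) powr Q)"
  have di: "density_int e x = indicator U x * (\<integral>\<^sup>+w. indicator S (x, w) * ennpowr (h w) Q \<partial>N)" for x
  proof -
    have "density_int e x = (\<integral>\<^sup>+w. indicator (f ` U) w * (indicator S (x, w) * ennpowr (h w) Q) \<partial>\<nu>)"
      unfolding density_int_def S_def by (intro nn_integral_cong) (auto simp: indicator_def)
    also have "\<dots> = (\<integral>\<^sup>+w. indicator S (x, w) * ennpowr (h w) Q \<partial>N)"
      unfolding N_def by (subst nn_integral_density) measurable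
    also have "\<dots> = indicator U x * (\<integral>\<^sup>+w. indicator S (x, w) * ennpowr (h w) Q \<partial>N)"
      by (cases "x \<in> U") (auto simp: S_def)
    finally show ?thesis .
  qed
  have "(\<integral>\<^sup>+x. ennreal (enn2real (rho e x) powr Q) \<partial>\<mu>) \<le> (\<integral>\<^sup>+x. A * density_int e x \<partial>\<mu>)"
    unfolding A_def by (intro nn_integral_mono rho_powr_le e)
  also have "\<dots> = (\<integral>\<^sup>+x. indicator U x * (A * (\<integral>\<^sup>+w. indicator S (x, w) * ennpowr (h w) Q \<partial>N)) \<partial>\<mu>)"
    unfolding di by (intro nn_integral_cong) (auto simp: mult_ac)
  also have "\<dots> = (\<integral>\<^sup>+x. A * (\<integral>\<^sup>+w. indicator S (x, w) * ennpowr (h w) Q \<partial>N) \<partial>M)"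
    unfolding M_def by (subst nn_integral_density) measurable
  also have "\<dots> = A * (\<integral>\<^sup>+x. \<integral>\<^sup>+w. indicator S (x, w) * ennpowr (h w) Q \<partial>N \<partial>M)"
    by (rule nn_integral_cmult) measurable
  also have "(\<integral>\<^sup>+x. \<integral>\<^sup>+w. indicator S (x, w) * ennpowr (h w) Q \<partial>N \<partial>M) =
      (\<integral>\<^sup>+w. \<integral>\<^sup>+x. indicator S (x, w) * ennpowr (h w) Q \<partial>M \<partial>N)"
    by (rule MN.Fubini'[symmetric]) measurable
  also have "\<dots> \<le> (\<integral>\<^sup>+w. ennreal (C1 * e powr Q) * ennpowr (h w) Q \<partial>N)"
  proof (intro nn_integral_mono)
    fix w
    have "(\<integral>\<^sup>+x. indicator S (x, w) * ennpowr (h w) Q \<partial>M) \<le> (\<integral>\<^sup>+x. indicator (ball (g w) e) x * ennpowr (h w) Q \<partial>M)"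
      by (intro nn_integral_mono) (auto simp: S_def indicator_def dist_commute)
    also have "\<dots> = (\<integral>\<^sup>+x. indicator (ball (g w) e) x \<partial>M) * ennpowr (h w) Q"
      by (rule nn_integral_multc) measurable
    also have "(\<integral>\<^sup>+x. indicator (ball (g w) e) x \<partial>M) = emeasure M (ball (g w) e)"
      by (rule nn_integral_indicator) (simp add: M_def sets_mu)
    also have "emeasure M (ball (g w) e) \<le> emeasure \<mu> (ball (g w) e)"
    proof -
      have "emeasure M (ball (g w) e) = (\<integral>\<^sup>+x. indicator U x * indicator (ball (g w) e) x \<partial>\<mu>)"
        unfolding M_def by (subst emeasure_density) auto
      also have "\<dots> \<le> (\<integral>\<^sup>+x. indicator (ball (g w) e) x \<partial>\<mu>)" by (intro nn_integral_mono) (auto simp: indicator_def)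
      also have "\<dots> = emeasure \<mu> (ball (g w) e)" by simp
      finally show ?thesis .
    qed
    also have "emeasure \<mu> (ball (g w) e) \<le> ennreal (C1 * e powr Q)"
      using e e0 by (intro upper) (auto intro: le_less_trans[OF ennreal_leI])
    finally show "(\<integral>\<^sup>+x. indicator S (x, w) * ennpowr (h w) Q \<partial>M) \<le> ennreal (C1 * e powr Q) * ennpowr (h w) Q"
      by (simp add: mult_right_mono)
  qed
  also have "\<dots> = ennreal (C1 * e powr Q) * (\<integral>\<^sup>+w. ennpowr (h w) Q \<partial>N)"
    by (rule nn_integral_cmult) measurable
  also have "(\<integral>\<^sup>+w. ennpowr (h w) Q \<partial>N) = (\<integral>\<^sup>+w. indicator (f ` U) w * ennpowr (h w) Q \<partial>\<nu>)"
    unfolding N_def by (subst nn_integral_density) measurable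
  finally have "(\<integral>\<^sup>+x. ennreal (enn2real (rho e x) powr Q) \<partial>\<mu>) \<le>
     A * (ennreal (C1 * e powr Q) * (\<integral>\<^sup>+w. indicator (f ` U) w * ennpowr (h w) Q \<partial>\<nu>))"
    by (simp add: mult_left_mono)
  also have "\<dots> = ennreal ((1 / e) powr Q * C2 * (4 * K) powr Q * (C1 * e powr Q)) * (\<integral>\<^sup>+w. indicator (f ` U) w * ennpowr (h w) Q \<partial>\<nu>)"
    unfolding A_def using C1 C2 by (simp add: ennreal_mult[symmetric] mult.assoc[symmetric])
  also have "(1 / e) powr Q * C2 * (4 * K) powr Q * (C1 * e powr Q) = C1 * C2 * (4 * K) powr Q"
    using e by (simp add: powr_divide)
  finally show ?thesis .
qed

end

section \<open>Integrals of the transferred density along curves\<close>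

lemma sum_emeasure_intervals:
  fixes M :: "real measure" and u :: "nat \<Rightarrow> real"
  assumes M: "sets M = sets borel" and u: "mono_on {..n} u"
  shows "(\<Sum>i<n. emeasure M {u i..<u (Suc i)}) = emeasure M {u 0..<u n}"
  using u
proof (induction n)
  case (Suc n)
  have m: "mono_on {..n} u" using Suc.prems by (rule mono_on_subset) auto
  have le: "u 0 \<le> u n" "u n \<le> u (Suc n)" using Suc.prems by (auto simp: mono_on_def)
  have "(\<Sum>i<Suc n. emeasure M {u i..<u (Suc i)}) = emeasure M {u 0..<u n} + emeasure M {u n..<u (Suc n)}"
    using Suc.IH[OF m] by simp
  also have "\<dots> = emeasure M ({u 0..<u n} \<union> {u n..<u (Suc n)})"
    by (intro plus_emeasure) (auto simp: M)
  also have "{u 0..<u n} \<union> {u n..<u (Suc n)} = {u 0..<u (Suc n)}" using le by auto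
  finally show ?case .
qed simp

context moebius_transfer
begin

section \<open>Behaviour of \<open>low\<close> and \<open>good\<close> as the scale tends to
  0\<close>

lemma low_mono: "0 < e' \<Longrightarrow> e' \<le> e \<Longrightarrow> low e x \<le> low e' x"
  unfolding low_def by (intro min.mono INF_superset_mono ennreal_leI divide_left_mono) auto

text \<open>Half the scale is traded for moving the centre: \<open>ball y e'\<close> is contained in
  \<open>ball x e\<close>.\<close>

lemma low_shift:
  assumes "0 < e'" "e' \<le> e / 2" "dist x y < e / 2"
  shows "low e x \<le> low e' y"
  unfolding low_def
proof (intro min.mono INF_superset_mono ennreal_leI divide_left_mono)
  show "ball y e' \<subseteq> ball x e"
  proof
    fix z assume "z \<in> ball y e'"
    then show "z \<in> ball x e" using assms dist_triangle[of x z y] by simp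
  qed
qed (use assms in auto)

text \<open>By lower semicontinuity of \<open>h\<close> and continuity of \<open>f\<close>, any
  level below \<open>h (f x)\<close> is exceeded on a whole ball about \<open>x\<close>, while the
  truncation \<open>1 / e\<close> grows beyond every real.\<close>

lemma SUP_low: "(SUP n. low (1 / real (Suc n)) x) = h (f x)"
proof (rule antisym)
  show "(SUP n. low (1 / real (Suc n)) x) \<le> h (f x)" by (intro SUP_least low_le) simp
  show "h (f x) \<le> (SUP n. low (1 / real (Suc n)) x)"
  proof (rule dense_le)
    fix a assume "a < h (f x)"
    moreover have "open (f -` {y. a < h y})" by (rule open_vimage[OF lsc_h cont_f])
    ultimately obtain e where e: "e > 0" "ball x e \<subseteq> f -` {y. a < h y}"
      by (metis (mono_tags) mem_Collect_eq open_contains_ball vimageI)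
    obtain b where b: "b \<ge> 0" "a = ennreal b" using \<open>a < h (f x)\<close> by (cases a) auto
    obtain n1 where n1: "inverse (real (Suc n1)) < e" using reals_Archimedean e by blast
    obtain n2 where n2: "b < real n2" using reals_Archimedean2 by blast
    define n where "n = max n1 n2"
    have "inverse (real (Suc n)) \<le> inverse (real (Suc n1))" by (simp add: n_def)
    then have "ball x (1 / real (Suc n)) \<subseteq> f -` {y. a < h y}"
      using e n1 by (force simp: inverse_eq_divide)
    then have "a \<le> (INF y\<in>ball x (1 / real (Suc n)). h (f y))"
      by (intro INF_greatest) (auto intro: less_imp_le)
    moreover have "a \<le> ennreal (1 / (1 / real (Suc n)))"
      unfolding b using n2 by (intro ennreal_leI) (simp add: n_def)
    ultimately have "a \<le> low (1 / real (Suc n)) x" unfolding low_def by simp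
    also have "\<dots> \<le> (SUP n. low (1 / real (Suc n)) x)" by (rule SUP_upper) simp
    finally show "a \<le> (SUP n. low (1 / real (Suc n)) x)" .
  qed
qed

lemma eventually_good:
  assumes S: "compact S" "S \<subseteq> U"
  shows "\<forall>\<^sub>F e in at_right 0. S \<subseteq> good e"
proof (cases "S = {}")
  case False
  \<comment> \<open>\<open>F\<close> is continuous and positive, as \<open>x\<close> differs from
    one anchor; its minimum \<open>m\<close> on \<open>S\<close> is the uniform distance to a
    suitable anchor in both spaces.\<close>
  define F where "F = (\<lambda>x. max (min (dist x p1) (dist (f x) (f p1))) (min (dist x p2) (dist (f x) (f p2))))"
  have "continuous_on S F"
    unfolding F_def by (intro continuous_intros continuous_on_subset[OF cont_f]) auto
  then obtain x0 where x0: "x0 \<in> S" "\<And>x. x \<in> S \<Longrightarrow> F x0 \<le> F x"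
    using continuous_attains_inf[OF S(1) False] by blast
  define m where "m = F x0"
  have m: "m > 0" using p12 inj_f[of x0 p1] inj_f[of x0 p2] unfolding m_def F_def
    by (cases "x0 = p1") (auto simp: less_max_iff_disj)
  have cover: "S \<subseteq> (\<Union>y. f -` ball y (m / 4))"
  proof
    fix x show "x \<in> (\<Union>y. f -` ball y (m / 4))" by (rule UN_I[of "f x"]) (use m in simp_all)
  qed
  have opens: "open G" if "G \<in> range (\<lambda>y. f -` ball y (m / 4))" for G
    using that by (auto intro!: open_vimage cont_f)
  \<comment> \<open>A Lebesgue number of the cover bounds the oscillation by \<open>m / 2\<close>
    uniformly on \<open>S\<close>.\<close>
  obtain d where d: "d > 0" "\<And>x. x \<in> S \<Longrightarrow> \<exists>G\<in>range (\<lambda>y. f -` ball y (m / 4)). ball x d \<subseteq> G"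
    using Heine_Borel_lemma[OF S(1) cover opens] by blast
  have "S \<subseteq> good e" if e: "0 < e" "e < min (m / 2) d" for e
  proof
    fix x assume x: "x \<in> S"
    obtain y where y: "ball x d \<subseteq> f -` ball y (m / 4)" using d(2)[OF x] by blast
    have "dist (f x) (f z) \<le> m / 2" if z: "dist x z < e" for z
    proof -
      have "x \<in> ball x d" "z \<in> ball x d" using d z e by auto
      then have "x \<in> f -` ball y (m / 4)" "z \<in> f -` ball y (m / 4)" using y by blast+
      then have "dist y (f x) < m / 4" "dist y (f z) < m / 4" by auto
      then show ?thesis using dist_triangle3[of "f x" "f z" y] by linarith
    qed
    then have osc: "osc e x \<le> ennreal (m / 2)" unfolding osc_def by (intro SUP_least ennreal_leI) auto
    have "m \<le> F x" using x0 x by (simp add: m_def)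
    then consider "m \<le> dist x p1" "m \<le> dist (f x) (f p1)" | "m \<le> dist x p2" "m \<le> dist (f x) (f p2)"
      unfolding F_def by linarith
    then obtain p where p: "p \<in> {p1, p2}" "m \<le> dist x p" "m \<le> dist (f x) (f p)" by cases auto
    have "osc e x < ennreal (dist (f x) (f p))"
      using osc p m by (intro le_less_trans[OF osc] ennreal_lessI) auto
    moreover have "2 * e < dist x p" using e p by simp
    ultimately show "x \<in> good e" using x S p(1) unfolding good_def by blast
  qed
  then show ?thesis unfolding eventually_at_right_field using m d by (intro exI[of _ "min (m / 2) d"]) auto
qed simp

end

locale transfer_path = moebius_transfer Q \<mu> \<nu> f g K C1 C2 e0 U C p1 p2 h + rectifiable_path a b \<gamma>
  for Q :: real and \<mu> :: "'a::metric_space measure" and \<nu> :: "'b::metric_space measure"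
    and f :: "'a \<Rightarrow> 'b" and g :: "'b \<Rightarrow> 'a" and K C1 C2 e0 :: real and U C :: "'a set"
    and p1 p2 :: 'a and h :: "'b \<Rightarrow> ennreal" and a b :: real and \<gamma> :: "real \<Rightarrow> 'a" +
  assumes path_U: "\<gamma> ` {a..b} \<subseteq> U"
begin

text \<open>The density \<open>rho e\<close> with respect to arc length, as a measure on the
  parameter line, so that lower bounds on disjoint pieces add up.\<close>

definition rho_length :: "real \<Rightarrow> real measure" where
  "rho_length e = density lborel (\<lambda>u. rho e (param u) * indicator {0..total_length} u)"

lemma sets_rho_length [simp]: "sets (rho_length e) = sets borel"
  by (simp add: rho_length_def)

lemma path_measurable:
  assumes "\<phi> \<in> borel_measurable borel"
  shows "(\<lambda>u. \<phi> (param u) * indicator {0..total_length} u :: ennreal) \<in> borel_measurable borel"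
proof -
  have "param \<in> borel_measurable (restrict_space borel {0..total_length})"
    by (rule borel_measurable_continuous_on_restrict[OF continuous_on_param])
  then have "(\<lambda>u. \<phi> (param u)) \<in> borel_measurable (restrict_space borel {0..total_length})"
    using assms by measurable
  then show ?thesis by (subst (asm) borel_measurable_restrict_space_iff_ennreal) auto
qed

lemma emeasure_rho_length:
  "B \<in> sets borel \<Longrightarrow> emeasure (rho_length e) B = (\<integral>\<^sup>+u. rho e (param u) * indicator {0..total_length} u * indicator B u \<partial>lborel)"
  unfolding rho_length_def using path_measurable[OF rho_measurable]
  by (subst emeasure_density) auto

lemma nn_integral_path_measure:
  "(\<integral>\<^sup>+x. rho e x \<partial>path_measure) = emeasure (rho_length e) UNIV"
proof -
  have "(\<integral>\<^sup>+x. rho e x \<partial>path_measure) = (\<integral>\<^sup>+u. rho e (param u) \<partial>restrict_space lborel {0..total_length})"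
    unfolding path_measure_def
    using borel_measurable_continuous_on_restrict[OF continuous_on_param]
      measurable_cong_sets[OF sets_restrict_space_cong[OF sets_lborel] refl]
    by (intro nn_integral_distr) (auto simp: rho_measurable)
  also have "\<dots> = (\<integral>\<^sup>+u. rho e (param u) * indicator {0..total_length} u \<partial>lborel)"
    by (subst nn_integral_restrict_space) auto
  finally show ?thesis by (simp add: emeasure_rho_length)
qed

text \<open>The upper gradient property at scale \<open>e\<close>. Every point of a piece of arc
  length \<open>\<delta>\<close> in [e/2, e) is within \<open>e\<close> of both end points, so its
  oscillation is at least half the increment \<open>D i\<close>; the piece thus contributes at least
  \<open>m * D i / 4\<close>.\<close>

lemma rho_length_segment:
  assumes pq: "a \<le> p" "p \<le> q" "q \<le> b" and e: "0 < e" "e \<le> arclength q - arclength p"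
    and good: "\<gamma> ` {p..q} \<subseteq> good e" and m: "0 \<le> m" "\<And>t. t \<in> {p..q} \<Longrightarrow> ennreal m \<le> low e (\<gamma> t)"
  shows "ennreal (m * dist (f (\<gamma> p)) (f (\<gamma> q)) / 4) \<le> emeasure (rho_length e) {arclength p..<arclength q}"
proof -
  define len where "len = arclength q - arclength p"
  \<comment> \<open>The added 1 makes \<open>\<delta>\<close> strictly smaller than
    \<open>e\<close>, as open balls require, while \<open>e \<le> len\<close> keeps it at least
    \<open>e / 2\<close>.\<close>
  define N where "N = nat \<lfloor>len / e\<rfloor> + 1"
  define \<delta> where "\<delta> = len / real N"
  define u where "u = (\<lambda>i. arclength p + real i * \<delta>)"
  define D where "D = (\<lambda>i. dist (f (param (u i))) (f (param (u (Suc i)))))"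
  have l: "len \<ge> e" "len > 0" using e by (auto simp: len_def)
  have "1 \<le> len / e" using l e by simp
  then have N: "len / e < real N" "real N \<le> 2 * (len / e)" unfolding N_def by linarith+
  have N0: "real N > 0" by (simp add: N_def)
  have \<delta>: "\<delta> < e" "e / 2 \<le> \<delta>" "\<delta> > 0"
    using N N0 e l by (auto simp: \<delta>_def field_simps)
  have uN: "u N = arclength q" "u 0 = arclength p" using N0 by (auto simp: u_def \<delta>_def len_def)
  have u_mono: "u i \<le> u j" if "i \<le> j" for i j using that \<delta> by (auto simp: u_def intro: mult_right_mono)
  have u_in: "u i \<in> {arclength p..arclength q}" if "i \<le> N" for i
    using u_mono[of 0 i] u_mono[of i N] that uN by auto
  have range: "{arclength p..arclength q} \<subseteq> {0..total_length}"
    using curve_length_arclength(2)[of a p] curve_length_arclength(2)[of q b] pq by (auto simp: total_length_def)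
  have piece: "ennreal (m * D i / 4) \<le> emeasure (rho_length e) {u i..<u (Suc i)}" if i: "i < N" for i
  proof -
    have low_rho: "ennreal (1 / e * (D i / 2) * m) \<le> rho e (param v)" if v: "v \<in> {u i..<u (Suc i)}" for v
    proof -
      have vpq: "v \<in> {arclength p..arclength q}" using v u_in[of i] u_in[of "Suc i"] i by auto
      then obtain t where t: "t \<in> {p..q}" "param v = \<gamma> t" using param_in[OF pq, of v] by auto
      have du: "u (Suc i) - u i = \<delta>" by (simp add: u_def algebra_simps)
      have d1: "dist (param v) (param (u j)) < e" if j: "j \<in> {i, Suc i}" for j
      proof -
        have "u j \<in> {0..total_length}" "v \<in> {0..total_length}" using u_in[of j] j i vpq range by auto
        then have "dist (param v) (param (u j)) \<le> \<bar>v - u j\<bar>" by (intro dist_param_le)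
        also have "\<dots> \<le> \<delta>" using v j du by auto
        finally show ?thesis using \<delta> by simp
      qed
      have "D i \<le> dist (f (param v)) (f (param (u i))) + dist (f (param v)) (f (param (u (Suc i))))"
        unfolding D_def by (rule dist_triangle3)
      then have "ennreal (D i / 2) \<le> ennreal (max (dist (f (param v)) (f (param (u i)))) (dist (f (param v)) (f (param (u (Suc i))))))"
        by (intro ennreal_leI) linarith
      also have "\<dots> \<le> osc e (param v)"
        using dist_le_osc[OF d1[of i]] dist_le_osc[OF d1[of "Suc i"]] by (simp add: max_def)
      finally have "ennreal (D i / 2) \<le> osc e (param v)" .
      then have "ennreal (1 / e) * ennreal (D i / 2) * ennreal m \<le> ennreal (1 / e) * osc e (param v) * low e (param v)"
        using m(2)[OF t(1)] t(2) by (intro mult_mono) auto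
      also have "\<dots> = rho e (param v)"
      proof -
        have "\<gamma> t \<in> good e" using good t(1) by blast
        then show ?thesis using t by (simp add: rho_def)
      qed
      finally have "ennreal (1 / e) * ennreal (D i / 2) * ennreal m \<le> rho e (param v)" .
      moreover have "ennreal (1 / e) * ennreal (D i / 2) * ennreal m = ennreal (1 / e * (D i / 2) * m)"
      proof -
        have "ennreal x * ennreal y * ennreal z = ennreal (x * y * z)" if "0 \<le> x" "0 \<le> y" "0 \<le> z" for x y z
          using that by (simp add: ennreal_mult)
        then show ?thesis using e m by (simp add: D_def)
      qed
      ultimately show ?thesis by simp
    qed
    have D0: "D i \<ge> 0" by (simp add: D_def)
    have "m * D i / 4 = (1 / e * (D i / 2) * m) * (e / 2)" using e by (simp add: field_simps)
    also have "\<dots> \<le> (1 / e * (D i / 2) * m) * \<delta>" using \<delta> e m D0 by (intro mult_left_mono) auto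
    finally have "ennreal (m * D i / 4) \<le> ennreal ((1 / e * (D i / 2) * m) * \<delta>)" by (rule ennreal_leI)
    also have "\<dots> = ennreal (1 / e * (D i / 2) * m) * ennreal \<delta>" using e m D0 \<delta> by (intro ennreal_mult) auto
    also have "ennreal \<delta> = emeasure lborel {u i..<u (Suc i)}"
      using u_mono[of i "Suc i"] by (simp add: u_def algebra_simps)
    also have "ennreal (1 / e * (D i / 2) * m) * emeasure lborel {u i..<u (Suc i)} =
       (\<integral>\<^sup>+v. ennreal (1 / e * (D i / 2) * m) * indicator {u i..<u (Suc i)} v \<partial>lborel)"
      by (intro nn_integral_cmult_indicator[symmetric]) simp
    also have "\<dots> \<le> (\<integral>\<^sup>+v. rho e (param v) * indicator {0..total_length} v * indicator {u i..<u (Suc i)} v \<partial>lborel)"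
    proof (intro nn_integral_mono)
      fix v
      show "ennreal (1 / e * (D i / 2) * m) * indicator {u i..<u (Suc i)} v \<le>
        rho e (param v) * indicator {0..total_length} v * indicator {u i..<u (Suc i)} v"
      proof (cases "v \<in> {u i..<u (Suc i)}")
        case True
        then have "v \<in> {0..total_length}" using u_in[of i] u_in[of "Suc i"] i range by force
        then show ?thesis using low_rho[OF True] True by simp
      qed simp
    qed
    also have "\<dots> = emeasure (rho_length e) {u i..<u (Suc i)}" by (simp add: emeasure_rho_length)
    finally show ?thesis .
  qed
  have "dist (f (param (u 0))) (f (param (u n))) \<le> (\<Sum>i<n. D i)" for n
  proof (induction n)
    case (Suc n)
    then show ?case using dist_triangle[of "f (param (u 0))" "f (param (u (Suc n)))" "f (param (u n))"]
      by (simp add: D_def)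
  qed simp
  from this[of N] have "dist (f (\<gamma> p)) (f (\<gamma> q)) \<le> (\<Sum>i<N. D i)"
    unfolding uN using param_arclength pq by simp
  then have "m * dist (f (\<gamma> p)) (f (\<gamma> q)) / 4 \<le> m * (\<Sum>i<N. D i) / 4"
    using m by (intro divide_right_mono mult_left_mono) auto
  then have "ennreal (m * dist (f (\<gamma> p)) (f (\<gamma> q)) / 4) \<le> ennreal (\<Sum>i<N. m * D i / 4)"
    by (intro ennreal_leI) (simp add: sum_distrib_left sum_divide_distrib)
  also have "\<dots> = (\<Sum>i<N. ennreal (m * D i / 4))" using m by (intro sum_ennreal[symmetric]) (simp add: D_def)
  also have "\<dots> \<le> (\<Sum>i<N. emeasure (rho_length e) {u i..<u (Suc i)})" by (intro sum_mono piece) auto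
  also have "\<dots> = emeasure (rho_length e) {u 0..<u N}"
    by (intro sum_emeasure_intervals) (auto intro: mono_onI u_mono)
  finally show ?thesis unfolding uN .
qed

lemma eventually_path_good: "\<forall>\<^sub>F e in at_right 0. \<gamma> ` {a..b} \<subseteq> good e"
  using cont path_U by (intro eventually_good compact_continuous_image) auto

text \<open>Fix a partition witnessing image length above \<open>v\<close>. Once \<open>e\<close> is
  below the arc length of each part whose end points differ on the curve,
  \<open>rho_length_segment\<close> applies to these parts; the others add nothing to the sum.
  Finitely many eventual conditions combine.\<close>

lemma eventually_rho_length_piece:
  assumes pq: "a \<le> p" "p \<le> q" "q \<le> b" and m: "0 \<le> m" and v: "0 \<le> v" "ennreal v < curve_length {p..q} (f \<circ> \<gamma>)"
    and ev: "\<forall>\<^sub>F e in at_right 0. \<forall>t\<in>{p..q}. ennreal m \<le> low e (\<gamma> t)"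
  shows "\<forall>\<^sub>F e in at_right 0. ennreal (m * v / 4) \<le> emeasure (rho_length e) {arclength p..<arclength q}"
proof -
  obtain n t where t: "t ` {..n} \<subseteq> {p..q}" "mono_on {..n} t" and vt: "ennreal v < ennreal (partition_sum (f \<circ> \<gamma>) n t)"
    using less_curve_lengthE[OF v(2)] .
  have t_in: "t i \<in> {p..q}" if "i \<le> n" for i using t(1) that by blast
  have t_le: "t i \<le> t j" if "i \<le> j" "j \<le> n" for i j using t(2) that by (auto simp: mono_on_def)
  define D where "D = (\<lambda>i. dist (f (\<gamma> (t i))) (f (\<gamma> (t (Suc i)))))"
  have vD: "v \<le> (\<Sum>i<n. D i)"
    using vt v(1) unfolding partition_sum_def D_def by (simp add: ennreal_less_iff)
  have "\<forall>\<^sub>F e in at_right 0. ennreal (m * D i / 4) \<le> emeasure (rho_length e) {arclength (t i)..<arclength (t (Suc i))}"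
    if i: "i < n" for i
  proof (cases "\<gamma> (t i) = \<gamma> (t (Suc i))")
    case True then show ?thesis by (simp add: D_def)
  next
    case False
    have ti: "t i \<in> {p..q}" "t (Suc i) \<in> {p..q}" "t i \<le> t (Suc i)" using t_in t_le i by auto
    define len where "len = arclength (t (Suc i)) - arclength (t i)"
    have "dist (\<gamma> (t i)) (\<gamma> (t (Suc i))) \<le> len"
      using dist_le_arclength[of "t i" "t (Suc i)"] curve_length_arclength(2)[of "t i" "t (Suc i)"] ti pq
      by (simp add: len_def)
    then have "len > 0" using False by (smt (verit) zero_less_dist_iff)
    then have "\<forall>\<^sub>F e in at_right 0. 0 < e \<and> e \<le> len"
      unfolding eventually_at_right_field by (intro exI[of _ len]) auto
    then show ?thesis using ev eventually_path_good
    proof eventually_elim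
      case (elim e)
      have "\<gamma> ` {t i..t (Suc i)} \<subseteq> \<gamma> ` {a..b}" using ti pq by (intro image_mono) auto
      then have "\<gamma> ` {t i..t (Suc i)} \<subseteq> good e" using elim(3) by (rule order_trans)
      then show ?case unfolding D_def
        using elim(1,2) ti pq m by (intro rho_length_segment) (simp_all add: len_def)
    qed
  qed
  then have "\<forall>\<^sub>F e in at_right 0. \<forall>i\<in>{..<n}. ennreal (m * D i / 4) \<le> emeasure (rho_length e) {arclength (t i)..<arclength (t (Suc i))}"
    by (intro eventually_ball_finite) auto
  then show ?thesis
  proof eventually_elim
    case (elim e)
    have "m * v / 4 \<le> (\<Sum>i<n. m * D i / 4)"
      using mult_left_mono[OF vD m] by (simp add: sum_distrib_left sum_divide_distrib[symmetric])
    then have "ennreal (m * v / 4) \<le> ennreal (\<Sum>i<n. m * D i / 4)" by (rule ennreal_leI)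
    also have "\<dots> = (\<Sum>i<n. ennreal (m * D i / 4))" using m by (intro sum_ennreal[symmetric]) (simp add: D_def)
    also have "\<dots> \<le> (\<Sum>i<n. emeasure (rho_length e) {arclength (t i)..<arclength (t (Suc i))})"
      using elim by (intro sum_mono) auto
    also have "\<dots> = emeasure (rho_length e) {arclength (t 0)..<arclength (t n)}"
    proof (intro sum_emeasure_intervals[where u = "\<lambda>i. arclength (t i)"] mono_onI)
      fix i j assume "i \<in> {..n}" "j \<in> {..n}" "i \<le> j"
      then show "arclength (t i) \<le> arclength (t j)"
        using t_in[of i] t_in[of j] t_le[of i j] pq by (intro curve_length_arclength(2)) auto
    qed simp
    also have "\<dots> \<le> emeasure (rho_length e) {arclength p..<arclength q}"
      using curve_length_arclength(2)[of p "t 0"] curve_length_arclength(2)[of "t n" q] t_in[of 0] t_in[of n] pq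
      by (intro emeasure_mono) auto
    finally show ?case .
  qed
qed

end

context transfer_path
begin

text \<open>Positivity, lower semicontinuity and compactness bound \<open>h \<circ> f\<close> below
  by some \<open>m > 0\<close> near the curve. As the image has infinite length,
  \<open>eventually_rho_length_piece\<close> applies with length \<open>1 / m\<close>.\<close>

lemma eventually_rho_length_of_nonrectifiable:
  assumes h: "\<And>x. x \<in> U \<Longrightarrow> 0 < h (f x)" and inf: "curve_length {a..b} (f \<circ> \<gamma>) = \<infinity>"
  shows "\<forall>\<^sub>F e in at_right 0. ennreal (1 / 8) \<le> emeasure (rho_length e) UNIV"
proof -
  define S where "S = \<gamma> ` {a..b}"
  have S: "compact S" "S \<noteq> {}" unfolding S_def using cont ab by (auto intro: compact_continuous_image)
  define W where "W = (\<lambda>n. f -` {y. ennreal (1 / real (Suc n)) < h y})"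
  have W_open: "open (W n)" for n unfolding W_def by (rule open_vimage[OF lsc_h cont_f])
  have W_mono: "W i \<subseteq> W j" if "i \<le> j" for i j
  proof -
    have "ennreal (1 / real (Suc j)) \<le> ennreal (1 / real (Suc i))"
      using that by (intro ennreal_leI divide_left_mono) auto
    then show ?thesis unfolding W_def by (blast intro: le_less_trans)
  qed
  have "S \<subseteq> (\<Union>n. W n)"
  proof
    fix x assume "x \<in> S"
    then have "0 < h (f x)" using path_U h by (auto simp: S_def)
    then obtain z where z: "0 < z" "z < h (f x)" using dense by blast
    then obtain r where r: "z = ennreal r" "r > 0" by (cases z) auto
    obtain n where "inverse (real (Suc n)) < r" using reals_Archimedean r by blast
    then have "ennreal (1 / real (Suc n)) \<le> z" unfolding r by (intro ennreal_leI) (simp add: inverse_eq_divide)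
    then have "x \<in> W n" using z unfolding W_def by auto
    then show "x \<in> (\<Union>n. W n)" by blast
  qed
  then obtain I where I: "finite I" "S \<subseteq> (\<Union>n\<in>I. W n)"
    using compactE_image[OF S(1), of UNIV W] W_open by metis
  have "S \<subseteq> W (Max I)"
  proof
    fix x assume "x \<in> S"
    then obtain n where "n \<in> I" "x \<in> W n" using I by blast
    then show "x \<in> W (Max I)" using W_mono[of n "Max I"] I(1) by auto
  qed
  then obtain d where d: "d > 0" "(\<Union>x\<in>S. ball x d) \<subseteq> W (Max I)"
    using compact_subset_open_imp_ball_epsilon_subset[OF S(1) W_open] by metis
  define m where "m = 1 / real (Suc (Max I))"
  have m: "m > 0" "m \<le> 1" by (auto simp: m_def)
  have "ennreal m \<le> low e (\<gamma> t)" if e: "0 < e" "e < min d 1" and t: "t \<in> {a..b}" for e t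
    unfolding low_def
  proof (intro min.boundedI INF_greatest)
    have "1 \<le> 1 / e" using e by simp
    then show "ennreal m \<le> ennreal (1 / e)" using m by (intro ennreal_leI) linarith
    fix y assume "y \<in> ball (\<gamma> t) e"
    then have "y \<in> (\<Union>x\<in>S. ball x d)" using e t by (force simp: S_def)
    then have "y \<in> W (Max I)" using d by blast
    then show "ennreal m \<le> h (f y)" by (auto simp: W_def m_def)
  qed
  then have "\<forall>\<^sub>F e in at_right 0. \<forall>t\<in>{a..b}. ennreal m \<le> low e (\<gamma> t)"
    unfolding eventually_at_right_field using d by (intro exI[of _ "min d 1"]) auto
  then have "\<forall>\<^sub>F e in at_right 0. ennreal (m * (1 / m) / 4) \<le> emeasure (rho_length e) {arclength a..<arclength b}"
    using ab m inf by (intro eventually_rho_length_piece) auto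
  then show ?thesis
  proof eventually_elim
    case (elim e)
    have "ennreal (1 / 8) \<le> ennreal (m * (1 / m) / 4)" using m by (intro ennreal_leI) simp
    also have "\<dots> \<le> emeasure (rho_length e) {arclength a..<arclength b}" by (rule elim)
    also have "\<dots> \<le> emeasure (rho_length e) UNIV" by (intro emeasure_mono) auto
    finally show ?case .
  qed
qed

text \<open>Run the curve by the arc length of its image. Monotone convergence along
  \<open>SUP_low\<close> gives a scale \<open>e1\<close> at which the integral of \<open>low\<close>
  still exceeds 1/2. A step function above \<open>low e1\<close> is, by \<open>low_shift\<close>,
  below \<open>low\<close> at scales up to \<open>e1 / 2\<close>, and each step is an instance of
  \<open>eventually_rho_length_piece\<close>.\<close>

lemma eventually_rho_length_of_rectifiable:
  assumes rect_f: "curve_length {a..b} (f \<circ> \<gamma>) < \<infinity>"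
    and big: "ennreal (1 / 2) < (\<integral>\<^sup>+u\<in>{0..enn2real (curve_length {a..b} (f \<circ> \<gamma>))}. h (arclength_param a b (f \<circ> \<gamma>) u) \<partial>lborel)"
  shows "\<forall>\<^sub>F e in at_right 0. ennreal (1 / 8) \<le> emeasure (rho_length e) UNIV"
proof -
  interpret Y: rectifiable_path a b "f \<circ> \<gamma>"
  proof
    show "continuous_on {a..b} (f \<circ> \<gamma>)"
      by (intro continuous_on_compose cont continuous_on_subset[OF cont_f]) auto
  qed (use ab rect_f in auto)
  define L where "L = Y.total_length"
  define \<psi> where "\<psi> = g \<circ> Y.param"
  have \<psi>_f: "f (\<psi> u) = Y.param u" for u by (simp add: \<psi>_def)
  have \<psi>_\<gamma>: "\<psi> (Y.arclength t) = \<gamma> t" if "t \<in> {a..b}" for t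
    using Y.param_arclength[OF that] by (simp add: \<psi>_def)
  have cont_\<psi>: "continuous_on {0..L} \<psi>"
    unfolding \<psi>_def L_def by (intro continuous_on_compose Y.continuous_on_param continuous_on_subset[OF cont_g]) auto
  have meas: "(\<lambda>u. low e (\<psi> u) * indicator {0..L} u) \<in> borel_measurable borel" for e
  proof -
    have "(\<lambda>u. low e (\<psi> u)) \<in> borel_measurable (restrict_space borel {0..L})"
      using borel_measurable_continuous_on_restrict[OF cont_\<psi>] low_measurable by measurable
    then show ?thesis by (subst (asm) borel_measurable_restrict_space_iff_ennreal) auto
  qed
  have "(\<integral>\<^sup>+u. h (Y.param u) * indicator {0..L} u \<partial>lborel) =
     (\<integral>\<^sup>+u. (SUP n. low (1 / real (Suc n)) (\<psi> u) * indicator {0..L} u) \<partial>lborel)"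
    by (intro nn_integral_cong) (simp add: SUP_mult_right_ennreal[symmetric] SUP_low \<psi>_f del: of_nat_Suc)
  also have "\<dots> = (SUP n. \<integral>\<^sup>+u. low (1 / real (Suc n)) (\<psi> u) * indicator {0..L} u \<partial>lborel)"
  proof (rule nn_integral_monotone_convergence_SUP)
    show "incseq (\<lambda>n u. low (1 / real (Suc n)) (\<psi> u) * indicator {0..L} u)"
    proof (intro incseq_SucI le_funI mult_right_mono low_mono)
      show "1 / real (Suc (Suc n)) \<le> 1 / real (Suc n)" for n by (intro divide_left_mono) auto
    qed auto
  qed (use meas in simp)
  finally have "ennreal (1 / 2) < (SUP n. \<integral>\<^sup>+u. low (1 / real (Suc n)) (\<psi> u) * indicator {0..L} u \<partial>lborel)"
    using big by (simp add: Y.param_def L_def Y.total_length_def Y.arclength_def)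
  then obtain n where n: "ennreal (1 / 2) < (\<integral>\<^sup>+u. low (1 / real (Suc n)) (\<psi> u) * indicator {0..L} u \<partial>lborel)"
    unfolding less_SUP_iff by blast
  define e1 where "e1 = 1 / real (Suc n)"
  have e1: "e1 > 0" by (simp add: e1_def)
  note n = n[folded e1_def]
  have L: "L > 0"
  proof (rule ccontr)
    assume "\<not> L > 0"
    then have L0: "{0..L} \<subseteq> {0}" by auto
    have "(\<integral>\<^sup>+u. low e1 (\<psi> u) * indicator {0..L} u \<partial>lborel) = 0"
    proof -
      have "AE u in lborel. u \<noteq> (0::real)" by (rule AE_lborel_singleton)
      then have "AE u in lborel. low e1 (\<psi> u) * indicator {0..L} u = 0"
        by eventually_elim (use L0 in \<open>auto simp: indicator_def\<close>)
      then show ?thesis by (subst nn_integral_0_iff_AE) (use meas in auto)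
    qed
    then show False using n by simp
  qed
  have "uniformly_continuous_on {0..L} \<psi>" by (intro compact_uniformly_continuous cont_\<psi>) simp
  \<comment> \<open>Along a step shorter than \<open>d\<close> the point \<open>\<psi> u\<close>
    moves by less than \<open>e1 / 2\<close>, as \<open>low_shift\<close> requires.\<close>
  then obtain d where d: "d > 0" "\<And>u v. u \<in> {0..L} \<Longrightarrow> v \<in> {0..L} \<Longrightarrow> dist u v < d \<Longrightarrow> dist (\<psi> u) (\<psi> v) < e1 / 2"
    unfolding uniformly_continuous_on_def using e1 by (meson half_gt_zero)
  obtain k0 where k0: "L / d < real k0" using reals_Archimedean2 by blast
  define k where "k = Suc k0"
  have k: "k > 0" "L / real k < d" using k0 d L by (auto simp: k_def field_simps)
  define \<delta> where "\<delta> = L / real k"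
  have \<delta>: "\<delta> > 0" "\<delta> < d" "real k * \<delta> = L" using k L by (auto simp: \<delta>_def)
  define u where "u = (\<lambda>i. real i * \<delta>)"
  have u_in: "u i \<in> {0..L}" if "i \<le> k" for i
    using that \<delta> mult_right_mono[of "real i" "real k" \<delta>] by (auto simp: u_def)
  have u_Suc: "u (Suc i) = u i + \<delta>" for i by (simp add: u_def algebra_simps)
  have "\<exists>t. t \<in> {a..b} \<and> Y.arclength t = u i" if "i \<le> k" for i
    using Y.arclength_ivt[of a b "u i"] u_in[OF that] ab by (auto simp: L_def Y.total_length_def)
  then obtain T where T: "\<And>i. i \<le> k \<Longrightarrow> T i \<in> {a..b}" "\<And>i. i \<le> k \<Longrightarrow> Y.arclength (T i) = u i" by metis
  have T_Suc: "T i \<le> T (Suc i)" if "i < k" for i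
  proof (rule ccontr)
    assume "\<not> T i \<le> T (Suc i)"
    then have "Y.arclength (T (Suc i)) \<le> Y.arclength (T i)"
      using T(1)[of i] T(1)[of "Suc i"] that by (intro Y.curve_length_arclength(2)) auto
    then show False using T(2)[of i] T(2)[of "Suc i"] that u_Suc[of i] \<delta> by simp
  qed
  \<comment> \<open>A supremum, so that the steps dominate the integrand; \<open>m_low\<close> shows
    that they are nevertheless lower bounds at smaller scales.\<close>
  define m where "m = (\<lambda>i. enn2real (SUP v\<in>{u i..u (Suc i)}. low e1 (\<psi> v)))"
  have m_eq: "ennreal (m i) = (SUP v\<in>{u i..u (Suc i)}. low e1 (\<psi> v))" for i
  proof -
    have "(SUP v\<in>{u i..u (Suc i)}. low e1 (\<psi> v)) \<le> ennreal (1 / e1)"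
      by (intro SUP_least) (simp add: low_def)
    then have "(SUP v\<in>{u i..u (Suc i)}. low e1 (\<psi> v)) < \<infinity>" by (rule le_less_trans) simp
    then show ?thesis by (simp add: m_def)
  qed
  have m_nn: "m i \<ge> 0" for i by (simp add: m_def)
  have m_low: "ennreal (m i) \<le> low e (\<gamma> t)" if i: "i < k" and t: "t \<in> {T i..T (Suc i)}" and e: "0 < e" "e \<le> e1 / 2" for i t e
    unfolding m_eq
  proof (rule SUP_least)
    fix v assume v: "v \<in> {u i..u (Suc i)}"
    have Ti: "T i \<in> {a..b}" "T (Suc i) \<in> {a..b}" using T(1) i by auto
    then have tab: "t \<in> {a..b}" using t by auto
    have "u i \<le> Y.arclength t" "Y.arclength t \<le> u (Suc i)"
      using Y.curve_length_arclength(2)[of "T i" t] Y.curve_length_arclength(2)[of t "T (Suc i)"] T(2)[of i] T(2)[of "Suc i"] i t Ti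
      by auto
    moreover have "u i \<in> {0..L}" "u (Suc i) \<in> {0..L}" using u_in i by auto
    ultimately have "dist (\<psi> v) (\<psi> (Y.arclength t)) < e1 / 2"
      using v u_Suc[of i] \<delta> by (intro d) (auto simp: dist_real_def)
    then show "low e1 (\<psi> v) \<le> low e (\<gamma> t)" unfolding \<psi>_\<gamma>[OF tab] using e by (intro low_shift)
  qed
  have "(\<integral>\<^sup>+v. low e1 (\<psi> v) * indicator {0..L} v \<partial>lborel) \<le> (\<integral>\<^sup>+v. (\<Sum>i<k. ennreal (m i) * indicator {u i..u (Suc i)} v) \<partial>lborel)"
  proof (intro nn_integral_mono)
    fix v
    show "low e1 (\<psi> v) * indicator {0..L} v \<le> (\<Sum>i<k. ennreal (m i) * indicator {u i..u (Suc i)} v)"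
    proof (cases "v \<in> {0..L}")
      case True
      have "\<exists>i<k. v \<in> {u i..u (Suc i)}"
      \<comment> \<open>At the right end point the floor would give the index \<open>k\<close>, one
        too large.\<close>
      proof (cases "v = L")
        case True
        have "u (Suc (k - 1)) = L" using k \<delta> by (simp add: u_def)
        then have "v \<in> {u (k - 1)..u (Suc (k - 1))}" using True u_Suc[of "k - 1"] \<delta> by auto
        then show ?thesis using k by (intro exI[of _ "k - 1"]) auto
      next
        case False
        define i where "i = nat \<lfloor>v / \<delta>\<rfloor>"
        have "0 \<le> v / \<delta>" using True \<delta> by simp
        then have i: "real i \<le> v / \<delta>" "v / \<delta> < real i + 1" unfolding i_def by linarith+
        have "real i * \<delta> \<le> v" "v < (real i + 1) * \<delta>" using i \<delta> by (simp_all add: field_simps)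
        moreover have "real i * \<delta> < real k * \<delta>" using calculation True False \<delta> by simp
        then have "real i < real k" by (simp only: mult_less_cancel_right_pos[OF \<delta>(1)])
        then have "i < k" by simp
        ultimately show ?thesis by (intro exI[of _ i]) (simp add: u_def add.commute)
      qed
      then obtain i where i: "i < k" "v \<in> {u i..u (Suc i)}" by blast
      have "low e1 (\<psi> v) \<le> ennreal (m i)" unfolding m_eq using i by (intro SUP_upper)
      also have "\<dots> = ennreal (m i) * indicator {u i..u (Suc i)} v" using i by simp
      also have "\<dots> \<le> (\<Sum>i<k. ennreal (m i) * indicator {u i..u (Suc i)} v)"
        using i by (intro member_le_sum) auto
      finally show ?thesis using True by simp
    qed simp
  qed
  also have "\<dots> = (\<Sum>i<k. ennreal (m i) * emeasure lborel {u i..u (Suc i)})"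
    by (subst nn_integral_sum) (auto simp: nn_integral_cmult_indicator)
  also have "\<dots> = (\<Sum>i<k. ennreal (m i * \<delta>))"
    using \<delta> m_nn by (intro sum.cong) (auto simp: u_Suc ennreal_mult)
  also have "\<dots> = ennreal (\<Sum>i<k. m i * \<delta>)" using m_nn \<delta> by (intro sum_ennreal) auto
  finally have "ennreal (1 / 2) < ennreal (\<Sum>i<k. m i * \<delta>)" by (rule less_le_trans[OF n])
  then have "1 / 2 < (\<Sum>i<k. m i * \<delta>)" by (subst (asm) ennreal_less_iff) auto
  then have m_sum: "1 / 2 < (\<Sum>i<k. m i) * \<delta>" by (simp add: sum_distrib_right)
  define A where "A = (\<Sum>i<k. m i)"
  have A: "A > 0" using m_sum \<delta> m_nn by (metis A_def less_eq_real_def mult_zero_left not_less sum_nonneg zero_less_divide_1_iff zero_less_numeral)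
  \<comment> \<open>Strictly below the image length \<open>\<delta>\<close> of a step, and such that
    the sum of \<open>m i * v / 4\<close> is exactly 1/8.\<close>
  define v where "v = 1 / (2 * A)"
  have v: "v \<ge> 0" "v < \<delta>" using A m_sum unfolding A_def[symmetric] v_def by (auto simp: field_simps)
  have "\<forall>\<^sub>F e in at_right 0. ennreal (m i * v / 4) \<le> emeasure (rho_length e) {arclength (T i)..<arclength (T (Suc i))}"
    if i: "i < k" for i
  proof (rule eventually_rho_length_piece)
    show "a \<le> T i" "T i \<le> T (Suc i)" "T (Suc i) \<le> b" using T(1)[of i] T(1)[of "Suc i"] T_Suc i by auto
    then have "curve_length {T i..T (Suc i)} (f \<circ> \<gamma>) = ennreal \<delta>"
      using Y.curve_length_arclength(1)[of "T i" "T (Suc i)"] T(2)[of i] T(2)[of "Suc i"] i u_Suc[of i] by simp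
    then show "ennreal v < curve_length {T i..T (Suc i)} (f \<circ> \<gamma>)" using v \<delta> by (simp add: ennreal_less_iff)
    have "\<forall>\<^sub>F e in at_right 0. 0 < e \<and> e \<le> e1 / 2"
      unfolding eventually_at_right_field using e1 by (intro exI[of _ "e1 / 2"]) auto
    then show "\<forall>\<^sub>F e in at_right 0. \<forall>t\<in>{T i..T (Suc i)}. ennreal (m i) \<le> low e (\<gamma> t)"
      by eventually_elim (use m_low[OF i] in blast)
  qed (use m_nn v in auto)
  then have "\<forall>\<^sub>F e in at_right 0. \<forall>i\<in>{..<k}. ennreal (m i * v / 4) \<le> emeasure (rho_length e) {arclength (T i)..<arclength (T (Suc i))}"
    by (intro eventually_ball_finite) auto
  then show ?thesis
  proof eventually_elim
    case (elim e)
    have "(\<Sum>i<k. m i * v / 4) = A * v / 4" by (simp add: A_def sum_distrib_right sum_divide_distrib)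
    also have "\<dots> = 1 / 8" using A by (simp add: v_def)
    finally have "ennreal (1 / 8) = ennreal (\<Sum>i<k. m i * v / 4)" by simp
    also have "\<dots> = (\<Sum>i<k. ennreal (m i * v / 4))" using m_nn v by (intro sum_ennreal[symmetric]) auto
    also have "\<dots> \<le> (\<Sum>i<k. emeasure (rho_length e) {arclength (T i)..<arclength (T (Suc i))})"
      using elim by (intro sum_mono) auto
    also have "\<dots> = emeasure (rho_length e) {arclength (T 0)..<arclength (T k)}"
    proof (intro sum_emeasure_intervals[where u = "\<lambda>i. arclength (T i)"] mono_onI)
      fix i j assume ij: "i \<in> {..k}" "j \<in> {..k}" "i \<le> j"
      have "T i \<le> T j" using ij(3,2)
      proof (induction rule: dec_induct)
        case (step j) then show ?case using T_Suc[of j] by auto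
      qed simp
      then show "arclength (T i) \<le> arclength (T j)"
        using T(1)[of i] T(1)[of j] ij by (intro curve_length_arclength(2)) auto
    qed simp
    also have "\<dots> \<le> emeasure (rho_length e) UNIV" by (intro emeasure_mono) auto
    finally show ?case .
  qed
qed

end

section \<open>Quasi-invariance of the modulus\<close>

lemma ennpowr_ennpowr_inverse: "p > 0 \<Longrightarrow> ennpowr (ennpowr x p) (1 / p) = x"
  by (cases x) (auto simp: ennpowr_def powr_powr)

lemma ennpowr_le_iff:
  assumes "p > 0"
  shows "ennpowr x p \<le> ennpowr y p \<longleftrightarrow> x \<le> y"
  using ennpowr_mono[of x y p] ennpowr_mono[of "ennpowr x p" "ennpowr y p" "1 / p"] assms
  by (auto simp: ennpowr_ennpowr_inverse)

lemma (in rectifiable_path) path_measure_le_line_integral: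
  assumes \<rho>: "\<rho> \<in> borel_measurable borel" and I: "{a..b} \<subseteq> I"
  shows "(\<integral>\<^sup>+x. \<rho> x \<partial>path_measure) \<le> line_integral (I, \<gamma>) \<rho>"
proof -
  have "(\<integral>\<^sup>+x. \<rho> x \<partial>path_measure) = (\<integral>\<^sup>+u. \<rho> (param u) \<partial>restrict_space lborel {0..total_length})"
    unfolding path_measure_def
    using borel_measurable_continuous_on_restrict[OF continuous_on_param]
      measurable_cong_sets[OF sets_restrict_space_cong[OF sets_lborel] refl]
    by (intro nn_integral_distr) (auto simp: \<rho>)
  also have "\<dots> = (\<integral>\<^sup>+u\<in>{0..enn2real (curve_length {a..b} \<gamma>)}. \<rho> (arclength_param a b \<gamma> u) \<partial>lborel)"
    by (subst nn_integral_restrict_space) (auto simp: param_def total_length_def arclength_def)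
  also have "\<dots> \<le> line_integral (I, \<gamma>) \<rho>"
    unfolding line_integral_def using ab I by (auto intro!: SUP_upper2[of "(a, b)"])
  finally show ?thesis .
qed

context moebius_transfer
begin

text \<open>The constant 8 compensates for the lower bound \<open>1/8\<close> on the integrals of \<open>rho e\<close>.\<close>

lemma modulus_le_of_majorant:
  assumes h_pos: "\<And>y. y \<in> f ` U \<Longrightarrow> 0 < h y" and h_ge: "\<And>y. y \<in> f ` U \<Longrightarrow> \<phi> y \<le> h y"
    and adm: "admissible (connecting_curves (f ` E) (f ` F)) \<phi>"
    and E: "connected E" "E \<inter> U \<noteq> {}"
    and B: "(\<integral>\<^sup>+w. indicator (f ` U) w * ennpowr (h w) Q \<partial>\<nu>) \<le> ennreal B" "B > 0"
  shows "modulus Q \<mu> (connecting_curves E F) \<le> ennreal (2 powr Q * 2 * 8 powr Q * (C1 * C2 * (4 * K) powr Q) * B)"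
proof -
  have EU: "E \<subseteq> U" by (rule connected_subset_ball_closed[OF E open_U e0(1) ball_U])
  \<comment> \<open>Only those paths are collected for which the lower bound 1/8 holds eventually;
    the proof then finds a subcurve of this kind in every connecting curve.\<close>
  define MM where "MM = {rectifiable_path.path_measure a b \<gamma> | a b \<gamma>. rectifiable_path a b \<gamma> \<and>
     (\<forall>\<^sub>F e in at_right 0. ennreal (1 / 8) \<le> (\<integral>\<^sup>+x. rho e x \<partial>rectifiable_path.path_measure a b \<gamma>))}"
  define \<epsilon> where "\<epsilon> = (\<lambda>n::nat. e0 / real (n + 2))"
  have \<epsilon>: "0 < \<epsilon> n" "\<epsilon> n \<le> e0" for n
    using e0(1) by (auto simp: \<epsilon>_def divide_le_eq mult_le_cancel_left1)
  have \<epsilon>_lim: "filterlim \<epsilon> (at_right 0) sequentially"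
  proof (rule tendsto_imp_filterlim_at_right)
    have "(\<lambda>n. e0 * inverse (real (Suc (Suc n)))) \<longlonglongrightarrow> e0 * 0"
      by (intro tendsto_mult tendsto_const LIMSEQ_Suc[OF LIMSEQ_inverse_real_of_nat])
    then show "\<epsilon> \<longlonglongrightarrow> 0" by (simp add: \<epsilon>_def divide_inverse numeral_2_eq_2)
    show "\<forall>\<^sub>F n in sequentially. 0 < \<epsilon> n" using \<epsilon> by simp
  qed
  define c where "c = C1 * C2 * (4 * K) powr Q"
  have c: "c > 0" using C1 C2 K by (auto simp: c_def)
  define r where "r = (\<lambda>n x. 8 * enn2real (rho (\<epsilon> n) x))"
  have er: "ennreal (r n x) = 8 * rho (\<epsilon> n) x" for n x
    using rho_finite[OF \<epsilon>(1), of n x] by (simp add: r_def ennreal_mult)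
  have "\<exists>\<rho>. \<rho> \<in> borel_measurable borel \<and>
    (\<integral>\<^sup>+x. ennpowr (\<rho> x) Q \<partial>\<mu>) \<le> ennreal (2 powr Q * (2 * (8 powr Q * c * B))) \<and>
    (\<forall>m\<in>MM. 1 \<le> (\<integral>\<^sup>+x. \<rho> x \<partial>m))"
  proof (rule admissible_limit[OF Q sets_mu, of "8 powr Q * c * B" r MM])
    show "8 powr Q * c * B > 0" using c B by simp
    show "r n \<in> borel_measurable borel" for n unfolding r_def by measurable
    show "0 \<le> r n x" for n x by (simp add: r_def)
    show "(\<integral>\<^sup>+x. ennreal (r n x powr Q) \<partial>\<mu>) \<le> ennreal (8 powr Q * c * B)" for n
    proof -
      have "(\<integral>\<^sup>+x. ennreal (r n x powr Q) \<partial>\<mu>) = (\<integral>\<^sup>+x. ennreal (8 powr Q) * ennreal (enn2real (rho (\<epsilon> n) x) powr Q) \<partial>\<mu>)"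
        by (intro nn_integral_cong) (simp add: r_def powr_mult ennreal_mult)
      also have "\<dots> = ennreal (8 powr Q) * (\<integral>\<^sup>+x. ennreal (enn2real (rho (\<epsilon> n) x) powr Q) \<partial>\<mu>)"
      proof (rule nn_integral_cmult)
        have "(\<lambda>x. ennreal (enn2real (rho (\<epsilon> n) x) powr Q)) \<in> borel_measurable borel" by measurable
        then show "(\<lambda>x. ennreal (enn2real (rho (\<epsilon> n) x) powr Q)) \<in> borel_measurable \<mu>"
          by (simp add: sets_mu cong: measurable_cong_sets)
      qed
      also have "\<dots> \<le> ennreal (8 powr Q) * (ennreal c * ennreal B)"
        unfolding c_def by (intro mult_left_mono order_trans[OF rho_energy[OF \<epsilon>]] B) auto
      also have "\<dots> = ennreal (8 powr Q * c * B)" using c B by (simp add: ennreal_mult mult.assoc)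
      finally show ?thesis .
    qed
    fix m assume m: "m \<in> MM"
    then obtain a b \<gamma> where abg: "m = rectifiable_path.path_measure a b \<gamma>" "rectifiable_path a b \<gamma>"
      "\<forall>\<^sub>F e in at_right 0. ennreal (1 / 8) \<le> (\<integral>\<^sup>+x. rho e x \<partial>m)" unfolding MM_def by auto
    show mb: "sets m = sets borel"
      unfolding abg(1) rectifiable_path.path_measure_def[OF abg(2)] by simp
    have "\<forall>\<^sub>F n in sequentially. ennreal (1 / 8) \<le> (\<integral>\<^sup>+x. rho (\<epsilon> n) x \<partial>m)"
      using \<epsilon>_lim abg(3) by (rule eventually_compose_filterlim[rotated])
    then show "\<forall>\<^sub>F n in sequentially. 1 \<le> (\<integral>\<^sup>+x. ennreal (r n x) \<partial>m)"
    proof eventually_elim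
      case (elim n)
      have "rho (\<epsilon> n) \<in> borel_measurable m" using rho_measurable by (simp add: mb cong: measurable_cong_sets)
      then have "(\<integral>\<^sup>+x. ennreal (r n x) \<partial>m) = 8 * (\<integral>\<^sup>+x. rho (\<epsilon> n) x \<partial>m)"
        unfolding er by (rule nn_integral_cmult)
      also have "\<dots> \<ge> 8 * ennreal (1 / 8)" using elim by (intro mult_left_mono) auto
      also have "8 * ennreal (1 / 8) = ennreal 8 * ennreal (1 / 8)" by simp
      also have "\<dots> = ennreal (8 * (1 / 8))" by (rule ennreal_mult[symmetric]) auto
      finally show ?case by simp
    qed
  qed blast
  then obtain \<rho> where \<rho>: "\<rho> \<in> borel_measurable borel"
    "(\<integral>\<^sup>+x. ennpowr (\<rho> x) Q \<partial>\<mu>) \<le> ennreal (2 powr Q * (2 * (8 powr Q * c * B)))"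
    "\<And>m. m \<in> MM \<Longrightarrow> 1 \<le> (\<integral>\<^sup>+x. \<rho> x \<partial>m)"
    by blast
  have "admissible (connecting_curves E F) \<rho>"
    unfolding admissible_def
  proof (intro conjI ballI impI \<rho>(1))
    fix c assume "c \<in> connecting_curves E F"
    then obtain a b \<gamma> where c: "c = ({a..b}, \<gamma>)" and curve: "is_curve ({a..b}, \<gamma>)" "rectifiable ({a..b}, \<gamma>)"
      and ends: "\<gamma> a \<in> E \<and> \<gamma> b \<in> F \<or> \<gamma> a \<in> F \<and> \<gamma> b \<in> E"
      unfolding connecting_curves_def by auto
    have ab: "a \<le> b" and cont: "continuous_on {a..b} \<gamma>" and rect: "curve_length {a..b} \<gamma> < \<infinity>"
      using curve by (auto simp: is_curve_def rectifiable_def)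
    have "\<gamma> ` {a..b} \<inter> U \<noteq> {}" using ends EU ab by force
    then have gU: "\<gamma> ` {a..b} \<subseteq> U"
      using connected_continuous_image[OF cont] by (intro connected_subset_ball_closed[OF _ _ open_U e0(1) ball_U]) auto
    have cont_f\<gamma>: "continuous_on {a..b} (f \<circ> \<gamma>)"
      by (intro continuous_on_compose cont continuous_on_subset[OF cont_f]) auto
    have sub: "transfer_path Q \<mu> \<nu> f g K C1 C2 e0 U C p1 p2 h a' b' \<gamma>" if "a' \<le> b'" "{a'..b'} \<subseteq> {a..b}" for a' b'
    proof (intro transfer_path.intro transfer_path_axioms.intro rectifiable_path.intro moebius_transfer_axioms)
      show "continuous_on {a'..b'} \<gamma>" using cont that(2) by (rule continuous_on_subset)
      show "curve_length {a'..b'} \<gamma> < \<infinity>" using curve_length_mono[OF that(2)] rect by (rule le_less_trans)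
      show "\<gamma> ` {a'..b'} \<subseteq> U" using gU that(2) by blast
    qed (rule that(1))
    have "\<exists>a' b'. a' \<le> b' \<and> {a'..b'} \<subseteq> {a..b} \<and> rectifiable_path.path_measure a' b' \<gamma> \<in> MM"
    proof (cases "curve_length {a..b} (f \<circ> \<gamma>) = \<infinity>")
      case True
      interpret P: transfer_path Q \<mu> \<nu> f g K C1 C2 e0 U C p1 p2 h a b \<gamma> using sub ab by simp
      have "\<forall>\<^sub>F e in at_right 0. ennreal (1 / 8) \<le> (\<integral>\<^sup>+x. rho e x \<partial>P.path_measure)"
        unfolding P.nn_integral_path_measure using h_pos True
        by (intro P.eventually_rho_length_of_nonrectifiable) auto
      then have "P.path_measure \<in> MM" unfolding MM_def using P.rectifiable_path_axioms by blast
      then show ?thesis using ab by blast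
    next
      case False
      then have fin: "curve_length {a..b} (f \<circ> \<gamma>) < \<infinity>" by (simp add: less_top)
      have "({a..b}, f \<circ> \<gamma>) \<in> connecting_curves (f ` E) (f ` F)"
        unfolding connecting_curves_def using ends fin cont_f\<gamma> ab
        by (auto simp: is_curve_def rectifiable_def is_interval_cc intro!: exI[of _ a] exI[of _ b] exI[of _ "f \<circ> \<gamma>"])
      moreover have "locally_rectifiable ({a..b}, f \<circ> \<gamma>)"
        unfolding locally_rectifiable_def prod.case using fin by (blast intro: le_less_trans curve_length_mono)
      ultimately have "1 \<le> line_integral ({a..b}, f \<circ> \<gamma>) \<phi>" using adm unfolding admissible_def by blast
      \<comment> \<open>The line integral is a supremum over compact subcurves, so a strict bound is
        needed to extract one of them; 1/2 leaves that room.\<close>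
      moreover have "ennreal (1 / 2) < ennreal 1" by (rule ennreal_lessI) auto
      then have "ennreal (1 / 2) < 1" by (simp only: ennreal_1)
      ultimately have "ennreal (1 / 2) < line_integral ({a..b}, f \<circ> \<gamma>) \<phi>" by (rule less_le_trans[rotated])
      then obtain a' b' where ab': "a' \<le> b'" "{a'..b'} \<subseteq> {a..b}"
        and big: "ennreal (1 / 2) < (\<integral>\<^sup>+u\<in>{0..enn2real (curve_length {a'..b'} (f \<circ> \<gamma>))}. \<phi> (arclength_param a' b' (f \<circ> \<gamma>) u) \<partial>lborel)"
        unfolding line_integral_def by (auto simp: less_SUP_iff)
      interpret P: transfer_path Q \<mu> \<nu> f g K C1 C2 e0 U C p1 p2 h a' b' \<gamma> using sub ab' by simp
      have fin': "curve_length {a'..b'} (f \<circ> \<gamma>) < \<infinity>" using curve_length_mono[OF ab'(2)] fin by (rule le_less_trans)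
      interpret Y: rectifiable_path a' b' "f \<circ> \<gamma>"
        using ab'(1) continuous_on_subset[OF cont_f\<gamma> ab'(2)] fin' by (rule rectifiable_path.intro)
      have "(\<integral>\<^sup>+u\<in>{0..enn2real (curve_length {a'..b'} (f \<circ> \<gamma>))}. \<phi> (arclength_param a' b' (f \<circ> \<gamma>) u) \<partial>lborel)
         \<le> (\<integral>\<^sup>+u\<in>{0..enn2real (curve_length {a'..b'} (f \<circ> \<gamma>))}. h (arclength_param a' b' (f \<circ> \<gamma>) u) \<partial>lborel)"
      proof (intro nn_integral_mono)
        fix u
        show "\<phi> (arclength_param a' b' (f \<circ> \<gamma>) u) * indicator {0..enn2real (curve_length {a'..b'} (f \<circ> \<gamma>))} u
           \<le> h (arclength_param a' b' (f \<circ> \<gamma>) u) * indicator {0..enn2real (curve_length {a'..b'} (f \<circ> \<gamma>))} u"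
        proof (cases "u \<in> {0..enn2real (curve_length {a'..b'} (f \<circ> \<gamma>))}")
          case True
          then have "Y.param u \<in> (f \<circ> \<gamma>) ` {a'..b'}"
            using ab' by (intro Y.param_in) (auto simp: Y.arclength_def[of b'])
          then have "Y.param u \<in> f ` U" using P.path_U by auto
          then show ?thesis using h_ge unfolding Y.param_def by (intro mult_right_mono) auto
        qed simp
      qed
      then have "ennreal (1 / 2) < (\<integral>\<^sup>+u\<in>{0..enn2real (curve_length {a'..b'} (f \<circ> \<gamma>))}. h (arclength_param a' b' (f \<circ> \<gamma>) u) \<partial>lborel)"
        by (rule less_le_trans[OF big])
      then have "\<forall>\<^sub>F e in at_right 0. ennreal (1 / 8) \<le> (\<integral>\<^sup>+x. rho e x \<partial>P.path_measure)"
        unfolding P.nn_integral_path_measure by (intro P.eventually_rho_length_of_rectifiable fin')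
      then have "P.path_measure \<in> MM" unfolding MM_def using P.rectifiable_path_axioms by blast
      then show ?thesis using ab' by blast
    qed
    then obtain a' b' where ab': "a' \<le> b'" "{a'..b'} \<subseteq> {a..b}" "rectifiable_path.path_measure a' b' \<gamma> \<in> MM" by blast
    interpret P: transfer_path Q \<mu> \<nu> f g K C1 C2 e0 U C p1 p2 h a' b' \<gamma> using sub ab' by simp
    have "1 \<le> (\<integral>\<^sup>+x. \<rho> x \<partial>P.path_measure)" using \<rho>(3) ab'(3) .
    also have "\<dots> \<le> line_integral ({a..b}, \<gamma>) \<rho>" by (rule P.path_measure_le_line_integral[OF \<rho>(1) ab'(2)])
    finally show "1 \<le> line_integral c \<rho>" unfolding c .
  qed
  then have "modulus Q \<mu> (connecting_curves E F) \<le> (\<integral>\<^sup>+x. ennpowr (\<rho> x) Q \<partial>\<mu>)"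
    unfolding modulus_def by (intro INF_lower) simp
  also note \<rho>(2)
  finally show ?thesis by (simp add: c_def mult_ac)
qed

end

section \<open>Distortion of relative distances\<close>

text \<open>A continuous injection of an interval is strictly monotone. It cannot decrease because
  the value \<open>\<theta> 0 + 1\<close> is attained, and then 0 can be attained only at 0.\<close>

lemma homeomorphism_nonneg_reals:
  fixes \<theta> \<theta>' :: "real \<Rightarrow> real"
  assumes "homeomorphism {0..} {0..} \<theta> \<theta>'"
  shows "strict_mono_on {0..} \<theta>" and "\<theta> 0 = 0"
proof -
  have cont: "continuous_on {0..} \<theta>" and im: "\<theta> ` {0..} = {0..}" and inv: "\<And>x. x \<ge> 0 \<Longrightarrow> \<theta>' (\<theta> x) = x"
    using assms by (auto simp: homeomorphism_def)
  have "inj_on \<theta> {0..}" using inv by (intro inj_on_inverseI[of _ \<theta>']) auto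
  then have mono: "strict_mono_on {0..} \<theta> \<or> strict_antimono_on {0..} \<theta>"
    using injective_eq_monotone_map[OF _ cont] by (simp add: is_interval_ci)
  have nn: "\<theta> x \<ge> 0" if "x \<ge> 0" for x using im that by auto
  have "\<not> strict_antimono_on {0..} \<theta>"
  proof
    assume anti: "strict_antimono_on {0..} \<theta>"
    have "\<theta> 0 + 1 \<in> \<theta> ` {0..}" using im nn[of 0] by auto
    then obtain x where x: "x \<ge> 0" "\<theta> x = \<theta> 0 + 1" by auto
    then have "x \<noteq> 0" by auto
    then have "\<theta> x < \<theta> 0" using monotone_onD[OF anti, of 0 x] x by simp
    then show False using x by simp
  qed
  then show smono: "strict_mono_on {0..} \<theta>" using mono by blast
  have "0 \<in> \<theta> ` {0..}" using im by simp
  then obtain x where x: "x \<ge> 0" "\<theta> x = 0" by auto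
  show "\<theta> 0 = 0"
  proof (cases "x = 0")
    case False
    then have "\<theta> 0 < \<theta> x" using monotone_onD[OF smono, of 0 x] x by simp
    then show ?thesis using x nn[of 0] by simp
  qed (use x in simp)
qed

lemma compact_setdist_attained:
  fixes S T :: "'a::metric_space set"
  assumes "compact S" "compact T" "S \<noteq> {}" "T \<noteq> {}"
  obtains x y where "x \<in> S" "y \<in> T" "dist x y = setdist S T"
proof -
  have "\<exists>p\<in>S \<times> T. \<forall>q\<in>S \<times> T. dist (fst p) (snd p) \<le> dist (fst q) (snd q)"
    using assms by (intro continuous_attains_inf compact_Times continuous_intros) auto
  then obtain x y where xy: "x \<in> S" "y \<in> T" "\<And>x' y'. x' \<in> S \<Longrightarrow> y' \<in> T \<Longrightarrow> dist x y \<le> dist x' y'"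
    by fastforce
  moreover have "dist x y = setdist S T"
    using xy assms by (intro antisym le_setdistI setdist_le_dist) auto
  ultimately show ?thesis using that by blast
qed

lemma nondegenerate_continuumD:
  assumes "nondegenerate_continuum E"
  shows "compact E" "connected E" "E \<noteq> {}" "0 < diameter E"
    and "\<And>x y. x \<in> E \<Longrightarrow> y \<in> E \<Longrightarrow> dist x y \<le> diameter E"
    and "\<And>x. x \<in> E \<Longrightarrow> \<exists>u\<in>E. diameter E / 2 \<le> dist x u"
proof -
  show comp: "compact E" and "connected E" and ne: "E \<noteq> {}" using assms by (auto simp: nondegenerate_continuum_def)
  show le: "dist x y \<le> diameter E" if "x \<in> E" "y \<in> E" for x y
    using that comp by (intro diameter_bounded_bound compact_imp_bounded)
  obtain x y where "x \<in> E" "y \<in> E" "x \<noteq> y" using assms by (auto simp: nondegenerate_continuum_def)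
  then show "0 < diameter E" using le[of x y] by (smt (verit) zero_less_dist_iff)
  obtain p q where pq: "p \<in> E" "q \<in> E" "dist p q = diameter E" using diameter_compact_attained[OF comp ne] by blast
  fix x assume "x \<in> E"
  have "diameter E \<le> dist x p + dist x q" using dist_triangle3[of p q x] pq by simp
  then have "diameter E / 2 \<le> dist x p \<or> diameter E / 2 \<le> dist x q" by linarith
  then show "\<exists>u\<in>E. diameter E / 2 \<le> dist x u" using pq by blast
qed

lemma relative_distance_pos:
  assumes "nondegenerate_continuum E" "nondegenerate_continuum F" "E \<inter> F = {}"
  shows "0 < relative_distance E F"
proof -
  note E = nondegenerate_continuumD[OF assms(1)] and F = nondegenerate_continuumD[OF assms(2)]
  obtain x y where "x \<in> E" "y \<in> F" "dist x y = setdist E F"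
    using compact_setdist_attained[OF E(1) F(1) E(3) F(3)] .
  then have "setdist E F > 0" using assms(3) by (metis disjoint_iff zero_less_dist_iff)
  then show ?thesis unfolding relative_distance_def using E(4) F(4) by simp
qed

lemma nondegenerate_continuum_image:
  assumes "nondegenerate_continuum E" "continuous_on UNIV f" "inj f"
  shows "nondegenerate_continuum (f ` E)"
proof -
  have "continuous_on E f" using assms(2) by (rule continuous_on_subset) simp
  moreover obtain x y where "x \<in> E" "y \<in> E" "x \<noteq> y" using assms(1) by (auto simp: nondegenerate_continuum_def)
  moreover have "f x \<noteq> f y" using \<open>x \<noteq> y\<close> assms(3) by (simp add: inj_eq)
  ultimately show ?thesis
    using assms(1) unfolding nondegenerate_continuum_def by (auto intro: compact_continuous_image connected_continuous_image)
qed

text \<open>Choose \<open>x\<close>, \<open>y\<close> realizing the distance of the images, and \<open>u\<close>, \<open>v\<close> far from them within the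
  two sets: the cross ratio is then at most \<open>3 / \<Delta>\<close> in the source, while in the target its
  inverse is at most \<open>4 t + 4 t\<^sup>2\<close>.\<close>

lemma relative_distance_distortion:
  fixes f :: "'a::metric_space \<Rightarrow> 'b::metric_space"
  assumes f: "continuous_on UNIV f" "inj f"
    and moebius: "\<And>a b c e t. \<lbrakk>t \<ge> 0; a \<noteq> b; c \<noteq> e; cross_ratio a b c e \<le> t\<rbrakk> \<Longrightarrow> cross_ratio (f a) (f b) (f c) (f e) \<le> \<theta> t"
    and E: "nondegenerate_continuum E" and F: "nondegenerate_continuum F" and disj: "E \<inter> F = {}"
    and big: "1 \<le> relative_distance E F"
  defines "t \<equiv> relative_distance (f ` E) (f ` F)"
  shows "1 \<le> (4 * t + 4 * t\<^sup>2) * \<theta> (3 / relative_distance E F)"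
proof -
  have fE: "nondegenerate_continuum (f ` E)" and fF: "nondegenerate_continuum (f ` F)"
    by (intro nondegenerate_continuum_image E F f)+
  note E' = nondegenerate_continuumD[OF E] and F' = nondegenerate_continuumD[OF F]
  note fE' = nondegenerate_continuumD[OF fE] and fF' = nondegenerate_continuumD[OF fF]
  have "f ` E \<inter> f ` F = {}" using disj f(2) by (auto simp: inj_eq)
  then have t: "t > 0" unfolding t_def by (intro relative_distance_pos fE fF)
  obtain x y where xy: "x \<in> E" "y \<in> F" "dist (f x) (f y) = setdist (f ` E) (f ` F)"
    using compact_setdist_attained[OF fE'(1) fF'(1) fE'(3) fF'(3)] by (metis imageE)
  obtain u where u: "u \<in> E" "diameter (f ` E) / 2 \<le> dist (f x) (f u)" using fE'(6)[of "f x"] xy by auto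
  obtain v where v: "v \<in> F" "diameter (f ` F) / 2 \<le> dist (f y) (f v)" using fF'(6)[of "f y"] xy by auto
  define s where "s = setdist E F"
  define D where "D = relative_distance E F"
  have D: "D \<ge> 1" using big by (simp add: D_def)
  define \<alpha> where "\<alpha> = dist x y"
  define \<beta> where "\<beta> = dist u v"
  have s: "s \<le> \<alpha>" "s \<le> \<beta>" using xy u v by (auto simp: s_def \<alpha>_def \<beta>_def intro: setdist_le_dist)
  have smin: "s = D * min (diameter E) (diameter F)"
    using E'(4) F'(4) by (simp add: D_def relative_distance_def s_def)
  have s0: "s > 0" unfolding smin using D E'(4) F'(4) by simp
  \<comment> \<open>\<open>w\<close> is a distance within the continuum of smaller diameter and
    \<open>z\<close> one within the other. As \<open>D \<ge> 1\<close>, also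
    \<open>w \<le> s\<close>, and \<open>s\<close> is at most both \<open>\<alpha>\<close> and
    \<open>\<beta>\<close>; hence the three terms and the 3.\<close>
  have ineq: "w * z \<le> 3 / D * (\<alpha> * \<beta>)"
    if w: "0 \<le> w" "D * w \<le> s" and z: "0 \<le> z" "z \<le> \<alpha> + w + \<beta>" for w z
  proof -
    have "w \<le> D * w" using D w(1) by (simp add: mult_le_cancel_right1)
    then have z': "z \<le> \<alpha> + s + \<beta>" using w(2) z(2) by linarith
    have "D * w * z \<le> s * (\<alpha> + s + \<beta>)" using w z z' s0 D by (intro mult_mono) auto
    also have "\<dots> = \<alpha> * s + s * s + s * \<beta>" by (simp add: algebra_simps)
    also have "\<dots> \<le> \<alpha> * \<beta> + \<alpha> * \<beta> + \<alpha> * \<beta>" using s s0 by (intro add_mono mult_mono) auto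
    finally show ?thesis using D by (simp add: field_simps)
  qed
  have "dist x u * dist y v \<le> 3 / D * (\<alpha> * \<beta>)"
  proof (cases "diameter E \<le> diameter F")
    case True
    then have "D * dist x u \<le> s" unfolding smin using E'(5)[OF xy(1) u(1)] D by (intro mult_left_mono) auto
    moreover have "dist y v \<le> \<alpha> + dist x u + \<beta>"
      unfolding \<alpha>_def \<beta>_def by (smt (verit) dist_commute dist_triangle)
    ultimately show ?thesis by (intro ineq) auto
  next
    case False
    then have "D * dist y v \<le> s" unfolding smin using F'(5)[OF xy(2) v(1)] D by (intro mult_left_mono) auto
    moreover have "dist x u \<le> \<alpha> + dist y v + \<beta>"
      unfolding \<alpha>_def \<beta>_def by (smt (verit) dist_commute dist_triangle)
    ultimately have "dist y v * dist x u \<le> 3 / D * (\<alpha> * \<beta>)" by (intro ineq) auto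
    then show ?thesis by (simp add: mult.commute)
  qed
  moreover have neq: "x \<noteq> y" "u \<noteq> v" using xy u v disj by auto
  ultimately have "cross_ratio x y u v \<le> 3 / D"
    unfolding cross_ratio_def \<alpha>_def \<beta>_def by (simp add: pos_divide_le_eq)
  then have cr: "cross_ratio (f x) (f y) (f u) (f v) \<le> \<theta> (3 / D)" using D neq by (intro moebius) auto
  define \<tau> where "\<tau> = \<theta> (3 / D)"
  define p where "p = dist (f x) (f u)"
  define q where "q = dist (f y) (f v)"
  define d where "d = dist (f x) (f y)"
  have d: "d > 0" using neq f(2) by (simp add: d_def inj_eq)
  have uv: "dist (f u) (f v) > 0" using neq f(2) by (simp add: inj_eq)
  have pq: "p > 0" "q > 0" using u v fE'(4) fF'(4) by (auto simp: p_def q_def)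
  have "0 \<le> cross_ratio (f x) (f y) (f u) (f v)" by (simp add: cross_ratio_def)
  then have \<tau>: "\<tau> \<ge> 0" using cr by (simp add: \<tau>_def)
  have "p * q \<le> \<tau> * (d * dist (f u) (f v))"
    using cr d uv unfolding cross_ratio_def \<tau>_def p_def q_def d_def by (simp add: pos_divide_le_eq)
  also have "\<dots> \<le> \<tau> * (d * (p + d + q))"
  proof (intro mult_left_mono)
    show "dist (f u) (f v) \<le> p + d + q"
      unfolding p_def q_def d_def by (smt (verit) dist_commute dist_triangle)
  qed (use d \<tau> in auto)
  also have "\<dots> \<le> \<tau> * ((4 * t + 4 * t\<^sup>2) * (p * q))"
  proof (rule mult_left_mono[OF _ \<tau>])
    \<comment> \<open>By definition of \<open>t\<close>, \<open>d = t * m\<close>, and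
      \<open>m\<close> is at most \<open>2 * p\<close> and \<open>2 * q\<close> by choice of
      \<open>u\<close> and \<open>v\<close>. The three products in \<open>d * (p + d + q)\<close>
      then yield 2t + 2t + 4t^2.\<close>
    define m where "m = min (diameter (f ` E)) (diameter (f ` F))"
    have "d = t * m" using xy(3) fE'(4) fF'(4) by (simp add: d_def t_def m_def relative_distance_def)
    moreover have "m \<le> 2 * p" "m \<le> 2 * q" using u v by (auto simp: m_def p_def q_def)
    ultimately have dp: "d \<le> 2 * t * p" and dq: "d \<le> 2 * t * q"
      using t mult_left_mono[of m "2 * p" t] mult_left_mono[of m "2 * q" t] by auto
    have "d * p \<le> (2 * t * q) * p" "d * q \<le> (2 * t * p) * q" "d * d \<le> (2 * t * p) * (2 * t * q)"
      using dp dq pq d t by (intro mult_right_mono mult_mono; simp)+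
    then show "d * (p + d + q) \<le> (4 * t + 4 * t\<^sup>2) * (p * q)"
      by (simp add: algebra_simps power2_eq_square)
  qed
  also have "\<dots> = ((4 * t + 4 * t\<^sup>2) * \<tau>) * (p * q)" by (simp add: algebra_simps)
  finally have "1 * (p * q) \<le> ((4 * t + 4 * t\<^sup>2) * \<tau>) * (p * q)" by simp
  moreover have "p * q > 0" using pq by simp
  ultimately have "1 \<le> (4 * t + 4 * t\<^sup>2) * \<tau>" by (simp only: mult_le_cancel_right_pos)
  then show ?thesis by (simp add: \<tau>_def D_def)
qed

section \<open>The Loewner condition\<close>

lemma Ahlfors_regularE:
  fixes \<mu> :: "'a::metric_space measure"
  assumes "Ahlfors_regular Q \<mu>"
  obtains C where "C \<ge> 1"
    "\<And>x R. \<lbrakk>0 < R; ennreal R < ediameter (UNIV :: 'a set)\<rbrakk> \<Longrightarrow> ennreal (inverse C * R powr Q) \<le> emeasure \<mu> (ball x R)"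
    "\<And>x R. \<lbrakk>0 < R; ennreal R < ediameter (UNIV :: 'a set)\<rbrakk> \<Longrightarrow> emeasure \<mu> (ball x R) \<le> ennreal (C * R powr Q)"
  using assms unfolding Ahlfors_regular_def by blast

lemma image_dense_cover:
  assumes f: "continuous_on UNIV f" and t: "t > 0"
    and C: "\<And>x e. x \<in> U \<Longrightarrow> e > 0 \<Longrightarrow> \<exists>c\<in>C. dist c x < e"
  shows "f ` U \<subseteq> (\<Union>y\<in>f ` C. ball y t)"
proof
  fix y assume "y \<in> f ` U"
  then obtain x where x: "x \<in> U" "y = f x" by blast
  obtain d where d: "d > 0" "\<And>z. dist z x < d \<Longrightarrow> dist (f z) (f x) < t"
    using f t unfolding continuous_on_iff by (metis UNIV_I)
  obtain c where "c \<in> C" "dist c x < d" using C x d by blast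
  then show "y \<in> (\<Union>y\<in>f ` C. ball y t)" using d x by auto
qed

text \<open>The constant depends only on \<open>Q\<close>, \<open>K\<close> and the regularity
  constants: the continuum \<open>E\<close> enters solely through the piece \<open>U\<close>, the
  anchors and the starting scale.\<close>

lemma modulus_transfer:
  fixes Q K :: real and \<mu> :: "'a::metric_space measure" and \<nu> :: "'b::metric_space measure"
    and f :: "'a \<Rightarrow> 'b" and g :: "'b \<Rightarrow> 'a"
  assumes Q: "Q > 1" and sets_mu: "sets \<mu> = sets borel" and sets_nu: "sets \<nu> = sets borel"
    and ar: "Ahlfors_regular Q \<mu>" "Ahlfors_regular Q \<nu>"
    and cont: "continuous_on UNIV f" "continuous_on UNIV g"
    and gf: "\<And>x. g (f x) = x" and fg: "\<And>y. f (g y) = y"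
    and moebius: "\<And>a b c e. \<lbrakk>a \<noteq> b; c \<noteq> e; cross_ratio a b c e \<le> 3\<rbrakk> \<Longrightarrow> cross_ratio (f a) (f b) (f c) (f e) \<le> K"
    and K: "K \<ge> 1"
  obtains c where "c > 0"
    "\<And>E F. nondegenerate_continuum E \<Longrightarrow>
       ennreal c * modulus Q \<mu> (connecting_curves E F) \<le> modulus Q \<nu> (connecting_curves (f ` E) (f ` F))"
proof -
  obtain C1 where C1: "C1 \<ge> 1" and upper1: "\<And>x R. \<lbrakk>0 < R; ennreal R < ediameter (UNIV :: 'a set)\<rbrakk> \<Longrightarrow> emeasure \<mu> (ball x R) \<le> ennreal (C1 * R powr Q)"
    using Ahlfors_regularE[OF ar(1)] by metis
  obtain C2 where C2: "C2 \<ge> 1" and lower2: "\<And>x R. \<lbrakk>0 < R; ennreal R < ediameter (UNIV :: 'b set)\<rbrakk> \<Longrightarrow> ennreal (inverse C2 * R powr Q) \<le> emeasure \<nu> (ball x R)"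
    and upper2: "\<And>x R. \<lbrakk>0 < R; ennreal R < ediameter (UNIV :: 'b set)\<rbrakk> \<Longrightarrow> emeasure \<nu> (ball x R) \<le> ennreal (C2 * R powr Q)"
    using Ahlfors_regularE[OF ar(2)] by metis
  define A where "A = 2 powr Q * 2 * 8 powr Q * (C1 * C2 * (4 * K) powr Q)"
  have A: "A > 0" using C1 C2 K by (auto simp: A_def)
  have main: "modulus Q \<mu> (connecting_curves E F) \<le> ennreal A * (\<integral>\<^sup>+y. ennpowr (\<phi> y) Q \<partial>\<nu>)"
    if E: "nondegenerate_continuum E" and adm: "admissible (connecting_curves (f ` E) (f ` F)) \<phi>" for E F \<phi>
  proof (rule ennreal_le_epsilon)
    fix \<eta> :: real
    assume fin: "ennreal A * (\<integral>\<^sup>+y. ennpowr (\<phi> y) Q \<partial>\<nu>) < top" and \<eta>: "0 < \<eta>"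
    define G where "G = (\<lambda>y. ennpowr (\<phi> y) Q)"
    have "(\<integral>\<^sup>+y. G y \<partial>\<nu>) < \<infinity>" using fin A by (auto simp: G_def ennreal_mult_less_top)
    then obtain B0 where B0: "B0 \<ge> 0" "(\<integral>\<^sup>+y. G y \<partial>\<nu>) = ennreal B0" by (cases "\<integral>\<^sup>+y. G y \<partial>\<nu>") auto
    obtain p1 p2 where p: "p1 \<in> E" "p2 \<in> E" "p1 \<noteq> p2" using E by (auto simp: nondegenerate_continuum_def)
    \<comment> \<open>A quarter, so that \<open>3 * s\<close> remains below the diameter, as
      \<open>Ahlfors_separable_piece\<close> demands.\<close>
    define s where "s = dist p1 p2 / 4"
    have s: "s > 0" using p by (simp add: s_def)
    have s3: "ennreal (3 * s) < ediameter (UNIV :: 'a set)" and s1: "ennreal s < ediameter (UNIV :: 'a set)"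
      using p s by (auto intro!: less_ediameter[of _ p1 p2] simp: s_def)
    define t where "t = dist (f p1) (f p2) / 2"
    have fp: "f p1 \<noteq> f p2" using p(3) gf by metis
    then have t: "t > 0" by (simp add: t_def)
    have t1: "ennreal t < ediameter (UNIV :: 'b set)"
      using fp by (intro less_ediameter[of _ "f p1" "f p2"]) (auto simp: t_def)
    obtain C U where CU: "countable C" "C \<subseteq> U" "p1 \<in> U" "open U" "\<And>x. x \<in> U \<Longrightarrow> ball x s \<subseteq> U"
      "\<And>x e. x \<in> U \<Longrightarrow> e > 0 \<Longrightarrow> \<exists>c\<in>C. dist c x < e"
      using Ahlfors_separable_piece[OF ar(1) sets_mu s s3] by metis
    have "f ` U = g -` U"
    proof (intro equalityI subsetI)
      fix y assume "y \<in> g -` U"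
      then show "y \<in> f ` U" using fg[of y] by (intro image_eqI[of y f "g y"]) auto
    qed (auto simp: gf)
    then have open_V: "open (f ` U)" using open_vimage[OF CU(4) cont(2)] by simp
    have sf_mu: "sigma_finite_measure (density \<mu> (indicator U))"
    proof (rule sigma_finite_density_indicator[OF sets_mu _ CU(1)])
      show "U \<in> sets borel" using CU(4) by (rule borel_open)
      show "U \<subseteq> (\<Union>c\<in>C. ball c s)" using CU(6)[OF _ s] by auto
      show "emeasure \<mu> (ball c s) < \<infinity>" for c using upper1[OF s s1, of c] by (rule le_less_trans) simp
    qed
    have fin_V: "emeasure \<nu> (ball y t) < \<infinity>" for y using upper2[OF t t1, of y] by (rule le_less_trans) simp
    have cover_V: "f ` U \<subseteq> (\<Union>y\<in>f ` C. ball y t)" by (rule image_dense_cover[OF cont(1) t CU(6)])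
    have sf_nu: "sigma_finite_measure (density \<nu> (indicator (f ` U)))"
      by (rule sigma_finite_density_indicator[OF sets_nu borel_open[OF open_V] countable_image[OF CU(1)] cover_V fin_V])

    define W where "W = (\<lambda>i. ball (from_nat_into (f ` C) i) t)"
    have V_W: "f ` U \<subseteq> (\<Union>i. W i)"
    proof
      fix y assume "y \<in> f ` U"
      then obtain z where z: "z \<in> f ` C" "y \<in> ball z t" using cover_V by blast
      obtain i where "from_nat_into (f ` C) i = z"
        using from_nat_into_surj[OF countable_image[OF CU(1)] z(1)] by blast
      then show "y \<in> (\<Union>i. W i)" using z(2) by (auto simp: W_def)
    qed
    have \<phi>_meas: "\<phi> \<in> borel_measurable borel" using adm by (simp add: admissible_def)
    then have G_meas: "G \<in> borel_measurable borel" unfolding G_def by measurable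
    \<comment> \<open>After multiplication by \<open>A\<close> this excess becomes
      \<open>\<eta>\<close>; it also keeps the energy bound positive when
      \<open>B0 = 0\<close>.\<close>
    have "\<exists>H. (\<forall>a. open {x. a < H x}) \<and> (\<forall>x\<in>f ` U. G x \<le> H x) \<and> (\<forall>x\<in>f ` U. 0 < H x) \<and>
        (\<integral>\<^sup>+x. H x \<partial>\<nu>) \<le> (\<integral>\<^sup>+x. G x \<partial>\<nu>) + ennreal (\<eta> / A)"
    proof (rule lower_semicontinuous_majorant[OF sets_nu _ _ G_meas borel_open[OF open_V] V_W])
      show "open (W i)" "emeasure \<nu> (W i) < \<infinity>" for i using fin_V by (auto simp: W_def)
      show "\<eta> / A > 0" using \<eta> A by simp
    qed blast
    then obtain H where H: "\<And>a. open {x. a < H x}" "\<And>x. x \<in> f ` U \<Longrightarrow> G x \<le> H x" "\<And>x. x \<in> f ` U \<Longrightarrow> 0 < H x"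
      "(\<integral>\<^sup>+x. H x \<partial>\<nu>) \<le> (\<integral>\<^sup>+x. G x \<partial>\<nu>) + ennreal (\<eta> / A)" by blast
    \<comment> \<open>The majorant was taken for the Q-th power, whose plain integral is the energy;
      the root turns it back into a density.\<close>
    define h where "h = (\<lambda>y. ennpowr (H y) (1 / Q))"
    have hQ: "ennpowr (h y) Q = H y" for y
      using ennpowr_ennpowr_inverse[of "1 / Q" "H y"] Q by (simp add: h_def)
    interpret T: moebius_transfer Q \<mu> \<nu> f g K C1 C2 s U C p1 p2 h
    proof (rule moebius_transfer.intro)
      fix a
      have "{y. a < h y} = {y. ennpowr a Q < H y}"
        using ennpowr_le_iff[of Q] Q hQ by (metis (no_types, opaque_lifting) less_trans not_less zero_less_one)
      then show "open {y. a < h y}" using H(1) by simp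
    qed (fact Q sets_mu sets_nu cont gf fg moebius K upper1 C1 lower2 C2 CU s s1 sf_mu sf_nu p(3))+
    have "modulus Q \<mu> (connecting_curves E F) \<le> ennreal (A * (B0 + \<eta> / A))"
      unfolding A_def
    proof (rule T.modulus_le_of_majorant[OF _ _ adm])
      fix y assume y: "y \<in> f ` U"
      have "h y \<noteq> 0"
        using H(3)[OF y] hQ[of y] by (auto simp: ennpowr_def)
      then show "0 < h y" by (simp add: zero_less_iff_neq_zero)
      have "ennpowr (\<phi> y) Q \<le> ennpowr (h y) Q" using H(2)[OF y] by (simp add: hQ G_def)
      then show "\<phi> y \<le> h y" using ennpowr_le_iff[of Q] Q by simp
    next
      show "connected E" using E by (simp add: nondegenerate_continuum_def)
      show "E \<inter> U \<noteq> {}" using p(1) CU(3) by blast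
      have "(\<integral>\<^sup>+w. indicator (f ` U) w * ennpowr (h w) Q \<partial>\<nu>) \<le> (\<integral>\<^sup>+w. H w \<partial>\<nu>)"
        by (intro nn_integral_mono) (auto simp: hQ indicator_def)
      also have "\<dots> \<le> ennreal B0 + ennreal (\<eta> / A)" using H(4) B0(2) by simp
      also have "\<dots> = ennreal (B0 + \<eta> / A)" using B0 \<eta> A by (intro ennreal_plus[symmetric]) auto
      finally show "(\<integral>\<^sup>+w. indicator (f ` U) w * ennpowr (h w) Q \<partial>\<nu>) \<le> ennreal (B0 + \<eta> / (2 powr Q * 2 * 8 powr Q * (C1 * C2 * (4 * K) powr Q)))"
        by (simp add: A_def)
      show "0 < B0 + \<eta> / (2 powr Q * 2 * 8 powr Q * (C1 * C2 * (4 * K) powr Q))"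
        using B0 \<eta> A unfolding A_def by (intro add_nonneg_pos divide_pos_pos)
    qed
    also have "A * (B0 + \<eta> / A) = A * B0 + \<eta>" using A by (simp add: field_simps)
    also have "ennreal (A * B0 + \<eta>) = ennreal A * ennreal B0 + ennreal \<eta>"
      using A B0 \<eta> by (simp add: ennreal_mult)
    finally show "modulus Q \<mu> (connecting_curves E F) \<le> ennreal A * (\<integral>\<^sup>+y. ennpowr (\<phi> y) Q \<partial>\<nu>) + ennreal \<eta>"
      using B0(2) by (simp add: G_def)
  qed
  show ?thesis
  proof (rule that)
    show "1 / A > 0" using A by simp
    fix E F :: "'a set" assume E: "nondegenerate_continuum E"
    show "ennreal (1 / A) * modulus Q \<mu> (connecting_curves E F) \<le> modulus Q \<nu> (connecting_curves (f ` E) (f ` F))"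
      unfolding modulus_def[of Q \<nu>]
    proof (rule INF_greatest)
      fix \<phi> assume "\<phi> \<in> {\<phi>. admissible (connecting_curves (f ` E) (f ` F)) \<phi>}"
      then have "ennreal (1 / A) * modulus Q \<mu> (connecting_curves E F) \<le> ennreal (1 / A) * (ennreal A * (\<integral>\<^sup>+y. ennpowr (\<phi> y) Q \<partial>\<nu>))"
        by (intro mult_left_mono main[OF E]) auto
      also have "\<dots> = (\<integral>\<^sup>+y. ennpowr (\<phi> y) Q \<partial>\<nu>)"
        using A by (simp add: mult.assoc[symmetric] ennreal_mult[symmetric])
      finally show "ennreal (1 / A) * modulus Q \<mu> (connecting_curves E F) \<le> (\<integral>\<^sup>+y. ennpowr (\<phi> y) Q \<partial>\<nu>)" .
    qed
  qed
qed

theorem theorem1p2: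
  fixes Q :: real
    and \<mu> :: "'a::metric_space measure"
    and \<nu> :: "'b::metric_space measure"
    and f :: "'a \<Rightarrow> 'b"
  assumes "Q > 1"
    and "sets \<mu> = sets borel" and "sets \<nu> = sets borel"
    and "locally_compact_space (euclidean :: 'a topology)"
    and "locally_compact_space (euclidean :: 'b topology)"
    and "Ahlfors_regular Q \<mu>" and "Ahlfors_regular Q \<nu>"
    and "quasimoebius f"
    and "Loewner Q \<mu>"
  shows "Loewner Q \<nu>"
proof -
  obtain g \<theta> \<theta>' where g: "homeomorphism UNIV UNIV f g" and \<theta>: "homeomorphism {0..} {0..} \<theta> \<theta>'"
    and moebius0: "\<forall>a b c e. \<forall>t\<ge>0. a \<noteq> b \<longrightarrow> c \<noteq> e \<longrightarrow> cross_ratio a b c e \<le> t \<longrightarrow>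
           cross_ratio (f a) (f b) (f c) (f e) \<le> \<theta> t"
    using assms(8) unfolding quasimoebius_def by blast
  have cont: "continuous_on UNIV f" "continuous_on UNIV g" and gf: "\<And>x. g (f x) = x" and fg: "\<And>y. f (g y) = y"
    using g by (auto simp: homeomorphism_def)
  have inj: "inj f" "inj g" using gf fg by (metis injI)+
  have moebius: "cross_ratio (f a) (f b) (f c) (f e) \<le> \<theta> t"
    if "t \<ge> 0" "a \<noteq> b" "c \<noteq> e" "cross_ratio a b c e \<le> t" for a b c e t
    using moebius0 that by blast
  \<comment> \<open>The maximum with 1 meets the requirement \<open>K \<ge> 1\<close>.\<close>
  have moebius3: "cross_ratio (f a) (f b) (f c) (f e) \<le> max 1 (\<theta> 3)"
    if "a \<noteq> b" "c \<noteq> e" "cross_ratio a b c e \<le> 3" for a b c e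
    using moebius[of 3 a b c e] that by simp
  obtain c where c: "c > 0" and modulus_le: "\<And>E F. nondegenerate_continuum E \<Longrightarrow>
       ennreal c * modulus Q \<mu> (connecting_curves E F) \<le> modulus Q \<nu> (connecting_curves (f ` E) (f ` F))"
    using modulus_transfer[OF assms(1,2,3,6,7) cont gf fg moebius3] by (metis max.cobounded1)
  obtain \<eta> where \<eta>: "\<And>t. t > 0 \<Longrightarrow> \<eta> t > 0" "antimono_on {0<..} \<eta>"
    and loewner: "\<And>E F. nondegenerate_continuum E \<Longrightarrow> nondegenerate_continuum F \<Longrightarrow> E \<inter> F = {} \<Longrightarrow>
           ennreal (\<eta> (relative_distance E F)) \<le> modulus Q \<mu> (connecting_curves E F)"
    using assms(9) unfolding Loewner_def by blast
  note \<theta>'_mono = homeomorphism_nonneg_reals[OF homeomorphism_symD[OF \<theta>]]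
  have \<theta>_nn: "\<theta> x \<ge> 0" and \<theta>'\<theta>: "\<theta>' (\<theta> x) = x" if "x \<ge> 0" for x
    using \<theta> that by (auto simp: homeomorphism_def)
  define k where "k = (\<lambda>t::real. 4 * t + 4 * t\<^sup>2)"
  have k_pos: "k t > 0" if "t > 0" for t using that by (auto simp: k_def intro: add_pos_pos)
  have k_mono: "k s \<le> k t" if "0 < s" "s \<le> t" for s t
    using that unfolding k_def by (intro add_mono mult_left_mono power_mono) auto
  have \<theta>'_le: "\<theta>' x \<le> \<theta>' y" if "0 \<le> x" "x \<le> y" for x y
    using monotone_onD[OF \<theta>'_mono(1), of x y] that by (cases "x = y") auto
  have \<theta>'_pos: "\<theta>' x > 0" if "x > 0" for x
    using monotone_onD[OF \<theta>'_mono(1), of 0 x] that \<theta>'_mono(2) by simp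
  \<comment> \<open>Solving \<open>1 \<le> k t * \<theta> (3 / D)\<close> for \<open>D\<close> with
    the increasing inverse \<open>\<theta>'\<close> gives
    \<open>D \<le> 3 / \<theta>' (1 / k t)\<close>. The maximum with 1 covers \<open>D < 1\<close>,
    where the distortion lemma does not apply.\<close>
  define \<Phi> where "\<Phi> = (\<lambda>t. max 1 (3 / \<theta>' (1 / k t)))"
  have \<Phi>_mono: "\<Phi> s \<le> \<Phi> t" if "0 < s" "s \<le> t" for s t
  proof -
    have "1 / k t \<le> 1 / k s" using k_mono[OF that] k_pos that by (intro divide_left_mono) auto
    moreover have "0 < 1 / k t" using k_pos that by simp
    ultimately have "\<theta>' (1 / k t) \<le> \<theta>' (1 / k s)" "0 < \<theta>' (1 / k t)" "0 < \<theta>' (1 / k s)"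
      by (intro \<theta>'_le \<theta>'_pos; linarith)+
    then have "3 / \<theta>' (1 / k s) \<le> 3 / \<theta>' (1 / k t)" by (intro divide_left_mono) auto
    then show ?thesis unfolding \<Phi>_def by (rule max.mono[OF order_refl])
  qed
  have \<Phi>_pos: "\<Phi> t > 0" for t by (simp add: \<Phi>_def less_max_iff_disj)
  define \<eta>' where "\<eta>' = (\<lambda>t. c * \<eta> (\<Phi> t))"
  show ?thesis unfolding Loewner_def
  proof (intro exI[of _ \<eta>'] conjI allI impI)
    show "\<eta>' t > 0" for t unfolding \<eta>'_def using c \<eta>(1) \<Phi>_pos by simp
    show "antimono_on {0<..} \<eta>'"
    proof (rule monotone_onI)
      fix s t :: real assume st: "s \<in> {0<..}" "t \<in> {0<..}" "s \<le> t"
      then have "\<eta> (\<Phi> t) \<le> \<eta> (\<Phi> s)"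
        using monotone_onD[OF \<eta>(2), of "\<Phi> s" "\<Phi> t"] \<Phi>_mono[of s t] \<Phi>_pos by simp
      then show "\<eta>' t \<le> \<eta>' s" unfolding \<eta>'_def using c by (intro mult_left_mono) auto
    qed
  next
    fix E' F' :: "'b set"
    assume E': "nondegenerate_continuum E'" and F': "nondegenerate_continuum F'" and disj': "E' \<inter> F' = {}"
    define E where "E = g ` E'"
    define F where "F = g ` F'"
    have E: "nondegenerate_continuum E" and F: "nondegenerate_continuum F"
      unfolding E_def F_def using E' F' cont(2) inj(2) by (auto intro: nondegenerate_continuum_image)
    have disj: "E \<inter> F = {}" using disj' inj(2) by (auto simp: E_def F_def inj_eq)
    have fEF: "f ` E = E'" "f ` F = F'" by (simp_all add: E_def F_def image_image fg)
    define D where "D = relative_distance E F"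
    define t where "t = relative_distance E' F'"
    have D: "D > 0" and t: "t > 0" unfolding D_def t_def using E F disj E' F' disj' by (auto intro: relative_distance_pos)
    have "D \<le> \<Phi> t"
    proof (cases "1 \<le> D")
      case True
      have "1 \<le> k t * \<theta> (3 / D)"
        using relative_distance_distortion[OF cont(1) inj(1) moebius E F disj] True
        unfolding fEF D_def t_def k_def by simp
      then have "1 / k t \<le> \<theta> (3 / D)" using k_pos[OF t] by (simp add: divide_le_eq mult.commute)
      then have "\<theta>' (1 / k t) \<le> \<theta>' (\<theta> (3 / D))" using k_pos[OF t] by (intro \<theta>'_le) auto
      also have "\<dots> = 3 / D" using D by (intro \<theta>'\<theta>) simp
      finally have "D \<le> 3 / \<theta>' (1 / k t)"
        using D \<theta>'_pos[of "1 / k t"] k_pos[OF t] by (simp add: field_simps)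
      then show ?thesis by (simp add: \<Phi>_def)
    qed (simp add: \<Phi>_def)
    then have "\<eta> (\<Phi> t) \<le> \<eta> D" using monotone_onD[OF \<eta>(2), of D "\<Phi> t"] D \<Phi>_pos by simp
    then have "ennreal (\<eta>' t) \<le> ennreal (c * \<eta> D)"
      unfolding \<eta>'_def using c by (intro ennreal_leI mult_left_mono) auto
    also have "\<dots> = ennreal c * ennreal (\<eta> D)" using c \<eta>(1)[OF D] by (intro ennreal_mult) auto
    also have "\<dots> \<le> ennreal c * modulus Q \<mu> (connecting_curves E F)"
      unfolding D_def by (intro mult_left_mono loewner E F disj) auto
    also have "\<dots> \<le> modulus Q \<nu> (connecting_curves E' F')" using modulus_le[OF E, of F] by (simp add: fEF)
    finally show "ennreal (\<eta>' (relative_distance E' F')) \<le> modulus Q \<nu> (connecting_curves E' F')"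
      by (simp add: t_def)
  qed
qed

end
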